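(* There exist simply connected, compact Riemannian manifolds that are not symmetric spaces, have sectional curvature $\sec\le 1$, and have the property that along every geodesic $\gamma$ there exists a normal Jacobi field $J$ with $\sec(\gamma'(t),J(t))=1$ for all $t$. Likewise, there exist simply connected, compact Riemannian manifolds that are not symmetric spaces, have sectional curvature $\sec\ge 1$, and have the property that along every geodesic $\gamma$ there exists a normal Jacobi field $J$ with $\sec(\gamma'(t),J(t))=1$ for all $t$.
   Context: All geodesics are parameterized by arc length. $\sec(X,Y)$ denotes the sectional curvature of the plane spanned by $X$ and $Y$. A normal Jacobi field along $\gamma$ is a Jacobi field orthogonal to $\gamma'$. *)

theory Defs
  imports "HOL-Analysis.Analysis"
begin

section \<open>Calculus in \<open>Euclidean_space n\<close>\<close>

text \<open>
  Coordinates live in \<open>nat \<Rightarrow> real\<close>; \<open>\<real>\<^sup>n\<close> is the library's \<open>Euclidean_space n\<close>, the functions that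
  vanish at all indices \<open>\<ge> n\<close>. This lets the dimension be an ordinary natural number.
\<close>

definition partial_deriv :: "nat \<Rightarrow> ((nat \<Rightarrow> real) \<Rightarrow> real) \<Rightarrow> (nat \<Rightarrow> real) \<Rightarrow> real" where
  "partial_deriv i f x = deriv (\<lambda>t. f (x(i := t))) (x i)"

definition has_partial_deriv :: "nat \<Rightarrow> ((nat \<Rightarrow> real) \<Rightarrow> real) \<Rightarrow> (nat \<Rightarrow> real) \<Rightarrow> bool" where
  "has_partial_deriv i f x \<longleftrightarrow> (\<lambda>t. f (x(i := t))) field_differentiable at (x i)"

text \<open>
  \<open>C\<^sup>\<infinity>\<close> on a set \<open>U\<close> that is open in \<open>\<real>\<^sup>n\<close>: all iterated partial derivatives, of every order and
  including order zero, exist and are continuous on \<open>U\<close>.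
\<close>

definition smooth_on :: "nat \<Rightarrow> (nat \<Rightarrow> real) set \<Rightarrow> ((nat \<Rightarrow> real) \<Rightarrow> real) \<Rightarrow> bool" where
  "smooth_on n U f \<longleftrightarrow>
     (\<forall>is. set is \<subseteq> {..<n} \<longrightarrow>
        continuous_on U (foldr partial_deriv is f) \<and>
        (\<forall>i<n. \<forall>x\<in>U. has_partial_deriv i (foldr partial_deriv is f) x))"


section \<open>Riemannian manifolds\<close>

text \<open>
  A chart is its domain together with its coordinate map. A tangent vector at \<open>p\<close> is given by its
  components \<open>v c k\<close> in every chart \<open>c\<close> around \<open>p\<close>, subject to the contravariant transformation
  law; it is \<open>0\<close> at all irrelevant arguments, so that equality of tangent vectors is equality of
  functions.
\<close>

type_synonym 'a chart = "'a set \<times> ('a \<Rightarrow> nat \<Rightarrow> real)"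
type_synonym 'a tangent = "'a chart \<Rightarrow> nat \<Rightarrow> real"

record 'a riemannian =
  points :: "'a set"
  mdim :: nat
  charts :: "'a chart set"
  metric :: "'a \<Rightarrow> 'a tangent \<Rightarrow> 'a tangent \<Rightarrow> real"

definition charts_at :: "'a riemannian \<Rightarrow> 'a \<Rightarrow> 'a chart set" where
  "charts_at M p = {c \<in> charts M. p \<in> fst c}"

definition chart_inv :: "'a chart \<Rightarrow> (nat \<Rightarrow> real) \<Rightarrow> 'a" where
  "chart_inv c = inv_into (fst c) (snd c)"

text \<open>
  The manifold is a subspace of the ambient type; being Hausdorff and second countable is inherited
  from the sort of \<open>'a\<close>. Choosing \<open>'a = nat \<Rightarrow> real\<close> with its product topology loses nothing: a second
  countable Hausdorff manifold is separable metrizable, so it is homeomorphic to a subspace of that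
  type by Urysohn's theorem. The metric below is not the one induced by the ambient type.
\<close>

definition smooth_manifold :: "'a::{t2_space, second_countable_topology} riemannian \<Rightarrow> bool" where
  "smooth_manifold M \<longleftrightarrow>
     points M \<noteq> {} \<and>
     points M = (\<Union>c\<in>charts M. fst c) \<and>
     (\<forall>c\<in>charts M.
        openin (top_of_set (points M)) (fst c) \<and>
        openin (Euclidean_space (mdim M)) (snd c ` fst c) \<and>
        homeomorphism (fst c) (snd c ` fst c) (snd c) (chart_inv c)) \<and>
     (\<forall>c\<in>charts M. \<forall>d\<in>charts M. \<forall>k<mdim M.
        smooth_on (mdim M) (snd c ` (fst c \<inter> fst d)) (\<lambda>x. snd d (chart_inv c x) k))"

definition tangent_space :: "'a riemannian \<Rightarrow> 'a \<Rightarrow> 'a tangent set" where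
  "tangent_space M p =
     {v. (\<forall>c k. \<not> (c \<in> charts_at M p \<and> k < mdim M) \<longrightarrow> v c k = 0) \<and>
         (\<forall>c\<in>charts_at M p. \<forall>d\<in>charts_at M p. \<forall>k<mdim M.
            v d k = (\<Sum>i<mdim M. partial_deriv i (\<lambda>x. snd d (chart_inv c x) k) (snd c p) * v c i))}"

definition tangent_zero :: "'a tangent" where
  "tangent_zero = (\<lambda>c k. 0)"

definition lincomb :: "real \<Rightarrow> 'a tangent \<Rightarrow> real \<Rightarrow> 'a tangent \<Rightarrow> 'a tangent" where
  "lincomb a v b w = (\<lambda>c k. a * v c k + b * w c k)"

definition lin_indep :: "'a tangent \<Rightarrow> 'a tangent \<Rightarrow> bool" where
  "lin_indep v w \<longleftrightarrow> (\<forall>a b. lincomb a v b w = tangent_zero \<longrightarrow> a = 0 \<and> b = 0)"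

text \<open>The coordinate vector \<open>\<partial>/\<partial>x\<^sub>i\<close> of the chart \<open>c\<close> at the point \<open>p\<close>.\<close>

definition coord_vec :: "'a riemannian \<Rightarrow> 'a chart \<Rightarrow> nat \<Rightarrow> 'a \<Rightarrow> 'a tangent" where
  "coord_vec M c i p = (\<lambda>d k.
     if d \<in> charts_at M p \<and> k < mdim M
     then partial_deriv i (\<lambda>x. snd d (chart_inv c x) k) (snd c p) else 0)"

definition metric_comp :: "'a riemannian \<Rightarrow> 'a chart \<Rightarrow> nat \<Rightarrow> nat \<Rightarrow> (nat \<Rightarrow> real) \<Rightarrow> real" where
  "metric_comp M c i j x =
     metric M (chart_inv c x) (coord_vec M c i (chart_inv c x)) (coord_vec M c j (chart_inv c x))"

definition riemannian_manifold :: "'a::{t2_space, second_countable_topology} riemannian \<Rightarrow> bool" where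
  "riemannian_manifold M \<longleftrightarrow>
     smooth_manifold M \<and>
     (\<forall>p\<in>points M.
        (\<forall>v\<in>tangent_space M p. \<forall>w\<in>tangent_space M p. metric M p v w = metric M p w v) \<and>
        (\<forall>u\<in>tangent_space M p. \<forall>v\<in>tangent_space M p. \<forall>w\<in>tangent_space M p. \<forall>a b.
           metric M p (lincomb a u b v) w = a * metric M p u w + b * metric M p v w) \<and>
        (\<forall>v\<in>tangent_space M p. v \<noteq> tangent_zero \<longrightarrow> metric M p v v > 0)) \<and>
     (\<forall>c\<in>charts M. \<forall>i<mdim M. \<forall>j<mdim M.
        smooth_on (mdim M) (snd c ` fst c) (metric_comp M c i j))"


section \<open>Levi-Civita connection and curvature\<close>

definition metric_inv :: "'a riemannian \<Rightarrow> 'a chart \<Rightarrow> (nat \<Rightarrow> real) \<Rightarrow> nat \<Rightarrow> nat \<Rightarrow> real" where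
  "metric_inv M c x = (THE h.
     (\<forall>i j. \<not> (i < mdim M \<and> j < mdim M) \<longrightarrow> h i j = 0) \<and>
     (\<forall>i<mdim M. \<forall>j<mdim M. (\<Sum>k<mdim M. metric_comp M c i k x * h k j) = (if i = j then 1 else 0)))"

text \<open>\<open>christoffel M c k i j\<close> is \<open>\<Gamma>\<^sup>k\<^sub>i\<^sub>j\<close> in the chart \<open>c\<close>.\<close>

definition christoffel ::
    "'a riemannian \<Rightarrow> 'a chart \<Rightarrow> nat \<Rightarrow> nat \<Rightarrow> nat \<Rightarrow> (nat \<Rightarrow> real) \<Rightarrow> real" where
  "christoffel M c k i j x =
     (\<Sum>l<mdim M. metric_inv M c x k l *
        (partial_deriv i (metric_comp M c j l) x + partial_deriv j (metric_comp M c i l) x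
         - partial_deriv l (metric_comp M c i j) x)) / 2"

text \<open>The \<open>l\<close>-th component of \<open>R(\<partial>\<^sub>i, \<partial>\<^sub>j) \<partial>\<^sub>k\<close>, where \<open>R(X,Y)Z = \<nabla>\<^sub>X \<nabla>\<^sub>Y Z - \<nabla>\<^sub>Y \<nabla>\<^sub>X Z - \<nabla>\<^bsub>[X,Y]\<^esub> Z\<close>.\<close>

definition curv_comp ::
    "'a riemannian \<Rightarrow> 'a chart \<Rightarrow> nat \<Rightarrow> nat \<Rightarrow> nat \<Rightarrow> nat \<Rightarrow> (nat \<Rightarrow> real) \<Rightarrow> real" where
  "curv_comp M c i j k l x =
     partial_deriv i (christoffel M c l j k) x - partial_deriv j (christoffel M c l i k) x
     + (\<Sum>m<mdim M. christoffel M c l i m x * christoffel M c m j k x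
                   - christoffel M c l j m x * christoffel M c m i k x)"

definition curvature ::
    "'a riemannian \<Rightarrow> 'a \<Rightarrow> 'a tangent \<Rightarrow> 'a tangent \<Rightarrow> 'a tangent \<Rightarrow> 'a tangent" where
  "curvature M p u v w = (\<lambda>c l.
     if c \<in> charts_at M p \<and> l < mdim M
     then \<Sum>i<mdim M. \<Sum>j<mdim M. \<Sum>k<mdim M.
            curv_comp M c i j k l (snd c p) * u c i * v c j * w c k
     else 0)"

text \<open>Only meaningful for linearly independent \<open>v\<close>, \<open>w\<close>; otherwise the denominator is \<open>0\<close>.\<close>

definition sec :: "'a riemannian \<Rightarrow> 'a \<Rightarrow> 'a tangent \<Rightarrow> 'a tangent \<Rightarrow> real" where
  "sec M p v w =
     metric M p (curvature M p v w w) v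
     / (metric M p v v * metric M p w w - (metric M p v w)\<^sup>2)"

definition sec_le :: "'a riemannian \<Rightarrow> real \<Rightarrow> bool" where
  "sec_le M \<kappa> \<longleftrightarrow>
     (\<forall>p\<in>points M. \<forall>v\<in>tangent_space M p. \<forall>w\<in>tangent_space M p. lin_indep v w \<longrightarrow> sec M p v w \<le> \<kappa>)"

definition sec_ge :: "'a riemannian \<Rightarrow> real \<Rightarrow> bool" where
  "sec_ge M \<kappa> \<longleftrightarrow>
     (\<forall>p\<in>points M. \<forall>v\<in>tangent_space M p. \<forall>w\<in>tangent_space M p. lin_indep v w \<longrightarrow> sec M p v w \<ge> \<kappa>)"


section \<open>Geodesics and Jacobi fields\<close>

text \<open>Curves and fields along them are defined on an open interval \<open>I\<close>, possibly all of \<open>\<real>\<close>.\<close>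

definition smooth_curve :: "'a::topological_space riemannian \<Rightarrow> real set \<Rightarrow> (real \<Rightarrow> 'a) \<Rightarrow> bool" where
  "smooth_curve M I \<gamma> \<longleftrightarrow>
     open I \<and> is_interval I \<and> I \<noteq> {} \<and> \<gamma> ` I \<subseteq> points M \<and> continuous_on I \<gamma> \<and>
     (\<forall>t\<in>I. \<forall>c\<in>charts_at M (\<gamma> t). \<forall>k<mdim M. \<forall>m.
        (deriv ^^ m) (\<lambda>s. snd c (\<gamma> s) k) field_differentiable at t)"

definition velocity :: "'a riemannian \<Rightarrow> (real \<Rightarrow> 'a) \<Rightarrow> real \<Rightarrow> 'a tangent" where
  "velocity M \<gamma> t = (\<lambda>c k.
     if c \<in> charts_at M (\<gamma> t) \<and> k < mdim M then deriv (\<lambda>s. snd c (\<gamma> s) k) t else 0)"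

definition smooth_field_along ::
    "'a riemannian \<Rightarrow> real set \<Rightarrow> (real \<Rightarrow> 'a) \<Rightarrow> (real \<Rightarrow> 'a tangent) \<Rightarrow> bool" where
  "smooth_field_along M I \<gamma> V \<longleftrightarrow>
     (\<forall>t\<in>I. V t \<in> tangent_space M (\<gamma> t) \<and>
        (\<forall>c\<in>charts_at M (\<gamma> t). \<forall>k<mdim M. \<forall>m.
           (deriv ^^ m) (\<lambda>s. V s c k) field_differentiable at t))"

text \<open>The covariant derivative \<open>D V / dt\<close> of a field \<open>V\<close> along \<open>\<gamma>\<close>.\<close>

definition cov_deriv ::
    "'a riemannian \<Rightarrow> (real \<Rightarrow> 'a) \<Rightarrow> (real \<Rightarrow> 'a tangent) \<Rightarrow> real \<Rightarrow> 'a tangent" where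
  "cov_deriv M \<gamma> V t = (\<lambda>c k.
     if c \<in> charts_at M (\<gamma> t) \<and> k < mdim M
     then deriv (\<lambda>s. V s c k) t
          + (\<Sum>i<mdim M. \<Sum>j<mdim M.
               christoffel M c k i j (snd c (\<gamma> t)) * velocity M \<gamma> t c i * V t c j)
     else 0)"

definition unit_geodesic :: "'a::topological_space riemannian \<Rightarrow> real set \<Rightarrow> (real \<Rightarrow> 'a) \<Rightarrow> bool" where
  "unit_geodesic M I \<gamma> \<longleftrightarrow>
     smooth_curve M I \<gamma> \<and>
     (\<forall>t\<in>I. cov_deriv M \<gamma> (velocity M \<gamma>) t = tangent_zero \<and>
            metric M (\<gamma> t) (velocity M \<gamma> t) (velocity M \<gamma> t) = 1)"

definition jacobi_field ::
    "'a riemannian \<Rightarrow> real set \<Rightarrow> (real \<Rightarrow> 'a) \<Rightarrow> (real \<Rightarrow> 'a tangent) \<Rightarrow> bool" where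
  "jacobi_field M I \<gamma> J \<longleftrightarrow>
     smooth_field_along M I \<gamma> J \<and>
     (\<forall>t\<in>I. lincomb 1 (cov_deriv M \<gamma> (cov_deriv M \<gamma> J) t)
                    1 (curvature M (\<gamma> t) (J t) (velocity M \<gamma> t) (velocity M \<gamma> t)) = tangent_zero)"

definition normal_jacobi_field ::
    "'a riemannian \<Rightarrow> real set \<Rightarrow> (real \<Rightarrow> 'a) \<Rightarrow> (real \<Rightarrow> 'a tangent) \<Rightarrow> bool" where
  "normal_jacobi_field M I \<gamma> J \<longleftrightarrow>
     jacobi_field M I \<gamma> J \<and> (\<forall>t\<in>I. metric M (\<gamma> t) (J t) (velocity M \<gamma> t) = 0)"


section \<open>Isometries and symmetric spaces\<close>

definition smooth_self_map :: "'a::topological_space riemannian \<Rightarrow> ('a \<Rightarrow> 'a) \<Rightarrow> bool" where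
  "smooth_self_map M f \<longleftrightarrow>
     f ` points M \<subseteq> points M \<and> continuous_on (points M) f \<and>
     (\<forall>c\<in>charts M. \<forall>d\<in>charts M. \<forall>k<mdim M.
        smooth_on (mdim M) (snd c ` (fst c \<inter> f -` fst d)) (\<lambda>x. snd d (f (chart_inv c x)) k))"

text \<open>The choice of the source chart does not matter, by the chain rule.\<close>

definition differential :: "'a riemannian \<Rightarrow> ('a \<Rightarrow> 'a) \<Rightarrow> 'a \<Rightarrow> 'a tangent \<Rightarrow> 'a tangent" where
  "differential M f p v =
     (let c = (SOME c. c \<in> charts_at M p)
      in (\<lambda>d k. if d \<in> charts_at M (f p) \<and> k < mdim M
                then \<Sum>i<mdim M. partial_deriv i (\<lambda>x. snd d (f (chart_inv c x)) k) (snd c p) * v c i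
                else 0))"

definition isometry :: "'a::topological_space riemannian \<Rightarrow> ('a \<Rightarrow> 'a) \<Rightarrow> bool" where
  "isometry M f \<longleftrightarrow>
     bij_betw f (points M) (points M) \<and>
     smooth_self_map M f \<and> smooth_self_map M (inv_into (points M) f) \<and>
     (\<forall>p\<in>points M. \<forall>v\<in>tangent_space M p. \<forall>w\<in>tangent_space M p.
        metric M (f p) (differential M f p v) (differential M f p w) = metric M p v w)"

text \<open>Every point \<open>p\<close> has a geodesic symmetry: a global isometry fixing \<open>p\<close> with differential \<open>-id\<close>.\<close>

definition symmetric_space :: "'a::topological_space riemannian \<Rightarrow> bool" where
  "symmetric_space M \<longleftrightarrow>
     (\<forall>p\<in>points M. \<exists>s. isometry M s \<and> s p = p \<and>
        (\<forall>v\<in>tangent_space M p. differential M s p v = lincomb (- 1) v 0 v))"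

end

theory Submission
  imports Defs
begin

text \<open>
  The examples are Berger spheres: left-invariant metrics on the unit quaternions for which the frame
  \<open>x i\<close>, \<open>x j\<close>, \<open>\<xi> = x k\<close> is orthogonal with squared lengths \<open>\<mu>\<close>, \<open>\<mu>\<close>, \<open>\<mu>\<^sup>2\<close>. All planes containing \<open>\<xi>\<close> have
  curvature 1, and the plane orthogonal to \<open>\<xi>\<close> has curvature \<open>4 / \<mu> - 3\<close>; so \<open>sec \<le> 1\<close> for \<open>\<mu> \<ge> 1\<close> and
  \<open>sec \<ge> 1\<close> for \<open>\<mu> \<le> 1\<close>. As \<open>\<xi>\<close> is a Killing field, the part of \<open>\<xi>\<close> orthogonal to \<open>\<gamma>'\<close> is a Jacobi field
  along a geodesic \<open>\<gamma>\<close>, and it spans with \<open>\<gamma>'\<close> a plane containing \<open>\<xi>\<close>. If \<open>\<gamma>'\<close> is parallel to \<open>\<xi>\<close>, a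
  right-invariant field does the same. For \<open>\<mu> \<noteq> 1\<close> isometries preserve \<open>\<xi>\<close> up to sign, which
  rules out geodesic symmetries.
\<close>

section \<open>Calculus in coordinates\<close>

text \<open>Christoffel symbols and curvature are defined in coordinates, where direct computation
  is unwieldy. In an orthogonal frame with constant connection coefficients the curvature is a
  quadratic expression in these constants (\<open>Rc\<close>), and the geodesic and Jacobi equations
  become ordinary differential equations for coefficient triples. The frame calculus is set up for
  an abstract coframe on an open set because it is applied twice: to the left-invariant coframe, and
  to its pullback under an isometry. The length of \<xi> is forced: with horizontal squared length a
  and vertical squared length b, planes containing \<xi> have curvature
  \<open>b / a\<^sup>2\<close>, which is normalised to 1. The field \<xi> is Killing because the two
  horizontal weights agree, so that right multiplication by exp(t k) is isometric; right-invariant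
  fields are Killing because they generate left translations. Isometries preserve \<xi> up to sign
  because it spans the eigenspace of the Ricci tensor for the eigenvalue 2, the other eigenvalue
  being \<open>4 / \<mu> - 2\<close>.\<close>

lemma openin_Euclidean_space_iff:
  "openin (Euclidean_space n) U \<longleftrightarrow> (\<exists>T. open T \<and> U = T \<inter> {x. \<forall>i\<ge>n. x i = 0})"
  by (auto simp: Euclidean_space_def openin_subtopology euclidean_product_topology)

lemma openin_Euclidean_space_zero:
  assumes "openin (Euclidean_space n) U" "x \<in> U" "n \<le> i"
  shows "x i = 0"
  using assms by (auto simp: openin_Euclidean_space_iff)

text \<open>A basic open set of the product topology restricts finitely many coordinates only, so
  finitely many eventualities have to be combined.\<close>

lemma eventually_in_open_fun:
  fixes x :: "nat \<Rightarrow> real"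
  assumes "open T" "x \<in> T" "\<And>i. ((\<lambda>s. \<gamma> s i) \<longlongrightarrow> x i) F"
  shows "eventually (\<lambda>s. \<gamma> s \<in> T) F"
proof -
  have "openin (product_topology (\<lambda>i. euclidean) UNIV) T"
    using assms(1) by (simp add: open_fun_def)
  from product_topology_open_contains_basis[OF this assms(2)]
  obtain X where X: "x \<in> Pi\<^sub>E UNIV X" "\<And>i. open (X i)" "finite {i. X i \<noteq> UNIV}" "Pi\<^sub>E UNIV X \<subseteq> T"
    by auto
  have "eventually (\<lambda>s. \<forall>i\<in>{i. X i \<noteq> UNIV}. \<gamma> s i \<in> X i) F"
  proof (rule eventually_ball_finite[OF X(3)], rule ballI)
    fix i
    have "x i \<in> X i" using X(1) by auto
    then show "eventually (\<lambda>s. \<gamma> s i \<in> X i) F"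
      using topological_tendstoD[OF assms(3) X(2)] by blast
  qed
  then show ?thesis
  proof (rule eventually_mono)
    fix s assume "\<forall>i\<in>{i. X i \<noteq> UNIV}. \<gamma> s i \<in> X i"
    then have "\<gamma> s i \<in> X i" for i by (cases "X i = UNIV") auto
    then show "\<gamma> s \<in> T" using X(4) by auto
  qed
qed

lemma tendsto_fun_iff:
  fixes x :: "nat \<Rightarrow> real"
  shows "(\<gamma> \<longlongrightarrow> x) F \<longleftrightarrow> (\<forall>i. ((\<lambda>s. \<gamma> s i) \<longlongrightarrow> x i) F)"
proof
  assume "(\<gamma> \<longlongrightarrow> x) F"
  moreover have "isCont (\<lambda>x::nat\<Rightarrow>real. x i) x" for i
    by (rule continuous_on_interior[OF continuous_on_product_coordinates]) simp
  ultimately show "\<forall>i. ((\<lambda>s. \<gamma> s i) \<longlongrightarrow> x i) F"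
    using isCont_tendsto_compose[where F = F and f = \<gamma> and l = x] by blast
next
  assume *: "\<forall>i. ((\<lambda>s. \<gamma> s i) \<longlongrightarrow> x i) F"
  show "(\<gamma> \<longlongrightarrow> x) F"
    by (rule topological_tendstoI, rule eventually_in_open_fun) (use * in blast)+
qed

text \<open>The curve vanishes at all indices from \<open>n\<close> on, as \<open>x\<close> does, so
  convergence has to be supplied for the first \<open>n\<close> coordinates only.\<close>

lemma eventually_in_openin_Euclidean_space:
  assumes "openin (Euclidean_space n) U" "x \<in> U" "\<And>i. i < n \<Longrightarrow> ((\<lambda>s. \<gamma> s i) \<longlongrightarrow> x i) F"
    and "\<And>s i. n \<le> i \<Longrightarrow> \<gamma> s i = 0"
  shows "eventually (\<lambda>s. \<gamma> s \<in> U) F"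
proof -
  obtain T where T: "open T" "U = T \<inter> {x. \<forall>i\<ge>n. x i = 0}"
    using assms(1) by (auto simp: openin_Euclidean_space_iff)
  have "((\<lambda>s. \<gamma> s i) \<longlongrightarrow> x i) F" for i
  proof (cases "i < n")
    case False
    then have "x i = 0" "(\<lambda>s. \<gamma> s i) = (\<lambda>s. 0)" using assms(2,4) T by (auto simp: fun_eq_iff)
    then show ?thesis by simp
  qed (use assms(3) in blast)
  then have "eventually (\<lambda>s. \<gamma> s \<in> T) F"
    using T assms(2) by (intro eventually_in_open_fun[of T x]) auto
  then show ?thesis
    by (rule eventually_mono) (use T assms(4) in auto)
qed

text \<open>Moving a coordinate below \<open>n\<close> does not leave the n-dimensional space. This
  makes relative openness of \<open>U\<close> enough for partial derivatives to be local.\<close>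

lemma eventually_slice:
  assumes "openin (Euclidean_space n) U" "x \<in> U" "i < n"
  shows "eventually (\<lambda>t. x(i := t) \<in> U) (nhds (x i))"
proof (rule eventually_in_openin_Euclidean_space[OF assms(1,2)])
  show "((\<lambda>s. (x(i := s)) j) \<longlongrightarrow> x j) (nhds (x i))" for j
    by (cases "j = i") (auto simp: filterlim_ident)
  show "(x(i := s)) j = 0" if "n \<le> j" for s j
    using that assms openin_Euclidean_space_zero by fastforce
qed

section \<open>Rules for partial derivatives\<close>

lemma has_partial_deriv_iff:
  "has_partial_deriv i f x \<longleftrightarrow> ((\<lambda>t. f (x(i := t))) has_real_derivative partial_deriv i f x) (at (x i))"
  unfolding has_partial_deriv_def partial_deriv_def
  using DERIV_deriv_iff_field_differentiable by blast

lemma partial_derivI: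
  assumes "((\<lambda>t. f (x(i := t))) has_real_derivative D) (at (x i))"
  shows "partial_deriv i f x = D" "has_partial_deriv i f x"
  using assms by (auto simp: partial_deriv_def has_partial_deriv_def field_differentiable_def
      intro: DERIV_imp_deriv)

lemma partial_deriv_cong:
  assumes "openin (Euclidean_space n) U" "x \<in> U" "i < n" "\<And>y. y \<in> U \<Longrightarrow> f y = g y"
  shows "partial_deriv i f x = partial_deriv i g x" "has_partial_deriv i f x \<longleftrightarrow> has_partial_deriv i g x"
proof -
  have e: "eventually (\<lambda>t. f (x(i := t)) = g (x(i := t))) (nhds (x i))"
    using eventually_slice[OF assms(1-3)] by (rule eventually_mono) (use assms(4) in auto)
  show "partial_deriv i f x = partial_deriv i g x"
    unfolding partial_deriv_def by (rule deriv_cong_ev[OF e]) simp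
  show "has_partial_deriv i f x \<longleftrightarrow> has_partial_deriv i g x"
    unfolding has_partial_deriv_def field_differentiable_def
    using DERIV_cong_ev[OF refl e refl] by blast
qed

lemma partial_deriv_const:
  "has_partial_deriv i (\<lambda>x. c) x" "partial_deriv i (\<lambda>x. c) x = 0"
  using partial_derivI[of "\<lambda>x. c" x i 0] by auto

lemma partial_deriv_coord:
  "has_partial_deriv i (\<lambda>x. x j) x" "partial_deriv i (\<lambda>x. x j) x = (if i = j then 1 else 0)"
  using partial_derivI[of "\<lambda>x. x j" x i "if i = j then 1 else 0"] by auto

lemma partial_deriv_add:
  assumes "has_partial_deriv i f x" "has_partial_deriv i g x"
  shows "partial_deriv i (\<lambda>x. f x + g x) x = partial_deriv i f x + partial_deriv i g x"
    "has_partial_deriv i (\<lambda>x. f x + g x) x"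
  using partial_derivI[OF DERIV_add[OF assms[unfolded has_partial_deriv_iff]]] by auto

lemma partial_deriv_mult:
  assumes "has_partial_deriv i f x" "has_partial_deriv i g x"
  shows "partial_deriv i (\<lambda>x. f x * g x) x = partial_deriv i f x * g x + f x * partial_deriv i g x"
    "has_partial_deriv i (\<lambda>x. f x * g x) x"
  using partial_derivI[OF DERIV_mult[OF assms[unfolded has_partial_deriv_iff]]] by auto

lemma partial_deriv_inverse:
  assumes "has_partial_deriv i f x" "f x \<noteq> 0"
  shows "partial_deriv i (\<lambda>x. inverse (f x)) x = - partial_deriv i f x * (inverse (f x) * inverse (f x))"
    "has_partial_deriv i (\<lambda>x. inverse (f x)) x"
proof -
  have "((\<lambda>t. inverse (f (x(i := t)))) has_real_derivative
     - (inverse (f x) * partial_deriv i f x * inverse (f x))) (at (x i))"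
    using DERIV_inverse'[OF assms(1)[unfolded has_partial_deriv_iff]] assms(2) by simp
  from partial_derivI[OF this]
  show "partial_deriv i (\<lambda>x. inverse (f x)) x = - partial_deriv i f x * (inverse (f x) * inverse (f x))"
    "has_partial_deriv i (\<lambda>x. inverse (f x)) x" by auto
qed

lemma partial_deriv_sum:
  assumes "finite A" "\<And>a. a \<in> A \<Longrightarrow> has_partial_deriv i (f a) x"
  shows "partial_deriv i (\<lambda>x. \<Sum>a\<in>A. f a x) x = (\<Sum>a\<in>A. partial_deriv i (f a) x)"
    "has_partial_deriv i (\<lambda>x. \<Sum>a\<in>A. f a x) x"
proof -
  have "((\<lambda>t. \<Sum>a\<in>A. f a (x(i := t))) has_real_derivative (\<Sum>a\<in>A. partial_deriv i (f a) x)) (at (x i))"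
    using assms by (intro DERIV_sum) (auto simp: has_partial_deriv_iff)
  from partial_derivI[OF this]
  show "partial_deriv i (\<lambda>x. \<Sum>a\<in>A. f a x) x = (\<Sum>a\<in>A. partial_deriv i (f a) x)"
    "has_partial_deriv i (\<lambda>x. \<Sum>a\<in>A. f a x) x" by auto
qed

lemma partial_deriv_sum_mult:
  assumes "finite A" "\<And>a. a \<in> A \<Longrightarrow> has_partial_deriv i (f a) x" "\<And>a. a \<in> A \<Longrightarrow> has_partial_deriv i (g a) x"
  shows "partial_deriv i (\<lambda>x. \<Sum>a\<in>A. f a x * g a x) x
    = (\<Sum>a\<in>A. partial_deriv i (f a) x * g a x + f a x * partial_deriv i (g a) x)"
    "has_partial_deriv i (\<lambda>x. \<Sum>a\<in>A. f a x * g a x) x"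
proof -
  have "partial_deriv i (\<lambda>x. \<Sum>a\<in>A. f a x * g a x) x = (\<Sum>a\<in>A. partial_deriv i (\<lambda>x. f a x * g a x) x)"
    using assms by (intro partial_deriv_sum partial_deriv_mult) auto
  also have "\<dots> = (\<Sum>a\<in>A. partial_deriv i (f a) x * g a x + f a x * partial_deriv i (g a) x)"
    using assms by (intro sum.cong partial_deriv_mult) auto
  finally show "partial_deriv i (\<lambda>x. \<Sum>a\<in>A. f a x * g a x) x
    = (\<Sum>a\<in>A. partial_deriv i (f a) x * g a x + f a x * partial_deriv i (g a) x)" .
  show "has_partial_deriv i (\<lambda>x. \<Sum>a\<in>A. f a x * g a x) x"
    using assms by (intro partial_deriv_sum partial_deriv_mult) auto
qed

section \<open>Smooth functions and their closure properties\<close>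

lemma smooth_on_imp_continuous_on: "smooth_on n U f \<Longrightarrow> continuous_on U f"
  unfolding smooth_on_def by (metis empty_set empty_subsetI foldr.simps(1) id_apply)

lemma smooth_on_imp_has_partial_deriv:
  assumes "smooth_on n U f" "i < n" "x \<in> U"
  shows "has_partial_deriv i f x"
  using assms unfolding smooth_on_def by (metis empty_set empty_subsetI foldr.simps(1) id_apply)

lemma smooth_on_partial_deriv:
  assumes "smooth_on n U f" "i < n"
  shows "smooth_on n U (partial_deriv i f)"
  unfolding smooth_on_def
proof (intro allI impI)
  fix "is" assume "set is \<subseteq> {..<n}"
  then show "continuous_on U (foldr partial_deriv is (partial_deriv i f)) \<and>
    (\<forall>j<n. \<forall>x\<in>U. has_partial_deriv j (foldr partial_deriv is (partial_deriv i f)) x)"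
    using assms(1)[unfolded smooth_on_def, THEN spec[of _ "is @ [i]"]] assms(2) by simp
qed

text \<open>Smoothness is the largest property that implies continuity and partial differentiability
  and passes to partial derivatives. The derivative need only agree on \<open>U\<close> with a
  member of the class, since explicit formulas for it are valid only there.\<close>

lemma smooth_on_coinduct:
  assumes U: "openin (Euclidean_space n) U" and f: "P f"
    and cont: "\<And>f. P f \<Longrightarrow> continuous_on U f"
    and has: "\<And>f i x. P f \<Longrightarrow> i < n \<Longrightarrow> x \<in> U \<Longrightarrow> has_partial_deriv i f x"
    and closed: "\<And>f i. P f \<Longrightarrow> i < n \<Longrightarrow> \<exists>g. P g \<and> (\<forall>x\<in>U. partial_deriv i f x = g x)"
  shows "smooth_on n U f"
proof -
  have *: "\<exists>g. P g \<and> (\<forall>x\<in>U. foldr partial_deriv is f x = g x)" if "set is \<subseteq> {..<n}" for "is"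
    using that
  proof (induction "is")
    case Nil
    then show ?case using f by auto
  next
    case (Cons i "is")
    then obtain g where g: "P g" "\<forall>x\<in>U. foldr partial_deriv is f x = g x" by auto
    obtain h where h: "P h" "\<forall>x\<in>U. partial_deriv i g x = h x"
      using closed[OF g(1), of i] Cons.prems by auto
    have "partial_deriv i (foldr partial_deriv is f) x = partial_deriv i g x" if "x \<in> U" for x
      by (rule partial_deriv_cong(1)[OF U that]) (use g(2) Cons.prems in simp_all)
    with h show ?case by (intro exI[of _ h]) simp
  qed
  show ?thesis
    unfolding smooth_on_def
  proof (intro allI impI conjI ballI)
    fix "is" assume "set is \<subseteq> {..<n}"
    from *[OF this] obtain g where g: "P g" "\<And>x. x \<in> U \<Longrightarrow> foldr partial_deriv is f x = g x" by auto
    show "continuous_on U (foldr partial_deriv is f)"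
      using cont[OF g(1)] g(2) by (simp cong: continuous_on_cong)
    show "has_partial_deriv i (foldr partial_deriv is f) x" if "i < n" "x \<in> U" for i x
      using partial_deriv_cong(2)[OF U that(2,1) g(2)] has[OF g(1) that] by simp
  qed
qed

lemma smooth_on_cong:
  assumes "openin (Euclidean_space n) U" "\<And>x. x \<in> U \<Longrightarrow> f x = g x" "smooth_on n U g"
  shows "smooth_on n U f"
proof (rule smooth_on_coinduct[OF assms(1), where P = "\<lambda>f. \<exists>g. smooth_on n U g \<and> (\<forall>x\<in>U. f x = g x)"])
  show "\<exists>g. smooth_on n U g \<and> (\<forall>x\<in>U. f x = g x)" using assms by blast
next
  fix f assume "\<exists>g. smooth_on n U g \<and> (\<forall>x\<in>U. f x = g x)"
  then obtain g where g: "smooth_on n U g" "\<And>x. x \<in> U \<Longrightarrow> f x = g x" by auto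
  show "continuous_on U f"
    using smooth_on_imp_continuous_on[OF g(1)] g(2) by (simp cong: continuous_on_cong)
  show "has_partial_deriv i f x" if "i < n" "x \<in> U" for i x
    using partial_deriv_cong(2)[OF assms(1) that(2,1) g(2)] smooth_on_imp_has_partial_deriv[OF g(1) that] by simp
  show "\<exists>h. (\<exists>g. smooth_on n U g \<and> (\<forall>x\<in>U. h x = g x)) \<and> (\<forall>x\<in>U. partial_deriv i f x = h x)" if "i < n" for i
  proof (intro exI conjI ballI)
    show "smooth_on n U (partial_deriv i g)" by (rule smooth_on_partial_deriv[OF g(1) that])
    show "partial_deriv i f x = partial_deriv i g x" if "x \<in> U" for x
      by (rule partial_deriv_cong(1)[OF assms(1) that \<open>i < n\<close> g(2)])
  qed simp
qed

text \<open>The product rule turns a product into a sum of products, so no single operation gives a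
  class closed under differentiation. Closing under all operations at once does, and
  \<open>smooth_on_coinduct\<close> then applies.\<close>

inductive_set smooth_closure :: "nat \<Rightarrow> (nat \<Rightarrow> real) set \<Rightarrow> ((nat \<Rightarrow> real) \<Rightarrow> real) set"
  for n U where
  base: "smooth_on n U f \<Longrightarrow> f \<in> smooth_closure n U"
| const: "(\<lambda>x. c) \<in> smooth_closure n U"
| coord: "(\<lambda>x. x j) \<in> smooth_closure n U"
| add: "f \<in> smooth_closure n U \<Longrightarrow> g \<in> smooth_closure n U \<Longrightarrow> (\<lambda>x. f x + g x) \<in> smooth_closure n U"
| mult: "f \<in> smooth_closure n U \<Longrightarrow> g \<in> smooth_closure n U \<Longrightarrow> (\<lambda>x. f x * g x) \<in> smooth_closure n U"
| inv: "f \<in> smooth_closure n U \<Longrightarrow> (\<And>x. x \<in> U \<Longrightarrow> f x \<noteq> 0) \<Longrightarrow> (\<lambda>x. inverse (f x)) \<in> smooth_closure n U"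

lemma smooth_closure_derivs:
  assumes "f \<in> smooth_closure n U"
  shows "continuous_on U f \<and> (\<forall>i<n. (\<forall>x\<in>U. has_partial_deriv i f x) \<and>
    (\<exists>g\<in>smooth_closure n U. \<forall>x\<in>U. partial_deriv i f x = g x))"
  using assms
proof (induction rule: smooth_closure.induct)
  case (base f)
  then show ?case
    using smooth_on_imp_continuous_on smooth_on_imp_has_partial_deriv smooth_on_partial_deriv
      smooth_closure.base by blast
next
  case (const c)
  show ?case by (auto simp: partial_deriv_const intro!: bexI[OF _ smooth_closure.const])
next
  case (coord j)
  have "\<exists>g\<in>smooth_closure n U. \<forall>x\<in>U. partial_deriv i (\<lambda>x. x j) x = g x" for i
    unfolding partial_deriv_coord by (rule bexI[OF _ smooth_closure.const[of "if i = j then 1 else 0"]]) auto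
  moreover have "continuous_on U (\<lambda>x. x j)"
    by (rule continuous_on_subset[OF continuous_on_product_coordinates]) simp
  ultimately show ?case by (auto simp: partial_deriv_coord(1))
next
  case (add f g)
  then have "\<exists>h\<in>smooth_closure n U. \<forall>x\<in>U. partial_deriv i (\<lambda>x. f x + g x) x = h x" if "i < n" for i
    using that by (metis (no_types, lifting) partial_deriv_add(1) smooth_closure.add)
  with add show ?case by (auto intro!: continuous_intros partial_deriv_add)
next
  case (mult f g)
  have "\<exists>h\<in>smooth_closure n U. \<forall>x\<in>U. partial_deriv i (\<lambda>x. f x * g x) x = h x" if i: "i < n" for i
  proof -
    obtain f' g' where "f' \<in> smooth_closure n U" "\<forall>x\<in>U. partial_deriv i f x = f' x"
      "g' \<in> smooth_closure n U" "\<forall>x\<in>U. partial_deriv i g x = g' x"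
      using mult i by meson
    with mult i show ?thesis
      using smooth_closure.add[OF smooth_closure.mult[of f' n U g] smooth_closure.mult[of f n U g']]
      by (intro bexI[where x = "\<lambda>x. f' x * g x + f x * g' x"]) (auto simp: partial_deriv_mult)
  qed
  with mult show ?case by (auto intro!: continuous_intros partial_deriv_mult)
next
  case (inv f)
  have "\<exists>h\<in>smooth_closure n U. \<forall>x\<in>U. partial_deriv i (\<lambda>x. inverse (f x)) x = h x" if i: "i < n" for i
  proof -
    obtain f' where "f' \<in> smooth_closure n U" "\<forall>x\<in>U. partial_deriv i f x = f' x"
      using inv i by meson
    with inv i show ?thesis
      using smooth_closure.mult[OF smooth_closure.mult[OF smooth_closure.const[of "- 1"], of f' n U]
          smooth_closure.mult[OF smooth_closure.inv[of f n U] smooth_closure.inv[of f n U]]]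
      by (intro bexI[where x = "\<lambda>x. ((- 1) * f' x) * (inverse (f x) * inverse (f x))"])
        (auto simp: partial_deriv_inverse)
  qed
  with inv show ?case by (auto intro!: continuous_intros partial_deriv_inverse)
qed

lemma smooth_on_smooth_closure:
  assumes "openin (Euclidean_space n) U" "f \<in> smooth_closure n U"
  shows "smooth_on n U f"
  using assms(2) smooth_closure_derivs
  by (intro smooth_on_coinduct[OF assms(1), where P = "\<lambda>f. f \<in> smooth_closure n U"]) blast+

context
  fixes n U assumes U: "openin (Euclidean_space n) U"
begin

lemma smooth_on_const: "smooth_on n U (\<lambda>x. c)"
  by (rule smooth_on_smooth_closure[OF U smooth_closure.const])

lemma smooth_on_coord: "smooth_on n U (\<lambda>x. x j)"
  by (rule smooth_on_smooth_closure[OF U smooth_closure.coord])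

lemma smooth_on_add:
  "smooth_on n U f \<Longrightarrow> smooth_on n U g \<Longrightarrow> smooth_on n U (\<lambda>x. f x + g x)"
  by (rule smooth_on_smooth_closure[OF U smooth_closure.add[OF smooth_closure.base smooth_closure.base]])

lemma smooth_on_mult:
  "smooth_on n U f \<Longrightarrow> smooth_on n U g \<Longrightarrow> smooth_on n U (\<lambda>x. f x * g x)"
  by (rule smooth_on_smooth_closure[OF U smooth_closure.mult[OF smooth_closure.base smooth_closure.base]])

lemma smooth_on_inverse:
  "smooth_on n U f \<Longrightarrow> (\<And>x. x \<in> U \<Longrightarrow> f x \<noteq> 0) \<Longrightarrow> smooth_on n U (\<lambda>x. inverse (f x))"
  by (rule smooth_on_smooth_closure[OF U smooth_closure.inv[OF smooth_closure.base]])

lemma smooth_on_uminus: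
  "smooth_on n U f \<Longrightarrow> smooth_on n U (\<lambda>x. - f x)"
  using smooth_on_mult[OF smooth_on_const[of "- 1"]] by simp

lemma smooth_on_diff:
  "smooth_on n U f \<Longrightarrow> smooth_on n U g \<Longrightarrow> smooth_on n U (\<lambda>x. f x - g x)"
  using smooth_on_add[OF _ smooth_on_uminus] by simp

lemma smooth_on_divide:
  "smooth_on n U f \<Longrightarrow> smooth_on n U g \<Longrightarrow> (\<And>x. x \<in> U \<Longrightarrow> g x \<noteq> 0) \<Longrightarrow> smooth_on n U (\<lambda>x. f x / g x)"
  unfolding divide_inverse by (intro smooth_on_mult smooth_on_inverse)

lemma smooth_on_power2: "smooth_on n U f \<Longrightarrow> smooth_on n U (\<lambda>x. (f x)\<^sup>2)"
  unfolding power2_eq_square by (intro smooth_on_mult)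

lemma smooth_on_sum:
  assumes "\<And>a. a \<in> A \<Longrightarrow> smooth_on n U (f a)"
  shows "smooth_on n U (\<lambda>x. \<Sum>a\<in>A. f a x)"
proof (cases "finite A")
  case True
  then show ?thesis using assms
    by (induction A rule: finite_induct) (auto intro: smooth_on_const smooth_on_add)
qed (auto intro: smooth_on_const)

end

lemmas smooth_on_intros = smooth_on_const smooth_on_coord smooth_on_add smooth_on_mult
  smooth_on_uminus smooth_on_diff smooth_on_divide smooth_on_power2 smooth_on_sum

section \<open>Chain rule along curves and symmetry of second derivatives\<close>

lemma openin_Euclidean_space_box:
  assumes "openin (Euclidean_space n) U" "x \<in> U"
  shows "\<exists>e>0. \<forall>y. (\<forall>i<n. \<bar>y i - x i\<bar> < e) \<and> (\<forall>i\<ge>n. y i = 0) \<longrightarrow> y \<in> U"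
proof -
  define P where "P = (\<lambda>e. \<forall>y. (\<forall>i<n. \<bar>y i - x i\<bar> < e) \<and> (\<forall>i\<ge>n. y i = 0) \<longrightarrow> y \<in> U)"
  have "\<exists>k::nat. P (1 / Suc k)"
  proof (rule ccontr)
    assume "\<not> ?thesis"
    then have "\<forall>k. \<exists>y. (\<forall>i<n. \<bar>y i - x i\<bar> < 1 / Suc k) \<and> (\<forall>i\<ge>n. y i = 0) \<and> y \<notin> U"
      unfolding P_def by auto
    \<comment> \<open>A point outside \<open>U\<close> in each of a sequence of shrinking cubes:
      these points converge to \<open>x\<close>, hence eventually lie in \<open>U\<close>.\<close>
    then obtain y where y: "\<And>k i. i < n \<Longrightarrow> \<bar>y k i - x i\<bar> < 1 / Suc k" "\<And>k i. n \<le> i \<Longrightarrow> y k i = 0"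
      "\<And>k. y k \<notin> U" by metis
    have "(\<lambda>k. y k i) \<longlonglongrightarrow> x i" if "i < n" for i
    proof (rule LIM_zero_cancel, rule Lim_null_comparison)
      show "eventually (\<lambda>k. norm (y k i - x i) \<le> 1 / Suc k) sequentially"
        using y(1)[OF that] by (auto intro!: always_eventually less_imp_le)
      show "(\<lambda>k. 1 / real (Suc k)) \<longlonglongrightarrow> 0"
        using LIMSEQ_inverse_real_of_nat by (simp add: inverse_eq_divide)
    qed
    from eventually_in_openin_Euclidean_space[OF assms this y(2)]
    show False using y(3) by simp
  qed
  then obtain k :: nat where "P (1 / Suc k)" by blast
  then show ?thesis unfolding P_def by (intro exI[of _ "1 / Suc k"]) simp
qed

text \<open>Increments along a curve may be positive, negative or zero; the unordered segment covers
  all three cases.\<close>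

lemma mean_value_closed_segment:
  fixes g :: "real \<Rightarrow> real"
  assumes "\<And>z. z \<in> closed_segment a b \<Longrightarrow> (g has_real_derivative g' z) (at z)"
  obtains z where "z \<in> closed_segment a b" "g b - g a = g' z * (b - a)"
proof -
  consider "a = b" | "a < b" | "b < a" by linarith
  then show ?thesis
  proof cases
    case 1
    then show ?thesis by (intro that[of a]) auto
  next
    case 2
    then obtain z where "a < z" "z < b" "g b - g a = (b - a) * g' z"
      using MVT2[of a b g g'] assms by (auto simp: closed_segment_eq_real_ivl)
    with 2 show ?thesis by (intro that[of z]) (auto simp: closed_segment_eq_real_ivl)
  next
    case 3
    then obtain z where "b < z" "z < a" "g a - g b = (a - b) * g' z"
      using MVT2[of b a g g'] assms by (auto simp: closed_segment_eq_real_ivl)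
    with 3 show ?thesis by (intro that[of z]) (auto simp: closed_segment_eq_real_ivl algebra_simps)
  qed
qed

lemma mean_value_partial_deriv:
  assumes "smooth_on n U f" "i < n" "\<And>z. z \<in> closed_segment a b \<Longrightarrow> x(i := z) \<in> U"
  obtains z where "z \<in> closed_segment a b" "f (x(i := b)) - f (x(i := a)) = partial_deriv i f (x(i := z)) * (b - a)"
proof (rule mean_value_closed_segment[where g = "\<lambda>z. f (x(i := z))" and g' = "\<lambda>z. partial_deriv i f (x(i := z))"])
  show "((\<lambda>z. f (x(i := z))) has_real_derivative partial_deriv i f (x(i := z))) (at z)"
    if "z \<in> closed_segment a b" for z
    using smooth_on_imp_has_partial_deriv[OF assms(1,2) assms(3)[OF that]]
    by (simp add: has_partial_deriv_iff)
qed (use that in auto)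

lemma smooth_on_tendsto:
  assumes "openin (Euclidean_space n) U" "smooth_on n U f" "x \<in> U"
    "\<And>i. i < n \<Longrightarrow> ((\<lambda>s. \<gamma> s i) \<longlongrightarrow> x i) F" "\<And>s i. n \<le> i \<Longrightarrow> \<gamma> s i = 0"
  shows "((\<lambda>s. f (\<gamma> s)) \<longlongrightarrow> f x) F"
proof (rule continuous_on_tendsto_compose[OF smooth_on_imp_continuous_on[OF assms(2)] _ assms(3)])
  have "((\<lambda>s. \<gamma> s i) \<longlongrightarrow> x i) F" for i
    using assms(4)[of i] assms(5) openin_Euclidean_space_zero[OF assms(1,3), of i] by (cases "i < n") auto
  then show "(\<gamma> \<longlongrightarrow> x) F" by (simp add: tendsto_fun_iff)
  show "eventually (\<lambda>s. \<gamma> s \<in> U) F"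
    by (rule eventually_in_openin_Euclidean_space[OF assms(1,3-5)])
qed

text \<open>Telescope over the coordinates, with the mean value theorem in each one.\<close>

lemma has_derivative_along_curve:
  assumes U: "openin (Euclidean_space n) U" and f: "smooth_on n U f"
    and t: "\<gamma> t \<in> U" and out: "\<And>s i. n \<le> i \<Longrightarrow> \<gamma> s i = 0"
    and d: "\<And>i. i < n \<Longrightarrow> ((\<lambda>s. \<gamma> s i) has_real_derivative d i) (at t)"
  shows "((\<lambda>s. f (\<gamma> s)) has_real_derivative (\<Sum>i<n. partial_deriv i f (\<gamma> t) * d i)) (at t)"
proof -
  \<comment> \<open>The first \<open>j\<close> coordinates are taken at time \<open>s\<close>, the
    others at time \<open>t\<close>. Thus \<open>mix 0\<close> is constant, \<open>mix n\<close> is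
    the curve, and consecutive stages differ in one coordinate.\<close>
  define mix where "mix = (\<lambda>j s i. if i < j then \<gamma> s i else \<gamma> t i)"
  have cont: "((\<lambda>s. \<gamma> s i) \<longlongrightarrow> \<gamma> t i) (at t)" if "i < n" for i
    using DERIV_isCont[OF d[OF that]] by (auto simp: isCont_def)
  obtain e where e: "e > 0"
    "\<And>y. (\<And>i. i < n \<Longrightarrow> \<bar>y i - \<gamma> t i\<bar> < e) \<Longrightarrow> (\<And>i. n \<le> i \<Longrightarrow> y i = 0) \<Longrightarrow> y \<in> U"
    using openin_Euclidean_space_box[OF U t] by metis
  have near: "eventually (\<lambda>s. \<forall>i\<in>{..<n}. \<bar>\<gamma> s i - \<gamma> t i\<bar> < e) (at t)"
    using cont e(1) by (intro eventually_ball_finite) (auto simp: tendsto_iff dist_real_def)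
  have "((\<lambda>s. f (mix j s)) has_real_derivative (\<Sum>i<j. partial_deriv i f (\<gamma> t) * d i)) (at t)"
    if "j \<le> n" for j
    using that
  proof (induction j)
    case 0
    then show ?case by (simp add: mix_def)
  next
    case (Suc j)
    then have j: "j < n" by simp
    have step: "mix (Suc j) s = (mix j s)(j := \<gamma> s j)" "mix j s = (mix j s)(j := \<gamma> t j)" for s
      by (auto simp: mix_def fun_eq_iff)
    \<comment> \<open>The implication is vacuous for \<open>s\<close> far from \<open>t\<close>, so
      an intermediate point can be chosen for every \<open>s\<close> and becomes a total function
      \<xi>.\<close>
    have "\<forall>s. \<exists>z\<in>closed_segment (\<gamma> t j) (\<gamma> s j). (\<forall>i\<in>{..<n}. \<bar>\<gamma> s i - \<gamma> t i\<bar> < e) \<longrightarrow>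
       f (mix (Suc j) s) - f (mix j s) = partial_deriv j f ((mix j s)(j := z)) * (\<gamma> s j - \<gamma> t j)"
    proof
      fix s
      show "\<exists>z\<in>closed_segment (\<gamma> t j) (\<gamma> s j). (\<forall>i\<in>{..<n}. \<bar>\<gamma> s i - \<gamma> t i\<bar> < e) \<longrightarrow>
       f (mix (Suc j) s) - f (mix j s) = partial_deriv j f ((mix j s)(j := z)) * (\<gamma> s j - \<gamma> t j)"
      proof (cases "\<forall>i\<in>{..<n}. \<bar>\<gamma> s i - \<gamma> t i\<bar> < e")
        case True
        have "(mix j s)(j := z) \<in> U" if z: "z \<in> closed_segment (\<gamma> t j) (\<gamma> s j)" for z
        proof (rule e(2))
          have "\<bar>z - \<gamma> t j\<bar> \<le> \<bar>\<gamma> s j - \<gamma> t j\<bar>"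
            using z by (auto simp: closed_segment_eq_real_ivl split: if_splits)
          also have "\<dots> < e" using True j by auto
          finally show "\<bar>((mix j s)(j := z)) i - \<gamma> t i\<bar> < e" if "i < n" for i
            using True that e(1) by (auto simp: mix_def)
          show "((mix j s)(j := z)) i = 0" if "n \<le> i" for i
            using that j out by (auto simp: mix_def)
        qed
        then obtain z where "z \<in> closed_segment (\<gamma> t j) (\<gamma> s j)"
          "f ((mix j s)(j := \<gamma> s j)) - f ((mix j s)(j := \<gamma> t j))
            = partial_deriv j f ((mix j s)(j := z)) * (\<gamma> s j - \<gamma> t j)"
          by (rule mean_value_partial_deriv[OF f j])
        then show ?thesis using step by metis
      qed auto
    qed
    then obtain \<xi> where \<xi>: "\<And>s. \<xi> s \<in> closed_segment (\<gamma> t j) (\<gamma> s j)"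
      "\<And>s. \<forall>i\<in>{..<n}. \<bar>\<gamma> s i - \<gamma> t i\<bar> < e \<Longrightarrow>
       f (mix (Suc j) s) - f (mix j s) = partial_deriv j f ((mix j s)(j := \<xi> s)) * (\<gamma> s j - \<gamma> t j)"
      by metis
    have "(\<lambda>s. \<xi> s - \<gamma> t j) \<midarrow>t\<rightarrow> 0"
    proof (rule Lim_null_comparison)
      have "\<bar>\<xi> s - \<gamma> t j\<bar> \<le> \<bar>\<gamma> s j - \<gamma> t j\<bar>" for s
        using \<xi>(1)[of s] by (auto simp: closed_segment_eq_real_ivl split: if_splits)
      then show "eventually (\<lambda>s. norm (\<xi> s - \<gamma> t j) \<le> \<bar>\<gamma> s j - \<gamma> t j\<bar>) (at t)" by simp
      show "(\<lambda>s. \<bar>\<gamma> s j - \<gamma> t j\<bar>) \<midarrow>t\<rightarrow> 0"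
        using tendsto_rabs[OF LIM_zero[OF cont[OF j]]] by simp
    qed
    then have "\<xi> \<midarrow>t\<rightarrow> \<gamma> t j" by (rule LIM_zero_cancel)
    then have "(\<lambda>s. partial_deriv j f ((mix j s)(j := \<xi> s))) \<midarrow>t\<rightarrow> partial_deriv j f (\<gamma> t)"
    proof (intro smooth_on_tendsto[OF U smooth_on_partial_deriv[OF f j] t])
      show "(\<lambda>s. ((mix j s)(j := \<xi> s)) i) \<midarrow>t\<rightarrow> \<gamma> t i"
        if "\<xi> \<midarrow>t\<rightarrow> \<gamma> t j" "i < n" for i
        using that cont[of i] by (cases "i = j"; cases "i < j") (auto simp: mix_def)
      show "((mix j s)(j := \<xi> s)) i = 0" if "n \<le> i" for s i
        using that j out by (auto simp: mix_def)
    qed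
    from tendsto_mult[OF this d[OF j, unfolded has_field_derivative_iff]]
    have "(\<lambda>s. partial_deriv j f ((mix j s)(j := \<xi> s)) * ((\<gamma> s j - \<gamma> t j) / (s - t)))
        \<midarrow>t\<rightarrow> partial_deriv j f (\<gamma> t) * d j" .
    then have "(\<lambda>s. (f (mix (Suc j) s) - f (mix j s)) / (s - t)) \<midarrow>t\<rightarrow> partial_deriv j f (\<gamma> t) * d j"
      by (rule Lim_transform_eventually) (use near in \<open>auto elim!: eventually_mono simp: \<xi>(2)\<close>)
    moreover have "f (mix (Suc j) t) - f (mix j t) = 0"
      using step[of t] by (metis diff_self)
    ultimately have "((\<lambda>s. f (mix (Suc j) s) - f (mix j s)) has_real_derivative partial_deriv j f (\<gamma> t) * d j) (at t)"
      by (simp add: has_field_derivative_iff)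
    from DERIV_add[OF Suc.IH this] j show ?case by simp
  qed
  moreover have "mix n = \<gamma>"
    using out by (auto simp: mix_def fun_eq_iff)
  ultimately show ?thesis by (metis order_refl)
qed

text \<open>The second difference of \<open>f\<close> over a small square is symmetric in the two
  coordinates. Two mean value steps, taken in either order, express it by one or the other mixed
  derivative at nearby points; continuity of both gives equality in the limit.\<close>

lemma partial_deriv_commute:
  assumes U: "openin (Euclidean_space n) U" and f: "smooth_on n U f" and x: "x \<in> U" and ij: "i < n" "j < n"
  shows "partial_deriv i (partial_deriv j f) x = partial_deriv j (partial_deriv i f) x"
proof (cases "i = j")
  case ne: False
  obtain e where e: "e > 0"
    "\<And>y. (\<And>i. i < n \<Longrightarrow> \<bar>y i - x i\<bar> < e) \<Longrightarrow> (\<And>i. n \<le> i \<Longrightarrow> y i = 0) \<Longrightarrow> y \<in> U"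
    using openin_Euclidean_space_box[OF U x] by metis
  have sq: "\<exists>a b. \<bar>a\<bar> \<le> h \<and> \<bar>b\<bar> \<le> h \<and>
     f (x(i := x i + h, j := x j + h)) - f (x(i := x i + h)) - f (x(j := x j + h)) + f x
       = partial_deriv j (partial_deriv i f) (x(i := x i + a, j := x j + b)) * h * h"
    if ij: "i < n" "j < n" "i \<noteq> j" and h: "0 < h" "h < e" for i j h
  proof -
    have inU: "x(i := u, j := v) \<in> U" if "\<bar>u - x i\<bar> < e" "\<bar>v - x j\<bar> < e" for u v
      by (rule e(2)) (use that e(1) ij openin_Euclidean_space_zero[OF U x] in auto)
    define g where "g = (\<lambda>u. f (x(i := u, j := x j + h)) - f (x(i := u, j := x j)))"
    have D: "((\<lambda>u. f (x(i := u, j := v))) has_real_derivative partial_deriv i f (x(i := u, j := v))) (at u)"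
      if "\<bar>u - x i\<bar> < e" "\<bar>v - x j\<bar> < e" for u v
      using smooth_on_imp_has_partial_deriv[OF f ij(1) inU[OF that]] ij(3)
      by (simp add: has_partial_deriv_iff fun_upd_twist)
    obtain u where u: "u \<in> closed_segment (x i) (x i + h)"
      "g (x i + h) - g (x i) = (partial_deriv i f (x(i := u, j := x j + h)) - partial_deriv i f (x(i := u, j := x j))) * ((x i + h) - x i)"
    proof (rule mean_value_closed_segment[where g = g])
      fix z assume "z \<in> closed_segment (x i) (x i + h)"
      then have "\<bar>z - x i\<bar> < e" using h by (auto simp: closed_segment_eq_real_ivl)
      then show "(g has_real_derivative (partial_deriv i f (x(i := z, j := x j + h)) - partial_deriv i f (x(i := z, j := x j)))) (at z)"
        unfolding g_def using h e(1) by (intro DERIV_diff D) auto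
    qed
    have u': "\<bar>u - x i\<bar> \<le> h" using u(1) h by (auto simp: closed_segment_eq_real_ivl)
    obtain v where v: "v \<in> closed_segment (x j) (x j + h)"
      "partial_deriv i f (x(i := u, j := x j + h)) - partial_deriv i f (x(i := u, j := x j))
        = partial_deriv j (partial_deriv i f) (x(i := u, j := v)) * ((x j + h) - x j)"
    proof (rule mean_value_partial_deriv[OF smooth_on_partial_deriv[OF f ij(1)] ij(2), where x = "x(i := u)"])
      show "x(i := u, j := z) \<in> U" if "z \<in> closed_segment (x j) (x j + h)" for z
        using that h u' by (intro inU) (auto simp: closed_segment_eq_real_ivl)
    qed blast
    have v': "\<bar>v - x j\<bar> \<le> h" using v(1) h by (auto simp: closed_segment_eq_real_ivl)
    have "g (x i + h) - g (x i) = partial_deriv j (partial_deriv i f) (x(i := x i + (u - x i), j := x j + (v - x j))) * h * h"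
      using u(2) v(2) by simp
    moreover have "g (x i + h) - g (x i) =
      f (x(i := x i + h, j := x j + h)) - f (x(i := x i + h)) - f (x(j := x j + h)) + f x"
      using ij(3) by (simp add: g_def fun_upd_twist fun_upd_idem)
    ultimately show ?thesis using u' v' by (intro exI[of _ "u - x i"] exI[of _ "v - x j"]) auto
  qed
  \<comment> \<open>A sequence of side lengths that tends to 0 and stays strictly below
    \<open>e\<close> from the start.\<close>
  define h where "h = (\<lambda>k. e / (real k + 2))"
  have h: "0 < h k" "h k < e" for k
    using e(1) by (auto simp: h_def field_simps intro: add_pos_nonneg)
  have hlim: "h \<longlonglongrightarrow> 0"
    unfolding h_def by (rule real_tendsto_divide_at_top[OF tendsto_const])
      (auto intro!: filterlim_tendsto_add_at_top[of "\<lambda>_. 2" 2 _ real, simplified add.commute] filterlim_real_sequentially)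
  have lim: "(\<lambda>k. g (x(i := x i + a k, j := x j + b k))) \<longlonglongrightarrow> g x"
    if "smooth_on n U g" "i < n" "j < n" "i \<noteq> j" "\<And>k. \<bar>a k\<bar> \<le> h k" "\<And>k. \<bar>b k\<bar> \<le> h k" for g i j a b
  proof (rule smooth_on_tendsto[OF U that(1) x])
    have "a \<longlonglongrightarrow> 0" "b \<longlonglongrightarrow> 0"
      using that(5,6) by (auto intro!: Lim_null_comparison[OF _ hlim])
    then show "(\<lambda>k. (x(i := x i + a k, j := x j + b k)) m) \<longlonglongrightarrow> x m" for m
      using tendsto_add[OF tendsto_const[of "x i"], of a 0] tendsto_add[OF tendsto_const[of "x j"], of b 0] that(4)
      by (cases "m = i"; cases "m = j") simp_all
    show "(x(i := x i + a k, j := x j + b k)) m = 0" if "n \<le> m" for k m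
      using that \<open>i < n\<close> \<open>j < n\<close> openin_Euclidean_space_zero[OF U x] by auto
  qed
  obtain a b where ab: "\<And>k. \<bar>a k\<bar> \<le> h k" "\<And>k. \<bar>b k\<bar> \<le> h k"
    "\<And>k. f (x(i := x i + h k, j := x j + h k)) - f (x(i := x i + h k)) - f (x(j := x j + h k)) + f x
       = partial_deriv j (partial_deriv i f) (x(i := x i + a k, j := x j + b k)) * h k * h k"
    using sq[OF ij ne h] by metis
  obtain c d where cd: "\<And>k. \<bar>c k\<bar> \<le> h k" "\<And>k. \<bar>d k\<bar> \<le> h k"
    "\<And>k. f (x(j := x j + h k, i := x i + h k)) - f (x(j := x j + h k)) - f (x(i := x i + h k)) + f x
       = partial_deriv i (partial_deriv j f) (x(j := x j + c k, i := x i + d k)) * h k * h k"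
    using sq[OF ij(2,1) ne[symmetric] h] by metis
  have "partial_deriv j (partial_deriv i f) (x(i := x i + a k, j := x j + b k))
      = partial_deriv i (partial_deriv j f) (x(j := x j + c k, i := x i + d k))" for k
  proof -
    have e: "x(i := x i + h k, j := x j + h k) = x(j := x j + h k, i := x i + h k)"
      using ne by (simp add: fun_upd_twist)
    have "partial_deriv j (partial_deriv i f) (x(i := x i + a k, j := x j + b k)) * h k * h k
      = partial_deriv i (partial_deriv j f) (x(j := x j + c k, i := x i + d k)) * h k * h k"
      using ab(3)[of k] cd(3)[of k] unfolding e by linarith
    then show ?thesis using h(1)[of k] by simp
  qed
  then have "(\<lambda>k. partial_deriv j (partial_deriv i f) (x(i := x i + a k, j := x j + b k)))
     \<longlonglongrightarrow> partial_deriv i (partial_deriv j f) x"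
    using lim[OF smooth_on_partial_deriv[OF smooth_on_partial_deriv[OF f ij(2)] ij(1)] ij(2,1) ne[symmetric] cd(1,2)] by simp
  with lim[OF smooth_on_partial_deriv[OF smooth_on_partial_deriv[OF f ij(1)] ij(2)] ij ne ab(1,2)]
  show ?thesis using LIMSEQ_unique by blast
qed simp

section \<open>Connection and curvature in an orthogonal frame\<close>

lemma sum_delta_left: "(l::nat) < n \<Longrightarrow> (\<Sum>k<n. (if k = l then 1 else 0) * f k) = (f l :: real)"
  "(l::nat) < n \<Longrightarrow> (\<Sum>k<n. (if l = k then 1 else 0) * f k) = (f l :: real)"
  by (simp_all add: if_distribR if_distrib[of "\<lambda>z. z * _"] cong: if_cong)

lemma sum_antisym_eq_zero:
  fixes A :: "nat \<Rightarrow> nat \<Rightarrow> real"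
  assumes "\<And>b c. b < n \<Longrightarrow> c < n \<Longrightarrow> A b c = - A c b"
  shows "(\<Sum>b<n. \<Sum>c<n. A b c) = 0"
proof -
  have "(\<Sum>b<n. \<Sum>c<n. A b c) = (\<Sum>b<n. \<Sum>c<n. - A c b)"
    by (intro sum.cong refl assms) auto
  also have "\<dots> = - (\<Sum>b<n. \<Sum>c<n. A b c)"
    by (subst sum.swap) (simp add: sum_negf)
  finally show ?thesis by simp
qed

lemma sum_swap3:
  fixes f :: "'a \<Rightarrow> 'b \<Rightarrow> 'c \<Rightarrow> real"
  shows "(\<Sum>i\<in>A. \<Sum>j\<in>B. \<Sum>b\<in>C. f i j b) = (\<Sum>b\<in>C. \<Sum>i\<in>A. \<Sum>j\<in>B. f i j b)"
proof -
  have "(\<Sum>i\<in>A. \<Sum>j\<in>B. \<Sum>b\<in>C. f i j b) = (\<Sum>i\<in>A. \<Sum>b\<in>C. \<Sum>j\<in>B. f i j b)"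
    by (intro sum.cong refl sum.swap)
  also have "\<dots> = (\<Sum>b\<in>C. \<Sum>i\<in>A. \<Sum>j\<in>B. f i j b)"
    by (rule sum.swap)
  finally show ?thesis .
qed

lemma sum_swap4:
  fixes f :: "'a \<Rightarrow> 'b \<Rightarrow> 'c \<Rightarrow> 'd \<Rightarrow> real"
  shows "(\<Sum>i\<in>A. \<Sum>j\<in>B. \<Sum>b\<in>C. \<Sum>d\<in>D. f i j b d) = (\<Sum>b\<in>C. \<Sum>d\<in>D. \<Sum>i\<in>A. \<Sum>j\<in>B. f i j b d)"
  by (subst sum_swap3) (intro sum.cong refl sum_swap3)

lemma sum_contract2:
  fixes R :: "'b \<Rightarrow> 'b \<Rightarrow> real"
  shows "(\<Sum>i\<in>A. \<Sum>j\<in>A. (\<Sum>b\<in>B. \<Sum>d\<in>B. R b d * P b i * P d j) * (u i * v j))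
    = (\<Sum>b\<in>B. \<Sum>d\<in>B. R b d * (\<Sum>i\<in>A. P b i * u i) * (\<Sum>j\<in>A. P d j * v j))"
proof -
  have "(\<Sum>i\<in>A. \<Sum>j\<in>A. (\<Sum>b\<in>B. \<Sum>d\<in>B. R b d * P b i * P d j) * (u i * v j))
    = (\<Sum>i\<in>A. \<Sum>j\<in>A. \<Sum>b\<in>B. \<Sum>d\<in>B. R b d * ((P b i * u i) * (P d j * v j)))"
    by (simp add: sum_distrib_right sum_distrib_left mult_ac)
  also have "\<dots> = (\<Sum>b\<in>B. \<Sum>d\<in>B. \<Sum>i\<in>A. \<Sum>j\<in>A. R b d * ((P b i * u i) * (P d j * v j)))"
    by (rule sum_swap4)
  also have "\<dots> = (\<Sum>b\<in>B. \<Sum>d\<in>B. R b d * ((\<Sum>i\<in>A. P b i * u i) * (\<Sum>j\<in>A. P d j * v j)))"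
    unfolding sum_product by (simp only: sum_distrib_left)
  finally show ?thesis by (simp only: mult.assoc)
qed

text \<open>
  A local coframe \<open>th\<close> with dual frame \<open>E\<close>, orthogonal with squared lengths \<open>la\<close>. The assumptions on the
  constants \<open>om a c b\<close> are metric compatibility and vanishing torsion, so that
  \<open>\<nabla>\<^bsub>E a\<^esub> (E c) = (\<Sum>b. om a c b * E b)\<close>.
\<close>

locale local_frame =
  fixes M :: "'a riemannian" and c :: "'a chart" and U :: "(nat \<Rightarrow> real) set" and n :: nat
    and th E :: "nat \<Rightarrow> nat \<Rightarrow> (nat \<Rightarrow> real) \<Rightarrow> real" and la :: "nat \<Rightarrow> real" and om :: "nat \<Rightarrow> nat \<Rightarrow> nat \<Rightarrow> real"
  assumes dim: "mdim M = n"
    and U: "openin (Euclidean_space n) U"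
    and th_smooth: "\<And>a i. a < n \<Longrightarrow> i < n \<Longrightarrow> smooth_on n U (th a i)"
    and E_smooth: "\<And>a i. a < n \<Longrightarrow> i < n \<Longrightarrow> smooth_on n U (E a i)"
    and th_E: "\<And>a b y. a < n \<Longrightarrow> b < n \<Longrightarrow> y \<in> U \<Longrightarrow> (\<Sum>k<n. th a k y * E b k y) = (if a = b then 1 else 0)"
    and E_th: "\<And>k l y. k < n \<Longrightarrow> l < n \<Longrightarrow> y \<in> U \<Longrightarrow> (\<Sum>a<n. E a k y * th a l y) = (if k = l then 1 else 0)"
    and la: "\<And>a. a < n \<Longrightarrow> la a \<noteq> 0"
    and metric_frame: "\<And>i j y. i < n \<Longrightarrow> j < n \<Longrightarrow> y \<in> U \<Longrightarrow>
        metric_comp M c i j y = (\<Sum>a<n. la a * th a i y * th a j y)"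
    and om_antisym: "\<And>a b d. a < n \<Longrightarrow> b < n \<Longrightarrow> d < n \<Longrightarrow> la b * om a d b = - (la d * om a b d)"
    and structure_eq: "\<And>b i j y. b < n \<Longrightarrow> i < n \<Longrightarrow> j < n \<Longrightarrow> y \<in> U \<Longrightarrow>
        partial_deriv i (th b j) y + (\<Sum>a<n. \<Sum>d<n. om a d b * th a i y * th d j y)
        = partial_deriv j (th b i) y + (\<Sum>a<n. \<Sum>d<n. om a d b * th a j y * th d i y)"
begin

text \<open>The connection 1-forms: \<open>W i b d\<close> is the component along \<partial>_i of
  the form that gives the coefficient of \<open>E b\<close> in the derivative of
  \<open>E d\<close>.\<close>

definition W :: "nat \<Rightarrow> nat \<Rightarrow> nat \<Rightarrow> (nat \<Rightarrow> real) \<Rightarrow> real" where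
  "W i b d y = (\<Sum>a<n. om a d b * th a i y)"

text \<open>This will turn out to be \<open>th b\<close> applied to the covariant derivative of
  \<partial>_j along \<partial>_i, see \<open>th_christoffel\<close>. Its symmetry in
  \<open>i\<close> and \<open>j\<close> is the vanishing of torsion.\<close>

definition X :: "nat \<Rightarrow> nat \<Rightarrow> nat \<Rightarrow> (nat \<Rightarrow> real) \<Rightarrow> real" where
  "X b i j y = (\<Sum>d<n. W i b d y * th d j y) + partial_deriv i (th b j) y"

lemma X_eq: "X b i j y = partial_deriv i (th b j) y + (\<Sum>a<n. \<Sum>d<n. om a d b * th a i y * th d j y)"
  unfolding X_def W_def by (subst sum.swap) (simp add: sum_distrib_right)

lemma X_sym: "b < n \<Longrightarrow> i < n \<Longrightarrow> j < n \<Longrightarrow> y \<in> U \<Longrightarrow> X b i j y = X b j i y"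
  unfolding X_eq by (rule structure_eq)

lemma W_smooth: "i < n \<Longrightarrow> smooth_on n U (W i b d)"
  unfolding W_def[abs_def]
  by (intro smooth_on_sum[OF U] smooth_on_mult[OF U] smooth_on_const[OF U] th_smooth) auto

lemma X_smooth: "b < n \<Longrightarrow> i < n \<Longrightarrow> j < n \<Longrightarrow> smooth_on n U (X b i j)"
  unfolding X_def[abs_def]
  by (intro smooth_on_add[OF U] smooth_on_sum[OF U] smooth_on_mult[OF U] W_smooth th_smooth smooth_on_partial_deriv) auto

lemma th_partial: "a < n \<Longrightarrow> j < n \<Longrightarrow> i < n \<Longrightarrow> y \<in> U \<Longrightarrow> has_partial_deriv i (th a j) y"
  by (rule smooth_on_imp_has_partial_deriv[OF th_smooth])

text \<open>Replacing the derivatives of \<open>th\<close> by \<open>X\<close> adds connection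
  terms, which cancel in pairs by metric compatibility (\<open>om_antisym\<close>).\<close>

lemma partial_deriv_metric_comp:
  assumes ij: "i < n" "j < n" "l < n" and y: "y \<in> U"
  shows "partial_deriv i (metric_comp M c j l) y
    = (\<Sum>b<n. la b * (X b i j y * th b l y + th b j y * X b i l y))"
proof -
  have "partial_deriv i (metric_comp M c j l) y = partial_deriv i (\<lambda>y. \<Sum>b<n. la b * (th b j y * th b l y)) y"
    by (rule partial_deriv_cong(1)[OF U y ij(1)]) (simp add: metric_frame ij mult.assoc)
  also have "\<dots> = (\<Sum>b<n. la b * (partial_deriv i (th b j) y * th b l y + th b j y * partial_deriv i (th b l) y))"
    using ij y th_partial
    by (subst partial_deriv_sum_mult) (auto intro!: sum.cong simp: partial_deriv_const partial_deriv_mult)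
  finally have 1: "partial_deriv i (metric_comp M c j l) y
    = (\<Sum>b<n. la b * (partial_deriv i (th b j) y * th b l y + th b j y * partial_deriv i (th b l) y))" .
  have "(\<Sum>b<n. \<Sum>d<n. la b * W i b d y * (th d j y * th b l y + th b j y * th d l y)) = 0"
  proof (rule sum_antisym_eq_zero)
    fix b d assume bd: "b < n" "d < n"
    have "la b * W i b d y = (\<Sum>a<n. (la b * om a d b) * th a i y)"
      by (simp add: W_def sum_distrib_left mult.assoc)
    also have "\<dots> = (\<Sum>a<n. - (la d * om a b d) * th a i y)"
      by (rule sum.cong[OF refl], subst om_antisym) (use bd in auto)
    also have "\<dots> = - (la d * W i d b y)"
      by (simp add: W_def sum_distrib_left sum_negf mult.assoc)
    finally have "la b * W i b d y = - (la d * W i d b y)" .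
    then show "la b * W i b d y * (th d j y * th b l y + th b j y * th d l y)
      = - (la d * W i d b y * (th b j y * th d l y + th d j y * th b l y))"
      by (simp add: algebra_simps)
  qed
  then have "(\<Sum>b<n. la b * ((\<Sum>d<n. W i b d y * th d j y) * th b l y + th b j y * (\<Sum>d<n. W i b d y * th d l y))) = 0"
    by (simp add: sum_distrib_left sum_distrib_right sum.distrib algebra_simps)
  with 1 show ?thesis
    by (simp add: X_def algebra_simps sum.distrib)
qed

lemma metric_inv_frame:
  assumes y: "y \<in> U"
  shows "metric_inv M c y k l = (if k < n \<and> l < n then \<Sum>a<n. E a k y * E a l y / la a else 0)"
proof -
  define H where "H = (\<lambda>k l. if k < n \<and> l < n then \<Sum>a<n. E a k y * E a l y / la a else 0)"
  have gH: "(\<Sum>k<n. metric_comp M c i k y * H k j) = (if i = j then 1 else 0)" if ij: "i < n" "j < n" for i j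
  proof -
    have "(\<Sum>k<n. metric_comp M c i k y * H k j)
      = (\<Sum>k<n. \<Sum>a<n. \<Sum>b<n. la a * th a i y * E b j y / la b * (th a k y * E b k y))"
      using ij y by (simp add: H_def metric_frame sum_product mult_ac)
    also have "\<dots> = (\<Sum>a<n. \<Sum>b<n. la a * th a i y * E b j y / la b * (\<Sum>k<n. th a k y * E b k y))"
      unfolding sum_distrib_left by (subst sum.swap, rule sum.cong[OF refl], subst sum.swap) simp
    also have "\<dots> = (\<Sum>a<n. \<Sum>b<n. la a * th a i y * E b j y / la b * (if a = b then 1 else 0))"
      using y by (intro sum.cong) (auto simp: th_E)
    also have "\<dots> = (\<Sum>a<n. E a j y * th a i y)"
      using la by (intro sum.cong) (auto simp: if_distrib cong: if_cong)
    finally show ?thesis using E_th[of j i y] ij y by auto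
  qed
  have g_sym: "metric_comp M c i k y = metric_comp M c k i y" if "i < n" "k < n" for i k
    using that y by (simp add: metric_frame mult_ac)
  have H_sym: "H i k = H k i" for i k by (simp add: H_def mult_ac)
  have "metric_inv M c y = H"
    unfolding metric_inv_def dim
  proof (rule the_equality, intro conjI allI impI)
    show "H i j = 0" if "\<not> (i < n \<and> j < n)" for i j using that unfolding H_def by (simp only: if_False)
    show "(\<Sum>k<n. metric_comp M c i k y * H k j) = (if i = j then 1 else 0)" if "i < n" "j < n" for i j
      using gH that by simp
  next
    fix h assume h: "(\<forall>i j. \<not> (i < n \<and> j < n) \<longrightarrow> h i j = 0) \<and>
      (\<forall>i<n. \<forall>j<n. (\<Sum>k<n. metric_comp M c i k y * h k j) = (if i = j then 1 else 0))"
    have "h l j = H l j" if lj: "l < n" "j < n" for l j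
    proof -
      have "h l j = (\<Sum>k<n. (if l = k then 1 else 0) * h k j)" using lj by (simp add: sum_delta_left)
      also have "\<dots> = (\<Sum>k<n. (\<Sum>i<n. H l i * metric_comp M c i k y) * h k j)"
      proof (rule sum.cong[OF refl])
        fix k assume k: "k \<in> {..<n}"
        have "(\<Sum>i<n. H l i * metric_comp M c i k y) = (\<Sum>i<n. metric_comp M c k i y * H i l)"
          using k g_sym H_sym by (intro sum.cong) (auto simp: mult.commute)
        then show "(if l = k then 1 else 0) * h k j = (\<Sum>i<n. H l i * metric_comp M c i k y) * h k j"
          using gH[of k l] k lj by auto
      qed
      also have "\<dots> = (\<Sum>i<n. H l i * (\<Sum>k<n. metric_comp M c i k y * h k j))"
        unfolding sum_distrib_left sum_distrib_right by (subst sum.swap) (simp add: mult_ac)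
      also have "\<dots> = (\<Sum>i<n. (if i = j then 1 else 0) * H l i)" using h lj by (intro sum.cong) auto
      finally show ?thesis using lj by (simp add: sum_delta_left)
    qed
    then show "h = H" using h by (intro ext) (metis (no_types, lifting) H_def)
  qed
  then show ?thesis by (simp add: H_def)
qed

text \<open>By the symmetry of \<open>X\<close>, four of the six terms in the combination of metric
  derivatives cancel and the other two coincide. Raising the index with
  \<open>metric_inv_frame\<close> leaves the frame expansion of \<open>X\<close>.\<close>

lemma christoffel_frame:
  assumes ij: "k < n" "i < n" "j < n" and y: "y \<in> U"
  shows "christoffel M c k i j y = (\<Sum>b<n. E b k y * X b i j y)"
proof -
  have 1: "partial_deriv i (metric_comp M c j l) y + partial_deriv j (metric_comp M c i l) y
      - partial_deriv l (metric_comp M c i j) y = 2 * (\<Sum>b<n. la b * X b i j y * th b l y)" if "l < n" for l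
  proof -
    have "partial_deriv i (metric_comp M c j l) y + partial_deriv j (metric_comp M c i l) y
      - partial_deriv l (metric_comp M c i j) y
      = (\<Sum>b<n. la b * (X b i j y * th b l y + th b j y * X b i l y) + la b * (X b j i y * th b l y + th b i y * X b j l y)
         - la b * (X b l i y * th b j y + th b i y * X b l j y))"
      using ij y that by (simp add: partial_deriv_metric_comp sum.distrib sum_subtractf)
    also have "\<dots> = (\<Sum>b<n. 2 * (la b * X b i j y * th b l y))"
    proof (rule sum.cong[OF refl])
      fix b assume "b \<in> {..<n}"
      then have "X b j i y = X b i j y" "X b l i y = X b i l y" "X b l j y = X b j l y"
        using X_sym ij y that by auto
      then show "la b * (X b i j y * th b l y + th b j y * X b i l y) + la b * (X b j i y * th b l y + th b i y * X b j l y)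
         - la b * (X b l i y * th b j y + th b i y * X b l j y) = 2 * (la b * X b i j y * th b l y)"
        by (simp add: algebra_simps)
    qed
    finally show ?thesis by (simp add: sum_distrib_left)
  qed
  have "christoffel M c k i j y = (\<Sum>l<n. metric_inv M c y k l * (\<Sum>b<n. la b * X b i j y * th b l y))"
    unfolding christoffel_def dim using 1 by (simp add: sum_divide_distrib)
  also have "\<dots> = (\<Sum>l<n. \<Sum>a<n. \<Sum>b<n. E a k y / la a * (la b * X b i j y) * (th b l y * E a l y))"
    using ij y by (simp add: metric_inv_frame sum_product mult_ac)
  also have "\<dots> = (\<Sum>a<n. \<Sum>b<n. E a k y / la a * (la b * X b i j y) * (\<Sum>l<n. th b l y * E a l y))"
    unfolding sum_distrib_left by (subst sum.swap, rule sum.cong[OF refl], subst sum.swap) simp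
  also have "\<dots> = (\<Sum>a<n. \<Sum>b<n. E a k y / la a * (la b * X b i j y) * (if b = a then 1 else 0))"
    using y by (intro sum.cong) (auto simp: th_E)
  also have "\<dots> = (\<Sum>a<n. E a k y * X a i j y)"
    using la by (intro sum.cong) (auto simp: if_distrib cong: if_cong)
  finally show ?thesis .
qed

lemma christoffel_smooth:
  assumes "k < n" "i < n" "j < n"
  shows "smooth_on n U (christoffel M c k i j)"
  by (rule smooth_on_cong[OF U christoffel_frame])
    (use assms in \<open>auto intro!: smooth_on_sum[OF U] smooth_on_mult[OF U] E_smooth X_smooth\<close>)

lemma th_christoffel:
  assumes "d < n" "i < n" "j < n" "y \<in> U"
  shows "(\<Sum>k<n. th d k y * christoffel M c k i j y) = X d i j y"
proof -
  have "(\<Sum>k<n. th d k y * christoffel M c k i j y) = (\<Sum>k<n. \<Sum>b<n. X b i j y * (th d k y * E b k y))"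
    using assms by (simp add: christoffel_frame sum_distrib_left mult_ac)
  also have "\<dots> = (\<Sum>b<n. X b i j y * (\<Sum>k<n. th d k y * E b k y))"
    unfolding sum_distrib_left by (rule sum.swap)
  also have "\<dots> = (\<Sum>b<n. (if d = b then 1 else 0) * X b i j y)"
    using assms by (intro sum.cong) (auto simp: th_E)
  finally show ?thesis using assms by (simp add: sum_delta_left)
qed

lemma frame_expand:
  assumes "k < n" "y \<in> U"
  shows "(\<Sum>d<n. E d k y * (\<Sum>l<n. th d l y * v l)) = v k"
proof -
  have "(\<Sum>d<n. E d k y * (\<Sum>l<n. th d l y * v l)) = (\<Sum>l<n. (\<Sum>d<n. E d k y * th d l y) * v l)"
    unfolding sum_distrib_left sum_distrib_right by (subst sum.swap) (simp add: mult_ac)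
  also have "\<dots> = (\<Sum>l<n. (if k = l then 1 else 0) * v l)"
    using assms by (intro sum.cong) (auto simp: E_th)
  finally show ?thesis using assms by (simp add: sum_delta_left)
qed

text \<open>Differentiating the duality of \<open>th\<close> and \<open>E\<close> trades derivatives
  of the coframe for derivatives of the frame; what survives of \<open>X\<close> is the connection
  form.\<close>

lemma nabla_E:
  assumes ak: "a < n" "k < n" "i < n" and y: "y \<in> U"
  shows "partial_deriv i (E a k) y + (\<Sum>j<n. christoffel M c k i j y * E a j y) = (\<Sum>b<n. W i b a y * E b k y)"
proof -
  have dth: "(\<Sum>j<n. partial_deriv i (th d j) y * E a j y) = - (\<Sum>j<n. th d j y * partial_deriv i (E a j) y)"
    if d: "d < n" for d
  proof -
    have "partial_deriv i (\<lambda>y. \<Sum>j<n. th d j y * E a j y) y = partial_deriv i (\<lambda>y. if d = a then 1 else 0) y"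
      by (rule partial_deriv_cong(1)[OF U y ak(3)]) (simp add: th_E d ak)
    moreover have "partial_deriv i (\<lambda>y. \<Sum>j<n. th d j y * E a j y) y
      = (\<Sum>j<n. partial_deriv i (th d j) y * E a j y + th d j y * partial_deriv i (E a j) y)"
      using ak y d by (intro partial_deriv_sum_mult) (auto intro: th_partial smooth_on_imp_has_partial_deriv[OF E_smooth])
    ultimately show ?thesis by (simp add: partial_deriv_const sum.distrib)
  qed
  have "(\<Sum>j<n. christoffel M c k i j y * E a j y)
    = (\<Sum>j<n. \<Sum>d<n. E d k y * (X d i j y * E a j y))"
    using ak y by (simp add: christoffel_frame sum_distrib_right sum_distrib_left mult_ac)
  also have "\<dots> = (\<Sum>d<n. E d k y * (\<Sum>j<n. X d i j y * E a j y))"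
    unfolding sum_distrib_left by (rule sum.swap)
  also have "\<dots> = (\<Sum>d<n. E d k y * (W i d a y - (\<Sum>j<n. th d j y * partial_deriv i (E a j) y)))"
  proof (rule sum.cong[OF refl])
    fix d assume d: "d \<in> {..<n}"
    have "(\<Sum>j<n. (\<Sum>e<n. W i d e y * th e j y) * E a j y) = (\<Sum>e<n. W i d e y * (\<Sum>j<n. th e j y * E a j y))"
      unfolding sum_distrib_left sum_distrib_right by (subst sum.swap) (simp add: mult_ac)
    also have "\<dots> = (\<Sum>e<n. (if e = a then 1 else 0) * W i d e y)"
      using ak y by (intro sum.cong) (auto simp: th_E)
    also have "\<dots> = W i d a y" using ak by (simp add: sum_delta_left)
    finally show "E d k y * (\<Sum>j<n. X d i j y * E a j y)
      = E d k y * (W i d a y - (\<Sum>j<n. th d j y * partial_deriv i (E a j) y))"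
      using dth[of d] d by (simp add: X_def distrib_right sum.distrib)
  qed
  also have "\<dots> = (\<Sum>d<n. E d k y * W i d a y) - (\<Sum>d<n. E d k y * (\<Sum>j<n. th d j y * partial_deriv i (E a j) y))"
    by (simp add: right_diff_distrib sum_subtractf)
  also have "\<dots> = (\<Sum>d<n. W i d a y * E d k y) - partial_deriv i (E a k) y"
    using ak y frame_expand[of k y "\<lambda>j. partial_deriv i (E a j) y"] by (simp add: mult.commute)
  finally show ?thesis by simp
qed

text \<open>The coefficient of \<open>E f\<close> in R(E b, E d) E e. As \<open>om\<close> is
  constant no derivatives occur; the last term comes from the bracket of \<open>E b\<close> and
  \<open>E d\<close>, whose coefficients are \<open>om b d a - om d b a\<close> by vanishing
  torsion.\<close>

definition Rc :: "nat \<Rightarrow> nat \<Rightarrow> nat \<Rightarrow> nat \<Rightarrow> real" where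
  "Rc b d e f = (\<Sum>a<n. om b a f * om d e a - om d a f * om b e a - (om b d a - om d b a) * om a e f)"

text \<open>Cartan's second structure equation. The identity \<open>th_christoffel\<close> is
  differentiated and antisymmetrised: the second derivatives of \<open>th\<close> drop out by
  symmetry, and the products of first derivatives of \<open>th\<close> with \<open>W\<close> or with
  Christoffel symbols cancel against the quadratic part of the curvature.\<close>

lemma curv_frame_form:
  assumes fk: "f < n" "i < n" "j < n" "k < n" and y: "y \<in> U"
  shows "(\<Sum>l<n. th f l y * curv_comp M c i j k l y)
    = (\<Sum>e<n. (partial_deriv i (W j f e) y - partial_deriv j (W i f e) y
        + (\<Sum>a<n. W i f a y * W j a e y - W j f a y * W i a e y)) * th e k y)"
proof -
  have dX: "(\<Sum>l<n. partial_deriv i (th f l) y * christoffel M c l j k y + th f l y * partial_deriv i (christoffel M c l j k) y)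
    = (\<Sum>e<n. partial_deriv i (W j f e) y * th e k y + W j f e y * partial_deriv i (th e k) y)
      + partial_deriv i (partial_deriv j (th f k)) y" if ij: "i < n" "j < n" for i j
  proof -
    have "partial_deriv i (\<lambda>y. \<Sum>l<n. th f l y * christoffel M c l j k y) y = partial_deriv i (X f j k) y"
      by (rule partial_deriv_cong(1)[OF U y ij(1)]) (simp add: th_christoffel fk ij)
    moreover have "partial_deriv i (\<lambda>y. \<Sum>l<n. th f l y * christoffel M c l j k y) y
      = (\<Sum>l<n. partial_deriv i (th f l) y * christoffel M c l j k y + th f l y * partial_deriv i (christoffel M c l j k) y)"
      using ij y fk by (intro partial_deriv_sum_mult) (auto intro: th_partial smooth_on_imp_has_partial_deriv[OF christoffel_smooth])
    moreover have "partial_deriv i (X f j k) y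
      = (\<Sum>e<n. partial_deriv i (W j f e) y * th e k y + W j f e y * partial_deriv i (th e k) y)
      + partial_deriv i (partial_deriv j (th f k)) y"
    proof -
      have W: "has_partial_deriv i (W j f e) y" for e
        by (rule smooth_on_imp_has_partial_deriv[OF W_smooth[OF ij(2)] ij(1) y])
      have "has_partial_deriv i (\<lambda>y. \<Sum>e<n. W j f e y * th e k y) y"
        "partial_deriv i (\<lambda>y. \<Sum>e<n. W j f e y * th e k y) y
          = (\<Sum>e<n. partial_deriv i (W j f e) y * th e k y + W j f e y * partial_deriv i (th e k) y)"
        using ij y fk W by (auto intro!: partial_deriv_sum_mult th_partial)
      moreover have "has_partial_deriv i (partial_deriv j (th f k)) y"
        using ij y fk by (intro smooth_on_imp_has_partial_deriv[OF smooth_on_partial_deriv[OF th_smooth]])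
      ultimately show ?thesis by (simp add: X_def[abs_def] partial_deriv_add)
    qed
    ultimately show ?thesis by simp
  qed
  have quad: "(\<Sum>l<n. th f l y * (\<Sum>m<n. christoffel M c l i m y * christoffel M c m j k y))
    = (\<Sum>a<n. W i f a y * (\<Sum>e<n. W j a e y * th e k y)) + (\<Sum>a<n. W i f a y * partial_deriv j (th a k) y)
      + (\<Sum>m<n. partial_deriv i (th f m) y * christoffel M c m j k y)" if ij: "i < n" "j < n" for i j
  proof -
    have "(\<Sum>l<n. th f l y * (\<Sum>m<n. christoffel M c l i m y * christoffel M c m j k y))
      = (\<Sum>m<n. (\<Sum>l<n. th f l y * christoffel M c l i m y) * christoffel M c m j k y)"
      unfolding sum_distrib_left sum_distrib_right by (subst sum.swap) (simp add: mult_ac)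
    also have "\<dots> = (\<Sum>m<n. X f i m y * christoffel M c m j k y)"
      using ij fk y by (simp add: th_christoffel)
    also have "\<dots> = (\<Sum>m<n. (\<Sum>a<n. W i f a y * th a m y) * christoffel M c m j k y)
       + (\<Sum>m<n. partial_deriv i (th f m) y * christoffel M c m j k y)"
      by (simp add: X_def distrib_right sum.distrib)
    also have "(\<Sum>m<n. (\<Sum>a<n. W i f a y * th a m y) * christoffel M c m j k y)
       = (\<Sum>a<n. W i f a y * (\<Sum>m<n. th a m y * christoffel M c m j k y))"
      unfolding sum_distrib_left sum_distrib_right by (subst sum.swap) (simp add: mult_ac)
    also have "\<dots> = (\<Sum>a<n. W i f a y * X a j k y)"
      using ij fk y by (simp add: th_christoffel)
    also have "\<dots> = (\<Sum>a<n. W i f a y * (\<Sum>e<n. W j a e y * th e k y)) + (\<Sum>a<n. W i f a y * partial_deriv j (th a k) y)"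
      by (simp add: X_def distrib_left sum.distrib)
    finally show ?thesis .
  qed
  have WW: "(\<Sum>a<n. W i f a y * (\<Sum>e<n. W j a e y * th e k y)) = (\<Sum>e<n. (\<Sum>a<n. W i f a y * W j a e y) * th e k y)" for i j
    unfolding sum_distrib_left sum_distrib_right by (subst sum.swap) (simp add: mult_ac)
  have "(\<Sum>l<n. th f l y * curv_comp M c i j k l y)
    = (\<Sum>l<n. th f l y * partial_deriv i (christoffel M c l j k) y) - (\<Sum>l<n. th f l y * partial_deriv j (christoffel M c l i k) y)
      + (\<Sum>l<n. th f l y * (\<Sum>m<n. christoffel M c l i m y * christoffel M c m j k y))
      - (\<Sum>l<n. th f l y * (\<Sum>m<n. christoffel M c l j m y * christoffel M c m i k y))"
    unfolding curv_comp_def dim by (simp add: algebra_simps sum.distrib sum_subtractf)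
  also have "\<dots> = (\<Sum>e<n. partial_deriv i (W j f e) y * th e k y) - (\<Sum>e<n. partial_deriv j (W i f e) y * th e k y)
      + (\<Sum>e<n. (\<Sum>a<n. W i f a y * W j a e y) * th e k y) - (\<Sum>e<n. (\<Sum>a<n. W j f a y * W i a e y) * th e k y)"
    using dX[OF fk(2,3)] dX[OF fk(3,2)] partial_deriv_commute[OF U th_smooth[OF fk(1,4)] y fk(2,3)]
    unfolding quad[OF fk(2,3)] quad[OF fk(3,2)] WW sum.distrib by linarith
  also have "\<dots> = (\<Sum>e<n. (partial_deriv i (W j f e) y - partial_deriv j (W i f e) y
        + (\<Sum>a<n. W i f a y * W j a e y - W j f a y * W i a e y)) * th e k y)"
    by (simp add: algebra_simps sum.distrib sum_subtractf)
  finally show ?thesis .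
qed

text \<open>Since \<open>om\<close> is constant, the exterior derivative of a connection form is a
  constant combination of the exterior derivatives of the coframe, which \<open>structure_eq\<close>
  expresses without derivatives.\<close>

lemma curv_form:
  assumes fk: "f < n" "i < n" "j < n" "e < n" and y: "y \<in> U"
  shows "partial_deriv i (W j f e) y - partial_deriv j (W i f e) y
        + (\<Sum>a<n. W i f a y * W j a e y - W j f a y * W i a e y)
     = (\<Sum>b<n. \<Sum>d<n. Rc b d e f * th b i y * th d j y)"
proof -
  have dW: "partial_deriv i (W j f e) y = (\<Sum>a<n. om a e f * partial_deriv i (th a j) y)" if "i < n" "j < n" for i j
    unfolding W_def[abs_def] using that y th_partial
    by (subst partial_deriv_sum_mult) (auto simp: partial_deriv_const)
  have "partial_deriv i (W j f e) y - partial_deriv j (W i f e) y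
    = (\<Sum>a<n. om a e f * (partial_deriv i (th a j) y - partial_deriv j (th a i) y))"
    using fk by (simp add: dW right_diff_distrib sum_subtractf)
  also have "\<dots> = (\<Sum>a<n. om a e f * (- (\<Sum>b<n. \<Sum>d<n. (om b d a - om d b a) * th b i y * th d j y)))"
  proof (rule sum.cong[OF refl])
    fix a assume a: "a \<in> {..<n}"
    have "(\<Sum>b<n. \<Sum>d<n. om b d a * th b j y * th d i y) = (\<Sum>b<n. \<Sum>d<n. om d b a * th b i y * th d j y)"
      by (subst sum.swap) (simp add: mult_ac)
    then have "partial_deriv i (th a j) y - partial_deriv j (th a i) y
       = - (\<Sum>b<n. \<Sum>d<n. (om b d a - om d b a) * th b i y * th d j y)"
      using structure_eq[of a i j y] a fk y by (simp add: left_diff_distrib sum_subtractf)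
    then show "om a e f * (partial_deriv i (th a j) y - partial_deriv j (th a i) y)
      = om a e f * (- (\<Sum>b<n. \<Sum>d<n. (om b d a - om d b a) * th b i y * th d j y))" by simp
  qed
  also have "\<dots> = (\<Sum>a<n. \<Sum>b<n. \<Sum>d<n. - ((om b d a - om d b a) * om a e f) * th b i y * th d j y)"
    by (simp add: sum_distrib_left sum_negf[symmetric] mult_ac)
  also have "\<dots> = (\<Sum>b<n. \<Sum>d<n. (\<Sum>a<n. - ((om b d a - om d b a) * om a e f)) * th b i y * th d j y)"
    unfolding sum_distrib_right by (subst sum.swap, rule sum.cong[OF refl], subst sum.swap) simp
  finally have 1: "partial_deriv i (W j f e) y - partial_deriv j (W i f e) y
    = (\<Sum>b<n. \<Sum>d<n. (\<Sum>a<n. - ((om b d a - om d b a) * om a e f)) * th b i y * th d j y)" .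
  have WW: "(\<Sum>a<n. W i f a y * W j a e y) = (\<Sum>b<n. \<Sum>d<n. (\<Sum>a<n. om b a f * om d e a) * th b i y * th d j y)" for i j
  proof -
    have "(\<Sum>a<n. W i f a y * W j a e y) = (\<Sum>a<n. \<Sum>b<n. \<Sum>d<n. (om b a f * om d e a) * th b i y * th d j y)"
      by (simp add: W_def sum_product mult_ac)
    also have "\<dots> = (\<Sum>b<n. \<Sum>d<n. (\<Sum>a<n. om b a f * om d e a) * th b i y * th d j y)"
      unfolding sum_distrib_right by (subst sum.swap, rule sum.cong[OF refl], subst sum.swap) simp
    finally show ?thesis .
  qed
  have WW': "(\<Sum>a<n. W j f a y * W i a e y) = (\<Sum>b<n. \<Sum>d<n. (\<Sum>a<n. om d a f * om b e a) * th b i y * th d j y)"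
  proof -
    have "(\<Sum>a<n. W j f a y * W i a e y) = (\<Sum>d<n. \<Sum>b<n. (\<Sum>a<n. om d a f * om b e a) * th b i y * th d j y)"
      unfolding WW by (simp only: mult.assoc mult.commute[of "th _ j y"])
    also have "\<dots> = (\<Sum>b<n. \<Sum>d<n. (\<Sum>a<n. om d a f * om b e a) * th b i y * th d j y)"
      by (rule sum.swap)
    finally show ?thesis .
  qed
  have "partial_deriv i (W j f e) y - partial_deriv j (W i f e) y
        + (\<Sum>a<n. W i f a y * W j a e y - W j f a y * W i a e y)
    = (\<Sum>b<n. \<Sum>d<n. ((\<Sum>a<n. - ((om b d a - om d b a) * om a e f)) + (\<Sum>a<n. om b a f * om d e a)
        - (\<Sum>a<n. om d a f * om b e a)) * th b i y * th d j y)"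
    unfolding sum_subtractf 1 WW[of i j] WW' by (simp add: distrib_right left_diff_distrib sum.distrib sum_subtractf)
  also have "\<dots> = (\<Sum>b<n. \<Sum>d<n. Rc b d e f * th b i y * th d j y)"
  proof -
    have "(\<Sum>a<n. - ((om b d a - om d b a) * om a e f)) + (\<Sum>a<n. om b a f * om d e a)
        - (\<Sum>a<n. om d a f * om b e a) = Rc b d e f" for b d
      unfolding Rc_def sum_subtractf sum_negf by linarith
    then show ?thesis by simp
  qed
  finally show ?thesis .
qed

lemma curv_comp_frame:
  assumes fk: "i < n" "j < n" "k < n" "l < n" and y: "y \<in> U"
  shows "curv_comp M c i j k l y
    = (\<Sum>f<n. E f l y * (\<Sum>e<n. (\<Sum>b<n. \<Sum>d<n. Rc b d e f * th b i y * th d j y) * th e k y))"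
proof -
  have "curv_comp M c i j k l y = (\<Sum>f<n. E f l y * (\<Sum>l<n. th f l y * curv_comp M c i j k l y))"
    using frame_expand[OF fk(4) y, of "\<lambda>l. curv_comp M c i j k l y"] by simp
  also have "\<dots> = (\<Sum>f<n. E f l y * (\<Sum>e<n. (\<Sum>b<n. \<Sum>d<n. Rc b d e f * th b i y * th d j y) * th e k y))"
    using fk y by (intro sum.cong) (auto simp: curv_frame_form curv_form)
  finally show ?thesis .
qed

lemma curvature_frame:
  assumes l: "l < n" and y: "y \<in> U"
  shows "(\<Sum>i<n. \<Sum>j<n. \<Sum>k<n. curv_comp M c i j k l y * u i * v j * w k)
    = (\<Sum>f<n. (\<Sum>e<n. (\<Sum>b<n. \<Sum>d<n. Rc b d e f * (\<Sum>i<n. th b i y * u i) * (\<Sum>i<n. th d i y * v i))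
        * (\<Sum>i<n. th e i y * w i)) * E f l y)"
proof -
  define F where "F = (\<lambda>f e i j. \<Sum>b<n. \<Sum>d<n. Rc b d e f * th b i y * th d j y)"
  have cF: "curv_comp M c i j k l y = (\<Sum>f<n. E f l y * (\<Sum>e<n. F f e i j * th e k y))"
    if "i < n" "j < n" "k < n" for i j k
    unfolding F_def by (rule curv_comp_frame[OF that l y])
  have "(\<Sum>k<n. curv_comp M c i j k l y * u i * v j * w k)
    = (\<Sum>f<n. \<Sum>e<n. (F f e i j * (u i * v j)) * (E f l y * (\<Sum>k<n. th e k y * w k)))" if ij: "i < n" "j < n" for i j
  proof -
    have "(\<Sum>k<n. curv_comp M c i j k l y * u i * v j * w k)
      = (\<Sum>k<n. \<Sum>f<n. \<Sum>e<n. (F f e i j * (u i * v j)) * (E f l y * (th e k y * w k)))"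
      using ij by (simp add: cF sum_distrib_left sum_distrib_right mult_ac)
    also have "\<dots> = (\<Sum>f<n. \<Sum>e<n. \<Sum>k<n. (F f e i j * (u i * v j)) * (E f l y * (th e k y * w k)))"
      by (rule sum_swap3[symmetric])
    finally show ?thesis by (simp add: sum_distrib_left)
  qed
  then have "(\<Sum>i<n. \<Sum>j<n. \<Sum>k<n. curv_comp M c i j k l y * u i * v j * w k)
    = (\<Sum>i<n. \<Sum>j<n. \<Sum>f<n. \<Sum>e<n. (F f e i j * (u i * v j)) * (E f l y * (\<Sum>k<n. th e k y * w k)))"
    by simp
  also have "\<dots> = (\<Sum>f<n. \<Sum>e<n. \<Sum>i<n. \<Sum>j<n. (F f e i j * (u i * v j)) * (E f l y * (\<Sum>k<n. th e k y * w k)))"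
    by (rule sum_swap4)
  also have "\<dots> = (\<Sum>f<n. \<Sum>e<n. (\<Sum>i<n. \<Sum>j<n. F f e i j * (u i * v j)) * (E f l y * (\<Sum>k<n. th e k y * w k)))"
    by (simp only: sum_distrib_right)
  finally show ?thesis
    unfolding F_def sum_contract2 by (simp add: sum_distrib_left sum_distrib_right mult_ac)
qed

text \<open>The part of the covariant derivative of a field with frame coefficients \<open>f\<close>
  along a curve with velocity \<xi> that does not differentiate \<open>f\<close>. The remaining
  Leibniz term is added in \<open>cov_deriv_comb\<close>.\<close>

lemma cov_deriv_frame:
  assumes k: "k < n" and y: "y \<in> U"
  shows "(\<Sum>a<n. f a * (\<Sum>i<n. partial_deriv i (E a k) y * \<xi> i))
      + (\<Sum>i<n. \<Sum>j<n. christoffel M c k i j y * \<xi> i * (\<Sum>a<n. f a * E a j y))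
    = (\<Sum>b<n. (\<Sum>a<n. \<Sum>d<n. om a d b * (\<Sum>i<n. th a i y * \<xi> i) * f d) * E b k y)"
proof -
  have "(\<Sum>i<n. \<Sum>j<n. christoffel M c k i j y * \<xi> i * (\<Sum>a<n. f a * E a j y))
    = (\<Sum>i<n. \<Sum>j<n. \<Sum>a<n. f a * (\<xi> i * (christoffel M c k i j y * E a j y)))"
    by (simp add: sum_distrib_left mult_ac)
  also have "\<dots> = (\<Sum>a<n. f a * (\<Sum>i<n. (\<Sum>j<n. christoffel M c k i j y * E a j y) * \<xi> i))"
    by (rule trans[OF sum_swap3]) (simp add: sum_distrib_left sum_distrib_right mult_ac)
  finally have "(\<Sum>a<n. f a * (\<Sum>i<n. partial_deriv i (E a k) y * \<xi> i))
      + (\<Sum>i<n. \<Sum>j<n. christoffel M c k i j y * \<xi> i * (\<Sum>a<n. f a * E a j y))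
    = (\<Sum>a<n. f a * (\<Sum>i<n. (partial_deriv i (E a k) y + (\<Sum>j<n. christoffel M c k i j y * E a j y)) * \<xi> i))"
    by (simp add: distrib_left distrib_right sum.distrib)
  also have "\<dots> = (\<Sum>a<n. f a * (\<Sum>i<n. (\<Sum>b<n. W i b a y * E b k y) * \<xi> i))"
    using k y by (simp add: nabla_E)
  also have "\<dots> = (\<Sum>a<n. \<Sum>i<n. \<Sum>b<n. f a * W i b a y * \<xi> i * E b k y)"
    by (simp add: sum_distrib_left sum_distrib_right mult_ac)
  also have "\<dots> = (\<Sum>b<n. (\<Sum>d<n. \<Sum>i<n. \<Sum>a<n. om a d b * (th a i y * \<xi> i) * f d) * E b k y)"
    by (rule trans[OF sum_swap3]) (simp add: W_def sum_distrib_left sum_distrib_right mult_ac)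
  also have "\<dots> = (\<Sum>b<n. (\<Sum>a<n. \<Sum>d<n. \<Sum>i<n. om a d b * (th a i y * \<xi> i) * f d) * E b k y)"
    by (intro sum.cong refl arg_cong2[where f = "(*)"] sum_swap3)
  finally show ?thesis by (simp add: sum_distrib_left sum_distrib_right mult.assoc)
qed

end

section \<open>Gnomonic charts of the three-sphere\<close>

text \<open>Quaternions as coordinate functions: index 0 is the real part, indices 1, 2, 3 are the
  coefficients of i, j, k.\<close>

definition qmul :: "(nat \<Rightarrow> real) \<Rightarrow> (nat \<Rightarrow> real) \<Rightarrow> nat \<Rightarrow> real" where
  "qmul p q n =
    (if n = 0 then p 0 * q 0 - p 1 * q 1 - p 2 * q 2 - p 3 * q 3
     else if n = 1 then p 0 * q 1 + p 1 * q 0 + p 2 * q 3 - p 3 * q 2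
     else if n = 2 then p 0 * q 2 - p 1 * q 3 + p 2 * q 0 + p 3 * q 1
     else if n = 3 then p 0 * q 3 + p 1 * q 2 - p 2 * q 1 + p 3 * q 0
     else 0)"

definition qconj :: "(nat \<Rightarrow> real) \<Rightarrow> nat \<Rightarrow> real" where
  "qconj p n = (if n = 0 then p 0 else - p n)"

definition S3 :: "(nat \<Rightarrow> real) set" where
  "S3 = {p. (\<forall>n\<ge>4. p n = 0) \<and> (p 0)\<^sup>2 + (p 1)\<^sup>2 + (p 2)\<^sup>2 + (p 3)\<^sup>2 = 1}"

abbreviation R3 :: "(nat \<Rightarrow> real) set" where
  "R3 \<equiv> {y. \<forall>i\<ge>3. y i = 0}"

text \<open>The quaternion with real part 1 and imaginary part \<open>y\<close>. Chart coordinates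
  0, 1, 2 are the quaternion coordinates 1, 2, 3, whence the shift by one.\<close>

definition lift :: "(nat \<Rightarrow> real) \<Rightarrow> nat \<Rightarrow> real" where
  "lift y n = (if n = 0 then 1 else if n \<le> 3 then y (n - 1) else 0)"

definition den :: "(nat \<Rightarrow> real) \<Rightarrow> real" where
  "den y = 1 + (y 0)\<^sup>2 + (y 1)\<^sup>2 + (y 2)\<^sup>2"

text \<open>Gnomonic coordinates centred at the unit quaternion \<open>g\<close>: central projection of a half sphere.\<close>

definition chart_map :: "(nat \<Rightarrow> real) \<Rightarrow> (nat \<Rightarrow> real) \<Rightarrow> nat \<Rightarrow> real" where
  "chart_map g x k = (if k < 3 then qmul (qconj g) x (Suc k) / qmul (qconj g) x 0 else 0)"

definition gnomonic :: "(nat \<Rightarrow> real) \<Rightarrow> (nat \<Rightarrow> real) chart" where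
  "gnomonic g = ({x \<in> S3. qmul (qconj g) x 0 > 0}, chart_map g)"

text \<open>The inverse of the gnomonic chart: \<open>den y\<close> is the squared norm of
  \<open>lift y\<close>, so a point of the affine tangent space at 1 is projected radially onto the
  sphere and translated by \<open>g\<close>.\<close>

definition point :: "(nat \<Rightarrow> real) \<Rightarrow> (nat \<Rightarrow> real) \<Rightarrow> nat \<Rightarrow> real" where
  "point g y n = qmul g (lift y) n / sqrt (den y)"

text \<open>With the weight \<open>\<mu>\<^sup>2\<close> on the third direction, every plane containing that direction has curvature 1.\<close>

definition lam :: "real \<Rightarrow> nat \<Rightarrow> real" where
  "lam \<mu> a = (if a = 2 then \<mu>\<^sup>2 else \<mu>)"

text \<open>The components of a tangent vector at \<open>p\<close> in the chart centred at \<open>p\<close> are its components in the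
  left-invariant frame.\<close>

definition berger :: "real \<Rightarrow> (nat \<Rightarrow> real) riemannian" where
  "berger \<mu> = \<lparr>points = S3, mdim = 3, charts = gnomonic ` S3,
     metric = (\<lambda>p v w. \<Sum>a<3. lam \<mu> a * v (gnomonic p) a * w (gnomonic p) a)\<rparr>"

lemma berger_simps [simp]:
  "points (berger \<mu>) = S3" "mdim (berger \<mu>) = 3" "charts (berger \<mu>) = gnomonic ` S3"
  "metric (berger \<mu>) p v w = (\<Sum>a<3. lam \<mu> a * v (gnomonic p) a * w (gnomonic p) a)"
  by (simp_all add: berger_def)

section \<open>Quaternion arithmetic and inverses of the charts\<close>

lemma less_three: "k < 3 \<longleftrightarrow> k = 0 \<or> k = 1 \<or> k = (2::nat)"
  by auto

lemma sum_three: "(\<Sum>k<(3::nat). f k) = f 0 + f 1 + (f 2 :: real)"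
  by (simp add: eval_nat_numeral)

lemma qmul_assoc: "qmul (qmul a b) c = qmul a (qmul b c)"
  by (rule ext) (simp add: qmul_def algebra_simps)

lemma qmul_qconj_self: "g \<in> S3 \<Longrightarrow> qmul (qconj g) g = (\<lambda>n. if n = 0 then 1 else 0)"
  by (auto simp: fun_eq_iff qmul_def qconj_def S3_def power2_eq_square)

lemma qmul_self_qconj: "g \<in> S3 \<Longrightarrow> qmul g (qconj g) = (\<lambda>n. if n = 0 then 1 else 0)"
  by (auto simp: fun_eq_iff qmul_def qconj_def S3_def power2_eq_square)

lemma qmul_one_left: "(\<And>n. 4 \<le> n \<Longrightarrow> x n = 0) \<Longrightarrow> qmul (\<lambda>n. if n = 0 then 1 else 0) x = x"
  by (rule ext) (auto simp: qmul_def eval_nat_numeral not_less_eq_eq)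

lemma qmul_lift_one: "qmul (\<lambda>n. if n = 0 then 1 else 0) (lift y) = lift y"
  by (rule qmul_one_left) (simp add: lift_def)

lemma qmul_scale: "qmul p (\<lambda>n. x n / r) n = qmul p x n / r"
  by (simp add: qmul_def add_divide_distrib diff_divide_distrib)

lemma qmul_norm:
  "(qmul p q 0)\<^sup>2 + (qmul p q 1)\<^sup>2 + (qmul p q 2)\<^sup>2 + (qmul p q 3)\<^sup>2
   = ((p 0)\<^sup>2 + (p 1)\<^sup>2 + (p 2)\<^sup>2 + (p 3)\<^sup>2) * ((q 0)\<^sup>2 + (q 1)\<^sup>2 + (q 2)\<^sup>2 + (q 3)\<^sup>2)"
  by (simp add: qmul_def power2_eq_square algebra_simps)

lemma den_pos: "den y > 0"
  unfolding den_def by (simp add: add_pos_nonneg)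

lemma point_in_S3: "g \<in> S3 \<Longrightarrow> point g y \<in> S3"
proof -
  assume g: "g \<in> S3"
  have "(point g y 0)\<^sup>2 + (point g y 1)\<^sup>2 + (point g y 2)\<^sup>2 + (point g y 3)\<^sup>2
    = ((qmul g (lift y) 0)\<^sup>2 + (qmul g (lift y) 1)\<^sup>2 + (qmul g (lift y) 2)\<^sup>2 + (qmul g (lift y) 3)\<^sup>2) / den y"
    using den_pos[of y] by (simp add: point_def power_divide add_divide_distrib)
  also have "\<dots> = 1"
    unfolding qmul_norm using g den_pos[of y] by (simp add: S3_def lift_def den_def)
  finally show ?thesis
    by (simp add: S3_def) (simp add: point_def qmul_def)
qed

lemma qmul_qconj_point: "qmul (qconj h) (point g y) n = qmul (qmul (qconj h) g) (lift y) n / sqrt (den y)"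
  unfolding point_def[abs_def] qmul_scale qmul_assoc ..

lemma qmul_qconj_point_self: "g \<in> S3 \<Longrightarrow> qmul (qconj g) (point g y) n = lift y n / sqrt (den y)"
  by (simp add: qmul_qconj_point qmul_qconj_self qmul_lift_one)

lemma chart_map_R3: "chart_map g x \<in> R3"
  by (simp add: chart_map_def)

lemma point_in_gnomonic: "g \<in> S3 \<Longrightarrow> point g y \<in> fst (gnomonic g)"
  using den_pos[of y] by (simp add: gnomonic_def point_in_S3 qmul_qconj_point_self lift_def)

lemma chart_map_point: "g \<in> S3 \<Longrightarrow> y \<in> R3 \<Longrightarrow> chart_map g (point g y) = y"
  using den_pos[of y] by (auto simp: fun_eq_iff chart_map_def qmul_qconj_point_self lift_def)

lemma point_chart_map:
  assumes g: "g \<in> S3" and x: "x \<in> fst (gnomonic g)"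
  shows "point g (chart_map g x) = x"
proof -
  define z where "z = qmul (qconj g) x"
  have x': "x \<in> S3" "z 0 > 0" using x by (auto simp: gnomonic_def z_def)
  have z: "z n = 0" if "4 \<le> n" for n using that by (simp add: z_def qmul_def)
  have nz: "(z 0)\<^sup>2 + (z 1)\<^sup>2 + (z 2)\<^sup>2 + (z 3)\<^sup>2 = 1"
    unfolding z_def qmul_norm using g x' by (simp add: S3_def qconj_def)
  have l: "lift (chart_map g x) = (\<lambda>n. z n / z 0)"
  proof
    fix n :: nat
    consider "n = 0" | "n \<in> {1, 2, 3}" | "4 \<le> n" by fastforce
    then show "lift (chart_map g x) n = z n / z 0"
    proof cases
      case 3
      then show ?thesis using z[of n] by (simp add: lift_def)
    qed (use x'(2) in \<open>auto simp: lift_def chart_map_def z_def[symmetric] eval_nat_numeral\<close>)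
  qed
  have "den (chart_map g x) = 1 + (z 1 / z 0)\<^sup>2 + (z 2 / z 0)\<^sup>2 + (z 3 / z 0)\<^sup>2"
    by (simp add: den_def chart_map_def z_def[symmetric] eval_nat_numeral)
  also have "\<dots> = ((z 0)\<^sup>2 + (z 1)\<^sup>2 + (z 2)\<^sup>2 + (z 3)\<^sup>2) / (z 0)\<^sup>2"
    using x'(2) by (simp add: power_divide add_divide_distrib)
  finally have "sqrt (den (chart_map g x)) = 1 / z 0"
    using nz x'(2) by (simp add: real_sqrt_divide)
  then have "point g (chart_map g x) n = qmul g z n" for n
    using x'(2) by (simp add: point_def l qmul_scale)
  moreover have "qmul g z = x"
    unfolding z_def qmul_assoc[symmetric] using g x'
    by (simp add: qmul_self_qconj qmul_one_left S3_def)
  ultimately show ?thesis by auto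
qed

lemma snd_gnomonic [simp]: "snd (gnomonic g) = chart_map g"
  by (simp add: gnomonic_def)

lemma chart_map_image: "g \<in> S3 \<Longrightarrow> chart_map g ` fst (gnomonic g) = R3"
proof (intro equalityI subsetI)
  fix y assume "g \<in> S3" "y \<in> R3"
  then show "y \<in> chart_map g ` fst (gnomonic g)"
    by (intro image_eqI[where x = "point g y"]) (auto simp: chart_map_point point_in_gnomonic)
qed (auto simp: chart_map_def)

lemma inj_chart_map: "g \<in> S3 \<Longrightarrow> inj_on (chart_map g) (fst (gnomonic g))"
  by (metis inj_on_inverseI point_chart_map)

lemma chart_inv_gnomonic: "g \<in> S3 \<Longrightarrow> y \<in> R3 \<Longrightarrow> chart_inv (gnomonic g) y = point g y"
  unfolding chart_inv_def snd_gnomonic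
  by (rule inv_into_f_eq) (auto simp: inj_chart_map point_in_gnomonic chart_map_point)

lemma self_in_gnomonic: "p \<in> S3 \<Longrightarrow> p \<in> fst (gnomonic p)"
  by (simp add: gnomonic_def qmul_qconj_self)

lemma chart_map_self: "p \<in> S3 \<Longrightarrow> chart_map p p = (\<lambda>k. 0)"
  by (simp add: chart_map_def qmul_qconj_self fun_eq_iff)

lemma charts_at_berger: "c \<in> charts_at (berger \<mu>) p \<longleftrightarrow> (\<exists>g\<in>S3. c = gnomonic g \<and> p \<in> fst (gnomonic g))"
  by (auto simp: charts_at_def)

lemma fst_gnomonic_subset: "fst (gnomonic g) \<subseteq> S3"
  by (auto simp: gnomonic_def)

lemma continuous_on_coord [continuous_intros]:
  "continuous_on S (\<lambda>x. x j :: real)"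
  by (rule continuous_on_subset[OF continuous_on_product_coordinates]) simp

lemma continuous_on_qmul [continuous_intros]:
  "(\<And>n. continuous_on S (\<lambda>x. f x n)) \<Longrightarrow> (\<And>n. continuous_on S (\<lambda>x. g x n)) \<Longrightarrow>
    continuous_on S (\<lambda>x. qmul (f x) (g x) n)"
  unfolding qmul_def by (cases "n = 0"; cases "n = 1"; cases "n = 2"; cases "n = 3") (auto intro!: continuous_intros)

lemma continuous_on_chart_map: "continuous_on (fst (gnomonic g)) (chart_map g)"
proof (rule continuous_on_coordinatewise_then_product)
  fix k show "continuous_on (fst (gnomonic g)) (\<lambda>x. chart_map g x k)"
    by (cases "k < 3") (auto simp: chart_map_def gnomonic_def intro!: continuous_intros)
qed

lemma continuous_on_point: "continuous_on S (point g)"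
proof (rule continuous_on_coordinatewise_then_product)
  have "continuous_on S (\<lambda>y. lift y n)" for n
    by (cases "n = 0"; cases "n \<le> 3") (auto simp: lift_def intro!: continuous_intros)
  moreover have "den y \<noteq> 0" for y using den_pos[of y] by simp
  moreover have "continuous_on S den"
    unfolding den_def[abs_def] by (intro continuous_intros)
  ultimately show "continuous_on S (\<lambda>y. point g y n)" for n
    unfolding point_def by (intro continuous_intros) auto
qed

lemma openin_R3: "openin (Euclidean_space 3) R3"
  unfolding openin_Euclidean_space_iff by (rule exI[of _ UNIV]) simp

lemma homeomorphism_gnomonic:
  assumes "g \<in> S3"
  shows "homeomorphism (fst (gnomonic g)) R3 (chart_map g) (chart_inv (gnomonic g))"
proof (rule homeomorphismI)
  show "continuous_on R3 (chart_inv (gnomonic g))"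
    by (subst continuous_on_cong[OF refl chart_inv_gnomonic[OF assms]]) (auto intro: continuous_on_point)
qed (use assms in \<open>auto simp: continuous_on_chart_map chart_inv_gnomonic chart_map_R3[simplified] point_in_gnomonic
     chart_map_point point_chart_map chart_map_def[of _ _ "_::nat"]\<close>)

lemma openin_gnomonic: "openin (top_of_set S3) (fst (gnomonic g))"
proof -
  have "open {x. 0 < qmul (qconj g) x 0}"
    by (intro open_Collect_less continuous_intros)
  then have "openin (top_of_set S3) (S3 \<inter> {x. 0 < qmul (qconj g) x 0})"
    by (rule openin_open_Int)
  then show ?thesis by (simp add: gnomonic_def Int_def)
qed

subsection \<open>Transition maps\<close>

text \<open>The change from the chart at \<open>g\<close> to the chart at \<open>h\<close> depends
  only on the quotient \<open>q = qmul (qconj h) g\<close> and is fractional linear, so its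
  derivatives are explicit.\<close>

definition trans_map :: "(nat \<Rightarrow> real) \<Rightarrow> (nat \<Rightarrow> real) \<Rightarrow> nat \<Rightarrow> real" where
  "trans_map q y k = (if k < 3 then qmul q (lift y) (Suc k) / qmul q (lift y) 0 else 0)"

lemma chart_map_point_trans: "chart_map h (point g y) = trans_map (qmul (qconj h) g) y"
proof
  fix k show "chart_map h (point g y) k = trans_map (qmul (qconj h) g) y k"
    using den_pos[of y] by (simp add: chart_map_def trans_map_def qmul_qconj_point)
qed

lemma transition_eq:
  "g \<in> S3 \<Longrightarrow> y \<in> R3 \<Longrightarrow> snd (gnomonic h) (chart_inv (gnomonic g) y) = trans_map (qmul (qconj h) g) y"
  by (simp add: chart_inv_gnomonic chart_map_point_trans)

lemma point_in_gnomonic_iff: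
  "g \<in> S3 \<Longrightarrow> point g y \<in> fst (gnomonic h) \<longleftrightarrow> qmul (qmul (qconj h) g) (lift y) 0 > 0"
  using den_pos[of y] by (simp add: gnomonic_def qmul_qconj_point point_in_S3 zero_less_divide_iff)

lemma chart_map_overlap:
  assumes "g \<in> S3"
  shows "chart_map g ` (fst (gnomonic g) \<inter> fst (gnomonic h)) = R3 \<inter> {y. qmul (qmul (qconj h) g) (lift y) 0 > 0}"
proof (intro equalityI subsetI)
  fix y assume "y \<in> R3 \<inter> {y. qmul (qmul (qconj h) g) (lift y) 0 > 0}"
  then show "y \<in> chart_map g ` (fst (gnomonic g) \<inter> fst (gnomonic h))"
    using point_in_gnomonic_iff[OF assms, of y h] point_in_gnomonic[OF assms, of y] chart_map_point[OF assms, of y]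
    by (metis (no_types, lifting) Int_iff image_eqI mem_Collect_eq)
next
  fix y assume "y \<in> chart_map g ` (fst (gnomonic g) \<inter> fst (gnomonic h))"
  then obtain x where x: "x \<in> fst (gnomonic g)" "x \<in> fst (gnomonic h)" "y = chart_map g x" by auto
  then have "point g y = x" using point_chart_map[OF assms] by simp
  then show "y \<in> R3 \<inter> {y. qmul (qmul (qconj h) g) (lift y) 0 > 0}"
    using x point_in_gnomonic_iff[OF assms, of y h] chart_map_R3[of g x] by auto
qed

lemma qmul_lift:
  "qmul q (lift y) n = (if n = 0 then q 0 - q 1 * y 0 - q 2 * y 1 - q 3 * y 2
     else if n = 1 then q 0 * y 0 + q 1 + q 2 * y 2 - q 3 * y 1
     else if n = 2 then q 0 * y 1 - q 1 * y 2 + q 2 + q 3 * y 0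
     else if n = 3 then q 0 * y 2 + q 1 * y 1 - q 2 * y 0 + q 3
     else 0)"
  by (simp add: qmul_def lift_def)

lemma openin_overlap: "openin (Euclidean_space 3) (R3 \<inter> {y. qmul q (lift y) 0 > 0})"
  unfolding openin_Euclidean_space_iff
proof (intro exI conjI)
  show "open {y. qmul q (lift y) 0 > 0}"
    unfolding qmul_lift by (simp, intro open_Collect_less continuous_intros)
qed auto

lemma trans_map_smooth:
  assumes U: "openin (Euclidean_space 3) U" and nz: "\<And>y. y \<in> U \<Longrightarrow> qmul q (lift y) 0 \<noteq> 0" and k: "k < 3"
  shows "smooth_on 3 U (\<lambda>y. trans_map q y k)"
proof -
  have "smooth_on 3 U (\<lambda>y. qmul q (lift y) n)" for n
    unfolding qmul_lift by (cases "n = 0"; cases "n = 1"; cases "n = 2"; cases "n = 3")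
      (simp_all, (intro smooth_on_intros[OF U])+)
  then show ?thesis
    unfolding trans_map_def using k nz by (simp, intro smooth_on_divide[OF U]) auto
qed

lemma smooth_manifold_berger: "smooth_manifold (berger \<mu>)"
  unfolding smooth_manifold_def berger_simps
proof (intro conjI ballI allI impI)
  have "(\<lambda>n. if n = 0 then 1 else 0) \<in> S3" by (simp add: S3_def)
  then show "S3 \<noteq> {}" by auto
  show "S3 = (\<Union>c\<in>gnomonic ` S3. fst c)"
    using self_in_gnomonic fst_gnomonic_subset by fastforce
next
  fix c assume "c \<in> gnomonic ` S3"
  then obtain g where g: "g \<in> S3" "c = gnomonic g" by auto
  then show "openin (top_of_set S3) (fst c)" "openin (Euclidean_space 3) (snd c ` fst c)"
    "homeomorphism (fst c) (snd c ` fst c) (snd c) (chart_inv c)"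
    using openin_R3 by (simp_all add: openin_gnomonic chart_map_image homeomorphism_gnomonic)
next
  fix c d k assume "c \<in> gnomonic ` S3" "d \<in> gnomonic ` S3" and k: "k < (3::nat)"
  then obtain g h where g: "g \<in> S3" "c = gnomonic g" "h \<in> S3" "d = gnomonic h" by auto
  let ?U = "R3 \<inter> {y. qmul (qmul (qconj h) g) (lift y) 0 > 0}"
  have "smooth_on 3 ?U (\<lambda>y. trans_map (qmul (qconj h) g) y k)"
    by (rule trans_map_smooth[OF openin_overlap _ k]) auto
  then have "smooth_on 3 ?U (\<lambda>x. snd d (chart_inv c x) k)"
    using smooth_on_cong[OF openin_overlap[of "qmul (qconj h) g"], of "\<lambda>x. snd d (chart_inv c x) k"] transition_eq[OF g(1)] g by simp
  then show "smooth_on 3 (snd c ` (fst c \<inter> fst d)) (\<lambda>x. snd d (chart_inv c x) k)"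
    using g by (simp add: chart_map_overlap)
qed

section \<open>The left-invariant frame\<close>

text \<open>Component \<open>k\<close> of the vector product of \<open>y\<close> with the basis
  vector e_a. It is the imaginary part of \<open>lift y\<close> times e_a, apart from e_a itself;
  central projection removes the real part \<open>- y a\<close> and thereby adds
  \<open>y a * y k\<close> in \<open>fr\<close>.\<close>

definition cross :: "nat \<Rightarrow> nat \<Rightarrow> (nat \<Rightarrow> real) \<Rightarrow> real" where
  "cross a k y =
    (if a = 0 \<and> k = 1 then y 2 else if a = 0 \<and> k = 2 then - y 1
     else if a = 1 \<and> k = 0 then - y 2 else if a = 1 \<and> k = 2 then y 0
     else if a = 2 \<and> k = 0 then y 1 else if a = 2 \<and> k = 1 then - y 0 else 0)"

text \<open>The left-invariant fields \<open>x \<mapsto> x i\<close>, \<open>x j\<close>, \<open>x k\<close> on the unit quaternions and their dual forms, in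
  gnomonic coordinates. The formulas are the same in every chart because the charts are left
  translates of each other.\<close>

definition fr :: "nat \<Rightarrow> nat \<Rightarrow> (nat \<Rightarrow> real) \<Rightarrow> real" where
  "fr a k y = (if a = k then 1 else 0) + cross a k y + y a * y k"

text \<open>Keeping the denominator \<open>den\<close> apart turns identities for the coframe into
  polynomial identities.\<close>

definition cofr_num :: "nat \<Rightarrow> nat \<Rightarrow> (nat \<Rightarrow> real) \<Rightarrow> real" where
  "cofr_num a i y = (if a = i then 1 else 0) + cross a i y"

definition cofr :: "nat \<Rightarrow> nat \<Rightarrow> (nat \<Rightarrow> real) \<Rightarrow> real" where
  "cofr a i y = cofr_num a i y / den y"

text \<open>From the Koszul formula and the brackets \<open>[fr 0, fr 1] = 2 fr 2\<close> and cyclic.\<close>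

definition om :: "real \<Rightarrow> nat \<Rightarrow> nat \<Rightarrow> nat \<Rightarrow> real" where
  "om \<mu> a d b =
    (if a = 0 \<and> d = 1 \<and> b = 2 then 1 else if a = 1 \<and> d = 0 \<and> b = 2 then - 1
     else if a = 0 \<and> d = 2 \<and> b = 1 then - \<mu> else if a = 2 \<and> d = 0 \<and> b = 1 then 2 - \<mu>
     else if a = 1 \<and> d = 2 \<and> b = 0 then \<mu> else if a = 2 \<and> d = 1 \<and> b = 0 then \<mu> - 2 else 0)"

abbreviation unit_vec :: "nat \<Rightarrow> nat \<Rightarrow> real" where
  "unit_vec i \<equiv> (\<lambda>m. if m = i then 1 else 0)"

section \<open>Duality, invariance under chart changes, and structure equations\<close>

lemma cofr_fr:
  assumes "a < 3" "b < 3"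
  shows "(\<Sum>k<3. cofr a k y * fr b k y) = (if a = b then 1 else 0)"
proof -
  have "(\<Sum>k<3. cofr_num a k y * fr b k y) = (if a = b then den y else 0)"
    using assms unfolding less_three
    by (elim disjE; simp add: sum_three cofr_num_def fr_def cross_def den_def power2_eq_square algebra_simps)
  then show ?thesis
    using den_pos[of y] by (simp add: cofr_def sum_divide_distrib[symmetric])
qed

lemma fr_cofr:
  assumes "k < 3" "l < 3"
  shows "(\<Sum>a<3. fr a k y * cofr a l y) = (if k = l then 1 else 0)"
proof -
  have "(\<Sum>a<3. fr a k y * cofr_num a l y) = (if k = l then den y else 0)"
    using assms unfolding less_three
    by (elim disjE; simp add: sum_three cofr_num_def fr_def cross_def den_def power2_eq_square algebra_simps)
  then show ?thesis
    using den_pos[of y] by (simp add: cofr_def sum_divide_distrib[symmetric])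
qed

lemma fr_zero: "fr a k (\<lambda>k. 0) = (if a = k then 1 else 0)"
  by (simp add: fr_def cross_def)

lemma cofr_zero: "cofr a k (\<lambda>k. 0) = (if a = k then 1 else 0)"
  by (simp add: cofr_def cofr_num_def cross_def den_def)

lemma smooth_on_if:
  "smooth_on n U f \<Longrightarrow> smooth_on n U g \<Longrightarrow> smooth_on n U (\<lambda>x. if P then f x else g x)"
  by (cases P) simp_all

lemma smooth_cross: "openin (Euclidean_space n) U \<Longrightarrow> smooth_on n U (cross a k)"
  unfolding cross_def[abs_def] by (intro smooth_on_if smooth_on_intros)

lemma smooth_fr: "openin (Euclidean_space n) U \<Longrightarrow> smooth_on n U (fr a k)"
  unfolding fr_def[abs_def] by (intro smooth_on_intros smooth_cross)

lemma smooth_den: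
  assumes "openin (Euclidean_space n) U" "\<And>i. smooth_on n U (\<lambda>x. f x i)"
  shows "smooth_on n U (\<lambda>x. den (f x))"
  unfolding den_def using assms by (intro smooth_on_intros) auto

lemma smooth_cofr_compose:
  assumes "openin (Euclidean_space n) U" "\<And>i. smooth_on n U (\<lambda>x. f x i)"
  shows "smooth_on n U (\<lambda>x. cofr a k (f x))"
proof -
  have "smooth_on n U (\<lambda>x. cross a k (f x))"
    unfolding cross_def using assms by (intro smooth_on_if smooth_on_uminus smooth_on_const)
  moreover have "den (f x) \<noteq> 0" for x using den_pos[of "f x"] by simp
  ultimately show ?thesis
    unfolding cofr_def cofr_num_def using assms by (intro smooth_on_divide smooth_on_add smooth_on_const smooth_den) auto
qed

lemma smooth_cofr: "openin (Euclidean_space n) U \<Longrightarrow> smooth_on n U (cofr a k)"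
  using smooth_cofr_compose[of n U "\<lambda>x. x"] smooth_on_coord by simp

lemma qmul_lift_deriv:
  assumes "i < 3"
  shows "((\<lambda>t. qmul q (lift (y(i := t))) n) has_real_derivative qmul q (unit_vec (Suc i)) n) (at s)"
proof -
  have *: "i = 0 \<or> i = 1 \<or> i = 2" using assms by auto
  show ?thesis
    unfolding qmul_lift
    by (cases "n = 0"; cases "n = 1"; cases "n = 2"; cases "n = 3"; insert *)
      (auto simp: qmul_def intro!: derivative_eq_intros)
qed

lemma partial_deriv_trans_map:
  assumes "i < 3" "k < 3" "qmul q (lift y) 0 \<noteq> 0"
  shows "partial_deriv i (\<lambda>y. trans_map q y k) y
    = (qmul q (unit_vec (Suc i)) (Suc k) * qmul q (lift y) 0 - qmul q (lift y) (Suc k) * qmul q (unit_vec (Suc i)) 0)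
      / (qmul q (lift y) 0)\<^sup>2"
proof -
  have "((\<lambda>t. qmul q (lift (y(i := t))) (Suc k) / qmul q (lift (y(i := t))) 0) has_real_derivative
     (qmul q (unit_vec (Suc i)) (Suc k) * qmul q (lift (y(i := y i))) 0
       - qmul q (lift (y(i := y i))) (Suc k) * qmul q (unit_vec (Suc i)) 0)
      / (qmul q (lift (y(i := y i))) 0 * qmul q (lift (y(i := y i))) 0)) (at (y i))"
    by (rule DERIV_divide[OF qmul_lift_deriv qmul_lift_deriv]) (use assms in auto)
  then show ?thesis
    using assms by (intro partial_derivI) (simp add: trans_map_def power2_eq_square)
qed

text \<open>As a quaternion, \<open>fr a\<close> is \<open>lift y\<close> times the a-th imaginary
  unit plus \<open>y a\<close> times \<open>lift y\<close>, the second summand cancelling the real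
  part. Multiplication by \<open>q\<close> from the left is linear and associative.\<close>

lemma qmul_fr:
  assumes "a < 3"
  shows "(\<Sum>i<3. qmul q (unit_vec (Suc i)) n * fr a i y)
    = qmul (qmul q (lift y)) (unit_vec (Suc a)) n + y a * qmul q (lift y) n"
proof -
  have *: "a = 0 \<or> a = 1 \<or> a = 2" using assms by auto
  have **: "lift y 0 = 1" "lift y (Suc 0) = y 0" "lift y 2 = y 1" "lift y 3 = y 2"
    by (auto simp: lift_def)
  consider "n = 0" | "n = 1" | "n = 2" | "n = 3" | "4 \<le> n" by linarith
  then show ?thesis
    using * by cases (auto simp: qmul_def ** sum_three fr_def cross_def algebra_simps)
qed

text \<open>Left invariance of the frame. The radial summand from \<open>qmul_fr\<close> does not
  change the quotient defining \<open>trans_map\<close>, so only right multiplication by an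
  imaginary unit remains, and this commutes with \<open>q\<close>.\<close>

lemma trans_map_fr:
  assumes a: "a < 3" and k: "k < 3" and nz: "qmul q (lift y) 0 \<noteq> 0"
  shows "(\<Sum>i<3. partial_deriv i (\<lambda>y. trans_map q y k) y * fr a i y) = fr a k (trans_map q y)"
proof -
  define Q where "Q = qmul q (lift y)"
  have Q: "Q 0 \<noteq> 0" using nz by (simp add: Q_def)
  have "(\<Sum>i<3. partial_deriv i (\<lambda>y. trans_map q y k) y * fr a i y)
    = (\<Sum>i<3. (qmul q (unit_vec (Suc i)) (Suc k) * fr a i y * Q 0 - Q (Suc k) * (qmul q (unit_vec (Suc i)) 0 * fr a i y)) / (Q 0)\<^sup>2)"
    using k nz by (intro sum.cong) (auto simp: partial_deriv_trans_map Q_def[symmetric] algebra_simps)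
  also have "\<dots> = ((\<Sum>i<3. qmul q (unit_vec (Suc i)) (Suc k) * fr a i y) * Q 0
      - Q (Suc k) * (\<Sum>i<3. qmul q (unit_vec (Suc i)) 0 * fr a i y)) / (Q 0)\<^sup>2"
    by (simp add: sum_divide_distrib[symmetric] sum_subtractf sum_distrib_left sum_distrib_right)
  also have "\<dots> = (qmul Q (unit_vec (Suc a)) (Suc k) * Q 0 - Q (Suc k) * qmul Q (unit_vec (Suc a)) 0) / (Q 0)\<^sup>2"
    unfolding qmul_fr[OF a] Q_def[symmetric] by (simp add: algebra_simps)
  also have "\<dots> = fr a k (trans_map q y)"
    using a k Q unfolding less_three
    by (elim disjE; simp add: fr_def cross_def trans_map_def Q_def[symmetric] qmul_def eval_nat_numeral power2_eq_square)
      (simp_all add: divide_simps algebra_simps)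
  finally show ?thesis .
qed

lemma partial_deriv_cofr:
  assumes "i < 3"
  shows "partial_deriv i (cofr b j) y
    = (cross b j (unit_vec i) * den y - cofr_num b j y * (2 * y i)) / (den y)\<^sup>2"
proof -
  have i: "i = 0 \<or> i = 1 \<or> i = 2" using assms by auto
  have "cofr_num b j (y(i := t)) = cofr_num b j y + (t - y i) * cross b j (unit_vec i)" for t
    unfolding cofr_num_def cross_def using i by (elim disjE) simp_all
  then have n: "((\<lambda>t. cofr_num b j (y(i := t))) has_real_derivative cross b j (unit_vec i)) (at s)" for s
    by (auto intro!: derivative_eq_intros)
  have d: "((\<lambda>t. den (y(i := t))) has_real_derivative 2 * s) (at s)" for s
    unfolding den_def using i by (auto intro!: derivative_eq_intros)
  have "((\<lambda>t. cofr_num b j (y(i := t)) / den (y(i := t))) has_real_derivative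
     (cross b j (unit_vec i) * den (y(i := y i)) - cofr_num b j (y(i := y i)) * (2 * y i))
      / (den (y(i := y i)) * den (y(i := y i)))) (at (y i))"
    by (rule DERIV_divide[OF n d]) (use den_pos[of y] in auto)
  then show ?thesis
    by (intro partial_derivI) (simp add: cofr_def[abs_def] power2_eq_square)
qed

text \<open>The Maurer-Cartan equations. They hold for every \<mu> because
  \<open>om \<mu> a d b - om \<mu> d a b\<close> does not depend on \<mu>. After multiplication by
  the square of \<open>den\<close> they are polynomial identities.\<close>

lemma cofr_structure:
  assumes "b < 3" "i < 3" "j < 3"
  shows "partial_deriv i (cofr b j) y + (\<Sum>a<3. \<Sum>d<3. om \<mu> a d b * cofr a i y * cofr d j y)
    = partial_deriv j (cofr b i) y + (\<Sum>a<3. \<Sum>d<3. om \<mu> a d b * cofr a j y * cofr d i y)"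
proof -
  have nz: "den y \<noteq> 0" using den_pos[of y] by simp
  have *: "partial_deriv i (cofr b j) y + (\<Sum>a<3. \<Sum>d<3. om \<mu> a d b * cofr a i y * cofr d j y)
    = (cross b j (unit_vec i) * den y - cofr_num b j y * (2 * y i)
       + (\<Sum>a<3. \<Sum>d<3. om \<mu> a d b * cofr_num a i y * cofr_num d j y)) / (den y)\<^sup>2" if "i < 3" for i j
    unfolding partial_deriv_cofr[OF that] add_divide_distrib sum_divide_distrib
    by (simp add: cofr_def power2_eq_square)
  have "cross b j (unit_vec i) * den y - cofr_num b j y * (2 * y i)
       + (\<Sum>a<3. \<Sum>d<3. om \<mu> a d b * cofr_num a i y * cofr_num d j y)
     = cross b i (unit_vec j) * den y - cofr_num b i y * (2 * y j)
       + (\<Sum>a<3. \<Sum>d<3. om \<mu> a d b * cofr_num a j y * cofr_num d i y)"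
    using assms unfolding less_three
    by (elim disjE; simp add: sum_three om_def cofr_num_def cross_def den_def power2_eq_square algebra_simps)
  then show ?thesis unfolding *[OF assms(2)] *[OF assms(3)] by simp
qed

lemma partial_deriv_transition:
  assumes "g \<in> S3" "y \<in> R3" "i < 3"
  shows "partial_deriv i (\<lambda>x. snd (gnomonic h) (chart_inv (gnomonic g) x) k) y
    = partial_deriv i (\<lambda>x. trans_map (qmul (qconj h) g) x k) y"
  by (rule partial_deriv_cong(1)[OF openin_R3 assms(2,3)])
    (simp add: transition_eq[OF assms(1), unfolded snd_gnomonic])

lemma transition_fr:
  assumes p: "p \<in> fst (gnomonic g)" "p \<in> fst (gnomonic h)" and gh: "g \<in> S3" "h \<in> S3" and a: "a < 3" "k < 3"
  shows "(\<Sum>i<3. partial_deriv i (\<lambda>x. snd (gnomonic h) (chart_inv (gnomonic g) x) k) (chart_map g p)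
      * fr a i (chart_map g p)) = fr a k (chart_map h p)"
proof -
  let ?y = "chart_map g p" and ?q = "qmul (qconj h) g"
  have pt: "point g ?y = p" by (rule point_chart_map[OF gh(1) p(1)])
  have "qmul ?q (lift ?y) 0 \<noteq> 0"
    using point_in_gnomonic_iff[OF gh(1), of ?y h] p(2) pt by auto
  from trans_map_fr[OF a this] have "(\<Sum>i<3. partial_deriv i (\<lambda>y. trans_map ?q y k) ?y * fr a i ?y) = fr a k (trans_map ?q ?y)" .
  then show ?thesis
    using chart_map_point_trans[of h g ?y] pt partial_deriv_transition[OF gh(1) chart_map_R3] by simp
qed

text \<open>At the centre of its own chart the frame is the standard basis. The differential of the
  transition therefore sends \<open>fr a\<close> to the a-th basis vector and is given by the dual
  coframe. This carries the metric, defined through centred charts, over to any chart.\<close>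

lemma transition_to_center:
  assumes p: "p \<in> fst (gnomonic g)" and g: "g \<in> S3" and i: "i < 3" "a < 3"
  shows "partial_deriv i (\<lambda>x. snd (gnomonic p) (chart_inv (gnomonic g) x) a) (chart_map g p) = cofr a i (chart_map g p)"
proof -
  let ?y = "chart_map g p"
  define D where "D = (\<lambda>j. partial_deriv j (\<lambda>x. snd (gnomonic p) (chart_inv (gnomonic g) x) a) ?y)"
  have pS: "p \<in> S3" using p fst_gnomonic_subset by auto
  have "D i = (\<Sum>j<3. (if j = i then 1 else 0) * D j)" using i by (simp add: sum_delta_left)
  also have "\<dots> = (\<Sum>j<3. (\<Sum>b<3. fr b j ?y * cofr b i ?y) * D j)"
    using i by (intro sum.cong) (auto simp: fr_cofr)
  also have "\<dots> = (\<Sum>b<3. (\<Sum>j<3. D j * fr b j ?y) * cofr b i ?y)"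
    unfolding sum_distrib_right by (subst sum.swap) (simp add: mult_ac)
  also have "\<dots> = (\<Sum>b<3. (if b = a then 1 else 0) * cofr b i ?y)"
    using transition_fr[OF p self_in_gnomonic[OF pS] g pS _ i(2)] chart_map_self[OF pS]
    by (intro sum.cong) (auto simp: D_def fr_zero)
  finally show ?thesis using i by (simp add: sum_delta_left D_def)
qed

lemma metric_comp_berger:
  assumes g: "g \<in> S3" and y: "y \<in> R3" and ij: "i < 3" "j < 3"
  shows "metric_comp (berger \<mu>) (gnomonic g) i j y = (\<Sum>a<3. lam \<mu> a * cofr a i y * cofr a j y)"
proof -
  define p where "p = point g y"
  have p: "p \<in> S3" "p \<in> fst (gnomonic g)" "chart_map g p = y"
    using g y by (simp_all add: p_def point_in_S3 point_in_gnomonic chart_map_point)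
  have "coord_vec (berger \<mu>) (gnomonic g) i p (gnomonic p) a = cofr a i y" if "a < 3" "i < 3" for a i
    using transition_to_center[OF p(2) g that(2,1)] that p self_in_gnomonic[OF p(1)]
    by (auto simp: coord_vec_def charts_at_berger)
  then show ?thesis
    using ij y g by (simp add: metric_comp_def chart_inv_gnomonic p_def[symmetric])
qed

lemma local_frame_berger:
  assumes g: "g \<in> S3" and mu: "\<mu> > 0"
  shows "local_frame (berger \<mu>) (gnomonic g) R3 3 cofr fr (lam \<mu>) (om \<mu>)"
proof
  show "lam \<mu> b * om \<mu> a d b = - (lam \<mu> d * om \<mu> a b d)" if "a < 3" "b < 3" "d < 3" for a b d
    using that unfolding less_three
    by (elim disjE; simp add: lam_def om_def power2_eq_square algebra_simps)
qed (use g mu in \<open>auto simp: metric_comp_berger cofr_fr fr_cofr lam_def cofr_structure openin_R3 intro!: smooth_fr smooth_cofr\<close>)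

subsection \<open>Tangent vectors\<close>

text \<open>Tangent vectors are identified with their coefficient triples in the left-invariant
  frame; the geometry that follows is computed on these triples.\<close>

definition comb :: "real \<Rightarrow> (nat \<Rightarrow> real) \<Rightarrow> (nat \<Rightarrow> real) \<Rightarrow> (nat \<Rightarrow> real) tangent" where
  "comb \<mu> f p = (\<lambda>c k. if c \<in> charts_at (berger \<mu>) p \<and> k < 3 then \<Sum>a<3. f a * fr a k (snd c p) else 0)"

lemma comb_gnomonic: "g \<in> S3 \<Longrightarrow> p \<in> fst (gnomonic g) \<Longrightarrow> k < 3 \<Longrightarrow>
   comb \<mu> f p (gnomonic g) k = (\<Sum>a<3. f a * fr a k (chart_map g p))"
  by (auto simp: comb_def charts_at_berger)

lemma comb_center: "p \<in> S3 \<Longrightarrow> a < 3 \<Longrightarrow> comb \<mu> f p (gnomonic p) a = f a"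
  by (simp add: comb_gnomonic self_in_gnomonic chart_map_self fr_zero sum_delta_left mult.commute[of "f _"])

lemma comb_in_tangent_space: "comb \<mu> f p \<in> tangent_space (berger \<mu>) p"
  unfolding tangent_space_def
proof (intro CollectI conjI allI impI ballI)
  fix c k assume "\<not> (c \<in> charts_at (berger \<mu>) p \<and> k < mdim (berger \<mu>))"
  then show "comb \<mu> f p c k = 0" unfolding comb_def berger_simps by (rule if_not_P)
next
  fix c d k assume "c \<in> charts_at (berger \<mu>) p" "d \<in> charts_at (berger \<mu>) p" and k': "k < mdim (berger \<mu>)"
  then obtain g h where g: "g \<in> S3" "c = gnomonic g" "p \<in> fst (gnomonic g)" and h: "h \<in> S3" "d = gnomonic h" "p \<in> fst (gnomonic h)"
    by (auto simp: charts_at_berger)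
  have k: "k < 3" using k' by simp
  have "(\<Sum>i<3. partial_deriv i (\<lambda>x. snd d (chart_inv c x) k) (snd c p) * comb \<mu> f p c i)
    = (\<Sum>i<3. \<Sum>a<3. f a * (partial_deriv i (\<lambda>x. snd d (chart_inv c x) k) (snd c p) * fr a i (chart_map g p)))"
    using g by (intro sum.cong) (auto simp: comb_gnomonic sum_distrib_left mult_ac)
  also have "\<dots> = (\<Sum>a<3. f a * (\<Sum>i<3. partial_deriv i (\<lambda>x. snd d (chart_inv c x) k) (snd c p) * fr a i (chart_map g p)))"
    unfolding sum_distrib_left by (rule sum.swap)
  also have "\<dots> = (\<Sum>a<3. f a * fr a k (chart_map h p))"
    using transition_fr[OF g(3) h(3) g(1) h(1) _ k] g h by (intro sum.cong) auto
  finally show "comb \<mu> f p d k = (\<Sum>i<mdim (berger \<mu>). partial_deriv i (\<lambda>x. snd d (chart_inv c x) k) (snd c p) * comb \<mu> f p c i)"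
    using h k by (simp add: comb_gnomonic)
qed

text \<open>The coefficients are read off in the chart centred at \<open>p\<close>, where the frame
  is the standard basis; the transformation law determines all other components.\<close>

lemma tangent_space_comb:
  assumes p: "p \<in> S3" and v: "v \<in> tangent_space (berger \<mu>) p"
  shows "v = comb \<mu> (v (gnomonic p)) p"
proof (intro ext)
  fix c k
  show "v c k = comb \<mu> (v (gnomonic p)) p c k"
  proof (cases "c \<in> charts_at (berger \<mu>) p \<and> k < 3")
    case False
    then show ?thesis
      using v unfolding comb_def tangent_space_def berger_simps by (simp only: mem_Collect_eq if_False) blast
  next
    case True
    then obtain g where g: "g \<in> S3" "c = gnomonic g" "p \<in> fst (gnomonic g)" and k: "k < 3"
      by (auto simp: charts_at_berger)
    have cp: "gnomonic p \<in> charts_at (berger \<mu>) p"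
      using p self_in_gnomonic by (auto simp: charts_at_berger)
    have "v c k = (\<Sum>i<3. partial_deriv i (\<lambda>x. snd c (chart_inv (gnomonic p) x) k) (snd (gnomonic p) p) * v (gnomonic p) i)"
      using v True cp unfolding tangent_space_def by auto
    also have "\<dots> = (\<Sum>i<3. fr i k (chart_map g p) * v (gnomonic p) i)"
    proof (rule sum.cong[OF refl])
      fix i :: nat assume i: "i \<in> {..<3}"
      have "(\<Sum>j<3. partial_deriv j (\<lambda>x. snd c (chart_inv (gnomonic p) x) k) (chart_map p p) * fr i j (chart_map p p))
        = fr i k (chart_map g p)"
        using transition_fr[OF self_in_gnomonic[OF p] g(3) p g(1) _ k] i g by auto
      then have "partial_deriv i (\<lambda>x. snd c (chart_inv (gnomonic p) x) k) (snd (gnomonic p) p) = fr i k (chart_map g p)"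
        using i by (simp add: chart_map_self[OF p] fr_zero sum_delta_left mult.commute)
      then show "partial_deriv i (\<lambda>x. snd c (chart_inv (gnomonic p) x) k) (snd (gnomonic p) p) * v (gnomonic p) i
        = fr i k (chart_map g p) * v (gnomonic p) i" by simp
    qed
    finally show ?thesis using g k by (simp add: comb_gnomonic mult.commute)
  qed
qed

lemma riemannian_berger:
  assumes mu: "\<mu> > 0"
  shows "riemannian_manifold (berger \<mu>)"
  unfolding riemannian_manifold_def
proof (intro conjI ballI allI impI)
  show "smooth_manifold (berger \<mu>)" by (rule smooth_manifold_berger)
next
  fix p v w
  show "metric (berger \<mu>) p v w = metric (berger \<mu>) p w v" by (simp add: mult_ac)
next
  fix p u v w a b
  show "metric (berger \<mu>) p (lincomb a u b v) w = a * metric (berger \<mu>) p u w + b * metric (berger \<mu>) p v w"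
    by (simp add: lincomb_def sum_three algebra_simps)
next
  fix p v assume p: "p \<in> points (berger \<mu>)" and v: "v \<in> tangent_space (berger \<mu>) p" "v \<noteq> tangent_zero"
  have pS: "p \<in> S3" using p by simp
  have "\<exists>a<3. v (gnomonic p) a \<noteq> 0"
  proof (rule ccontr)
    assume "\<not> ?thesis"
    then have "comb \<mu> (v (gnomonic p)) p = tangent_zero"
      by (auto simp: comb_def tangent_zero_def fun_eq_iff)
    then show False using tangent_space_comb[OF pS v(1)] v(2) by simp
  qed
  then obtain a where a: "a < 3" "v (gnomonic p) a \<noteq> 0" by auto
  have lp: "lam \<mu> b > 0" for b using mu by (simp add: lam_def)
  have "0 < lam \<mu> a * v (gnomonic p) a * v (gnomonic p) a"
  proof -
    have "0 < (v (gnomonic p) a)\<^sup>2" using a by simp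
    from mult_pos_pos[OF lp[of a] this] show ?thesis by (simp only: power2_eq_square mult.assoc)
  qed
  also have "\<dots> \<le> (\<Sum>b<3. lam \<mu> b * v (gnomonic p) b * v (gnomonic p) b)"
    using a lp by (intro member_le_sum) (auto simp: mult.assoc less_imp_le)
  finally show "metric (berger \<mu>) p v v > 0" by simp
next
  fix c i j assume "c \<in> charts (berger \<mu>)" and ij: "i < mdim (berger \<mu>)" "j < mdim (berger \<mu>)"
  then obtain g where g: "g \<in> S3" "c = gnomonic g" by auto
  have "smooth_on 3 R3 (metric_comp (berger \<mu>) (gnomonic g) i j)"
    by (rule smooth_on_cong[OF openin_R3 metric_comp_berger[OF g(1)]])
      (use ij in \<open>auto intro!: smooth_on_sum[OF openin_R3] smooth_on_mult[OF openin_R3] smooth_on_const[OF openin_R3] smooth_cofr[OF openin_R3]\<close>)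
  then show "smooth_on (mdim (berger \<mu>)) (snd c ` fst c) (metric_comp (berger \<mu>) c i j)"
    using g by (simp add: chart_map_image)
qed

section \<open>Geodesics and Jacobi fields\<close>

subsection \<open>Smooth functions of one variable\<close>

abbreviation line :: "real set \<Rightarrow> (nat \<Rightarrow> real) set" where
  "line T \<equiv> {y. y 0 \<in> T \<and> (\<forall>i\<ge>1. y i = 0)}"

definition smooth1 :: "real set \<Rightarrow> (real \<Rightarrow> real) \<Rightarrow> bool" where
  "smooth1 T f \<longleftrightarrow> (\<forall>t\<in>T. \<forall>m. (deriv ^^ m) f field_differentiable at t)"

lemma openin_line: "open T \<Longrightarrow> openin (Euclidean_space 1) (line T)"
  unfolding openin_Euclidean_space_iff
proof (intro exI conjI)
  assume "open T"
  then show "open {y::nat\<Rightarrow>real. y 0 \<in> T}"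
    using open_vimage[of T "\<lambda>y::nat\<Rightarrow>real. y 0"] continuous_on_coord[of UNIV 0] by (simp add: vimage_def)
qed auto

text \<open>Functions of one variable are seen as functions of the coordinate 0 on a line, so that
  the closure rules for \<open>smooth_on\<close> carry over.\<close>

lemma smooth1_iff:
  assumes "open T"
  shows "smooth1 T f \<longleftrightarrow> smooth_on 1 (line T) (\<lambda>y. f (y 0))"
proof -
  have pd: "partial_deriv 0 (\<lambda>y. g (y 0)) = (\<lambda>y. deriv g (y 0))" for g
    by (simp add: partial_deriv_def fun_eq_iff)
  have fold: "foldr partial_deriv is (\<lambda>y. f (y 0)) = (\<lambda>y. (deriv ^^ length is) f (y 0))" if "set is \<subseteq> {..<1}" for "is"
    using that by (induction "is") (auto simp: pd)
  have has: "has_partial_deriv 0 (\<lambda>y. g (y 0)) y \<longleftrightarrow> g field_differentiable at (y 0)" for g y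
    by (simp add: has_partial_deriv_def)
  show ?thesis
  proof
    assume f: "smooth1 T f"
    show "smooth_on 1 (line T) (\<lambda>y. f (y 0))"
      unfolding smooth_on_def
    proof (intro allI impI conjI ballI)
      fix "is" :: "nat list" assume i: "set is \<subseteq> {..<1}"
      have "continuous_on T ((deriv ^^ length is) f)"
        using f unfolding smooth1_def
        by (intro continuous_at_imp_continuous_on ballI field_differentiable_imp_continuous_at) blast
      then show "continuous_on (line T) (foldr partial_deriv is (\<lambda>y. f (y 0)))"
        unfolding fold[OF i] by (rule continuous_on_compose2[OF _ continuous_on_coord]) auto
      fix j y assume "j < (1::nat)" "y \<in> line T"
      then show "has_partial_deriv j (foldr partial_deriv is (\<lambda>y. f (y 0))) y"
        using f unfolding fold[OF i] by (simp add: has smooth1_def)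
    qed
  next
    assume f: "smooth_on 1 (line T) (\<lambda>y. f (y 0))"
    show "smooth1 T f"
      unfolding smooth1_def
    proof (intro ballI allI)
      fix t m assume t: "t \<in> T"
      have m: "set (replicate m (0::nat)) \<subseteq> {..<1}" by auto
      have "\<forall>i<1. \<forall>x\<in>line T. has_partial_deriv i (foldr partial_deriv (replicate m 0) (\<lambda>y. f (y 0))) x"
        using f m unfolding smooth_on_def by blast
      then have "\<forall>x\<in>line T. has_partial_deriv 0 (\<lambda>y. (deriv ^^ m) f (y 0)) x"
        unfolding fold[OF m] by simp
      then have "has_partial_deriv 0 (\<lambda>y. (deriv ^^ m) f (y 0)) (\<lambda>n. if n = 0 then t else 0)"
        using t by auto
      then show "(deriv ^^ m) f field_differentiable at t"
        unfolding has by simp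
    qed
  qed
qed

lemma smooth1_DERIV: "smooth1 T f \<Longrightarrow> t \<in> T \<Longrightarrow> (f has_real_derivative deriv f t) (at t)"
  unfolding smooth1_def by (metis DERIV_deriv_iff_field_differentiable funpow_0)

lemma smooth1_deriv: "smooth1 T f \<Longrightarrow> smooth1 T (deriv f)"
  unfolding smooth1_def by (metis comp_apply funpow_Suc_right)

lemma smooth1_subset: "smooth1 T f \<Longrightarrow> S \<subseteq> T \<Longrightarrow> smooth1 S f"
  unfolding smooth1_def by blast

context
  fixes T :: "real set" assumes T: "open T"
begin

lemma smooth1_cong: "(\<And>t. t \<in> T \<Longrightarrow> f t = g t) \<Longrightarrow> smooth1 T g \<Longrightarrow> smooth1 T f"
  unfolding smooth1_iff[OF T] by (rule smooth_on_cong[OF openin_line[OF T]]) auto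

lemma smooth1_const: "smooth1 T (\<lambda>t. a)"
  unfolding smooth1_iff[OF T] by (rule smooth_on_const[OF openin_line[OF T]])

lemma smooth1_mult: "smooth1 T f \<Longrightarrow> smooth1 T g \<Longrightarrow> smooth1 T (\<lambda>t. f t * g t)"
  unfolding smooth1_iff[OF T] by (rule smooth_on_mult[OF openin_line[OF T]])

lemma smooth1_add: "smooth1 T f \<Longrightarrow> smooth1 T g \<Longrightarrow> smooth1 T (\<lambda>t. f t + g t)"
  unfolding smooth1_iff[OF T] by (rule smooth_on_add[OF openin_line[OF T]])

lemma smooth1_diff: "smooth1 T f \<Longrightarrow> smooth1 T g \<Longrightarrow> smooth1 T (\<lambda>t. f t - g t)"
  unfolding smooth1_iff[OF T] by (rule smooth_on_diff[OF openin_line[OF T]])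

lemma smooth1_uminus: "smooth1 T f \<Longrightarrow> smooth1 T (\<lambda>t. - f t)"
  unfolding smooth1_iff[OF T] by (rule smooth_on_uminus[OF openin_line[OF T]])

lemma smooth1_sum: "(\<And>a. a \<in> A \<Longrightarrow> smooth1 T (f a)) \<Longrightarrow> smooth1 T (\<lambda>t. \<Sum>a\<in>A. f a t)"
  unfolding smooth1_iff[OF T] by (rule smooth_on_sum[OF openin_line[OF T]])

lemma smooth1_cofr: "(\<And>i. smooth1 T (\<lambda>t. x t i)) \<Longrightarrow> smooth1 T (\<lambda>t. cofr a k (x t))"
  unfolding smooth1_iff[OF T] by (rule smooth_cofr_compose[OF openin_line[OF T]])

lemma smooth1_if: "smooth1 T f \<Longrightarrow> smooth1 T g \<Longrightarrow> smooth1 T (\<lambda>t. if P then f t else g t)"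
  by (cases P) simp_all

lemma smooth1_fr: "(\<And>i. smooth1 T (\<lambda>t. x t i)) \<Longrightarrow> smooth1 T (\<lambda>t. fr a k (x t))"
  unfolding fr_def cross_def
  by (intro smooth1_add smooth1_mult smooth1_if smooth1_const smooth1_uminus)

text \<open>Linear combinations of both functions form a class closed under \<open>deriv\<close>, so
  all iterated derivatives are explicit.\<close>

lemma smooth1_sin_cos: "smooth1 T (\<lambda>t. cos (w * t))" "smooth1 T (\<lambda>t. sin (w * t))"
proof -
  have D: "((\<lambda>t. a * cos (w * t) + b * sin (w * t)) has_real_derivative (b * w) * cos (w * s) + (- a * w) * sin (w * s)) (at s)" for a b s
    by (auto intro!: derivative_eq_intros simp: algebra_simps)
  have "\<exists>a' b'. (deriv ^^ m) (\<lambda>t. a * cos (w * t) + b * sin (w * t)) = (\<lambda>t. a' * cos (w * t) + b' * sin (w * t))" for m a b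
  proof (induction m)
    case (Suc m)
    then obtain a' b' where "(deriv ^^ m) (\<lambda>t. a * cos (w * t) + b * sin (w * t)) = (\<lambda>t. a' * cos (w * t) + b' * sin (w * t))" by blast
    then have "(deriv ^^ Suc m) (\<lambda>t. a * cos (w * t) + b * sin (w * t)) = deriv (\<lambda>t. a' * cos (w * t) + b' * sin (w * t))"
      by (simp only: funpow.simps o_apply)
    also have "\<dots> = (\<lambda>t. (b' * w) * cos (w * t) + (- a' * w) * sin (w * t))"
      by (rule ext) (rule DERIV_imp_deriv[OF D])
    finally have "(deriv ^^ Suc m) (\<lambda>t. a * cos (w * t) + b * sin (w * t)) = (\<lambda>t. (b' * w) * cos (w * t) + (- a' * w) * sin (w * t))" .
    then show ?case by blast
  qed auto
  then have *: "smooth1 T (\<lambda>t. a * cos (w * t) + b * sin (w * t))" for a b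
    unfolding smooth1_def field_differentiable_def using D by metis
  show "smooth1 T (\<lambda>t. cos (w * t))" "smooth1 T (\<lambda>t. sin (w * t))"
    using *[of 1 0] *[of 0 1] by simp_all
qed

end

lemma cofr_comb:
  assumes "g \<in> S3" "p \<in> fst (gnomonic g)" "a < 3"
  shows "(\<Sum>i<3. cofr a i (chart_map g p) * comb \<mu> f p (gnomonic g) i) = f a"
proof -
  have "(\<Sum>i<3. cofr a i (chart_map g p) * comb \<mu> f p (gnomonic g) i)
    = (\<Sum>i<3. \<Sum>b<3. f b * (cofr a i (chart_map g p) * fr b i (chart_map g p)))"
    using assms by (intro sum.cong) (auto simp: comb_gnomonic sum_distrib_left mult_ac)
  also have "\<dots> = (\<Sum>b<3. f b * (\<Sum>i<3. cofr a i (chart_map g p) * fr b i (chart_map g p)))"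
    unfolding sum_distrib_left by (rule sum.swap)
  also have "\<dots> = (\<Sum>b<3. (if a = b then 1 else 0) * f b)"
    using assms by (intro sum.cong) (auto simp: cofr_fr)
  finally show ?thesis using assms by (simp add: sum_delta_left)
qed

subsection \<open>Curves and fields along them\<close>

text \<open>The frame coefficients of the velocity: at each time they are its components in the
  chart centred at the current point.\<close>

definition vel :: "real \<Rightarrow> (real \<Rightarrow> nat \<Rightarrow> real) \<Rightarrow> real \<Rightarrow> nat \<Rightarrow> real" where
  "vel \<mu> \<gamma> t = velocity (berger \<mu>) \<gamma> t (gnomonic (\<gamma> t))"

context
  fixes \<mu> I \<gamma> assumes sc: "smooth_curve (berger \<mu>) I \<gamma>" and mu: "\<mu> > 0"
begin

lemma curve_in: "t \<in> I \<Longrightarrow> \<gamma> t \<in> S3"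
  using sc by (auto simp: smooth_curve_def)

lemma open_I: "open I"
  using sc by (auto simp: smooth_curve_def)

lemma open_curve_chart: "open {t \<in> I. \<gamma> t \<in> fst (gnomonic g)}"
proof -
  have "continuous_on I \<gamma>" "\<gamma> ` I \<subseteq> S3" using sc by (auto simp: smooth_curve_def)
  then have "openin (top_of_set I) (I \<inter> \<gamma> -` fst (gnomonic g))"
    using openin_gnomonic by (meson continuous_openin_preimage image_subset_iff_funcset)
  then show ?thesis
    using open_I by (simp add: openin_open_eq Int_def vimage_def)
qed

lemma smooth1_coord:
  assumes "g \<in> S3"
  shows "smooth1 {t \<in> I. \<gamma> t \<in> fst (gnomonic g)} (\<lambda>s. chart_map g (\<gamma> s) k)"
proof (cases "k < 3")
  case True
  have "gnomonic g \<in> charts_at (berger \<mu>) (\<gamma> t)" if "\<gamma> t \<in> fst (gnomonic g)" for t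
    using assms that by (auto simp: charts_at_berger)
  then show ?thesis
    using sc True unfolding smooth_curve_def smooth1_def by fastforce
next
  case False
  then have "(\<lambda>s. chart_map g (\<gamma> s) k) = (\<lambda>s. 0)" by (simp add: chart_map_def)
  then show ?thesis by (simp add: smooth1_const[OF open_curve_chart])
qed

lemma has_derivative_coord:
  assumes "g \<in> S3" "t \<in> I" "\<gamma> t \<in> fst (gnomonic g)" "k < 3"
  shows "((\<lambda>s. chart_map g (\<gamma> s) k) has_real_derivative velocity (berger \<mu>) \<gamma> t (gnomonic g) k) (at t)"
proof -
  have "velocity (berger \<mu>) \<gamma> t (gnomonic g) k = deriv (\<lambda>s. chart_map g (\<gamma> s) k) t"
    using assms by (auto simp: velocity_def charts_at_berger)
  then show ?thesis using smooth1_DERIV[OF smooth1_coord[OF assms(1)]] assms by simp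
qed

lemma velocity_in_tangent_space:
  assumes t: "t \<in> I"
  shows "velocity (berger \<mu>) \<gamma> t \<in> tangent_space (berger \<mu>) (\<gamma> t)"
  unfolding tangent_space_def
proof (intro CollectI conjI allI impI ballI)
  fix c k assume "\<not> (c \<in> charts_at (berger \<mu>) (\<gamma> t) \<and> k < mdim (berger \<mu>))"
  then show "velocity (berger \<mu>) \<gamma> t c k = 0" unfolding velocity_def by (rule if_not_P)
next
  fix c d k assume "c \<in> charts_at (berger \<mu>) (\<gamma> t)" "d \<in> charts_at (berger \<mu>) (\<gamma> t)" and k': "k < mdim (berger \<mu>)"
  then obtain g h where g: "g \<in> S3" "c = gnomonic g" "\<gamma> t \<in> fst (gnomonic g)"
    and h: "h \<in> S3" "d = gnomonic h" "\<gamma> t \<in> fst (gnomonic h)"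
    by (auto simp: charts_at_berger)
  have k: "k < 3" using k' by simp
  let ?q = "qmul (qconj h) g" and ?y = "chart_map g (\<gamma> t)"
  let ?U = "R3 \<inter> {y. qmul ?q (lift y) 0 > 0}"
  have pt: "point g (chart_map g (\<gamma> s)) = \<gamma> s" if "\<gamma> s \<in> fst (gnomonic g)" for s
    by (rule point_chart_map[OF g(1) that])
  have yU: "?y \<in> ?U"
    using point_in_gnomonic_iff[OF g(1), of ?y h] h(3) pt[OF g(3)] chart_map_R3[of g "\<gamma> t"] by auto
  have "((\<lambda>s. trans_map ?q (chart_map g (\<gamma> s)) k) has_real_derivative
      (\<Sum>i<3. partial_deriv i (\<lambda>x. trans_map ?q x k) ?y * velocity (berger \<mu>) \<gamma> t (gnomonic g) i)) (at t)"
    by (rule has_derivative_along_curve[OF openin_overlap trans_map_smooth[OF openin_overlap _ k]])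
      (use yU has_derivative_coord[OF g(1) t g(3)] in \<open>auto simp: chart_map_def\<close>)
  then have "((\<lambda>s. chart_map h (\<gamma> s) k) has_real_derivative
      (\<Sum>i<3. partial_deriv i (\<lambda>x. trans_map ?q x k) ?y * velocity (berger \<mu>) \<gamma> t (gnomonic g) i)) (at t)"
  proof (rule DERIV_cong_ev[OF refl _ refl, THEN iffD1, rotated])
    have "eventually (\<lambda>s. s \<in> {t \<in> I. \<gamma> t \<in> fst (gnomonic g)}) (nhds t)"
      using open_curve_chart t g(3) by (intro eventually_nhds_in_open) auto
    then show "eventually (\<lambda>s. trans_map ?q (chart_map g (\<gamma> s)) k = chart_map h (\<gamma> s) k) (nhds t)"
      by (rule eventually_mono) (simp add: chart_map_point_trans[symmetric] pt)
  qed
  from DERIV_unique[OF this has_derivative_coord[OF h(1) t h(3) k]]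
  show "velocity (berger \<mu>) \<gamma> t d k = (\<Sum>i<mdim (berger \<mu>). partial_deriv i (\<lambda>x. snd d (chart_inv c x) k) (snd c (\<gamma> t)) * velocity (berger \<mu>) \<gamma> t c i)"
    using g h partial_deriv_transition[OF g(1) chart_map_R3[of g "\<gamma> t"]] by simp
qed

lemma velocity_comb: "t \<in> I \<Longrightarrow> velocity (berger \<mu>) \<gamma> t = comb \<mu> (vel \<mu> \<gamma> t) (\<gamma> t)"
  unfolding vel_def by (rule tangent_space_comb[OF curve_in velocity_in_tangent_space])

text \<open>The chart in the definition of \<open>vel\<close> moves with the curve. Over a fixed
  chart the coframe recovers the same coefficients from the coordinate derivatives, which are
  smooth; smoothness is local.\<close>

lemma smooth1_vel:
  assumes a: "a < 3"
  shows "smooth1 I (\<lambda>s. vel \<mu> \<gamma> s a)"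
proof -
  have "smooth1 {t \<in> I. \<gamma> t \<in> fst (gnomonic g)} (\<lambda>s. vel \<mu> \<gamma> s a)" if g: "g \<in> S3" for g
  proof (rule smooth1_cong[OF open_curve_chart])
    show "vel \<mu> \<gamma> s a = (\<Sum>i<3. cofr a i (chart_map g (\<gamma> s)) * deriv (\<lambda>s. chart_map g (\<gamma> s) i) s)"
      if s: "s \<in> {t \<in> I. \<gamma> t \<in> fst (gnomonic g)}" for s
    proof -
      have "(\<Sum>i<3. cofr a i (chart_map g (\<gamma> s)) * deriv (\<lambda>s. chart_map g (\<gamma> s) i) s)
        = (\<Sum>i<3. cofr a i (chart_map g (\<gamma> s)) * velocity (berger \<mu>) \<gamma> s (gnomonic g) i)"
        using has_derivative_coord[OF g] s by (intro sum.cong refl) (auto dest!: DERIV_imp_deriv)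
      also have "\<dots> = vel \<mu> \<gamma> s a"
        using s cofr_comb[OF g _ a] by (simp add: velocity_comb)
      finally show ?thesis by simp
    qed
    show "smooth1 {t \<in> I. \<gamma> t \<in> fst (gnomonic g)} (\<lambda>s. \<Sum>i<3. cofr a i (chart_map g (\<gamma> s)) * deriv (\<lambda>s. chart_map g (\<gamma> s) i) s)"
      by (intro smooth1_sum smooth1_mult smooth1_cofr smooth1_deriv smooth1_coord open_curve_chart g)
  qed
  then show ?thesis
    unfolding smooth1_def using curve_in self_in_gnomonic by blast
qed

lemma smooth_field_comb:
  assumes f: "\<And>a. a < 3 \<Longrightarrow> smooth1 I (\<lambda>s. f s a)"
  shows "smooth_field_along (berger \<mu>) I \<gamma> (\<lambda>s. comb \<mu> (f s) (\<gamma> s))"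
  unfolding smooth_field_along_def
proof (intro ballI conjI allI impI)
  fix t assume t: "t \<in> I"
  show "comb \<mu> (f t) (\<gamma> t) \<in> tangent_space (berger \<mu>) (\<gamma> t)" by (rule comb_in_tangent_space)
  fix c k m assume "c \<in> charts_at (berger \<mu>) (\<gamma> t)" and k': "k < mdim (berger \<mu>)"
  then obtain g where g: "g \<in> S3" "c = gnomonic g" "\<gamma> t \<in> fst (gnomonic g)" and k: "k < 3"
    by (auto simp: charts_at_berger)
  have "smooth1 {t \<in> I. \<gamma> t \<in> fst (gnomonic g)} (\<lambda>s. comb \<mu> (f s) (\<gamma> s) c k)"
  proof (rule smooth1_cong[OF open_curve_chart])
    show "comb \<mu> (f s) (\<gamma> s) c k = (\<Sum>a<3. f s a * fr a k (chart_map g (\<gamma> s)))"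
      if "s \<in> {t \<in> I. \<gamma> t \<in> fst (gnomonic g)}" for s
      using that g k by (simp add: comb_gnomonic)
    show "smooth1 {t \<in> I. \<gamma> t \<in> fst (gnomonic g)} (\<lambda>s. \<Sum>a<3. f s a * fr a k (chart_map g (\<gamma> s)))"
      using smooth1_subset[OF f]
      by (intro smooth1_sum smooth1_mult smooth1_fr smooth1_coord open_curve_chart g) auto
  qed
  then show "(deriv ^^ m) (\<lambda>s. comb \<mu> (f s) (\<gamma> s) c k) field_differentiable at t"
    using t g(3) by (simp add: smooth1_def)
qed

text \<open>The representation of \<open>V\<close> is required on \<open>I\<close> only, so that the
  lemma can be applied again to a covariant derivative; \<open>I\<close> being open, this determines
  the derivative.\<close>

lemma cov_deriv_comb:
  assumes t: "t \<in> I" and V: "\<And>s. s \<in> I \<Longrightarrow> V s = comb \<mu> (f s) (\<gamma> s)"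
    and f: "\<And>a. a < 3 \<Longrightarrow> ((\<lambda>s. f s a) has_real_derivative f' a) (at t)"
  shows "cov_deriv (berger \<mu>) \<gamma> V t
    = comb \<mu> (\<lambda>b. f' b + (\<Sum>a<3. \<Sum>d<3. om \<mu> a d b * vel \<mu> \<gamma> t a * f t d)) (\<gamma> t)"
proof (intro ext)
  fix c k
  show "cov_deriv (berger \<mu>) \<gamma> V t c k
    = comb \<mu> (\<lambda>b. f' b + (\<Sum>a<3. \<Sum>d<3. om \<mu> a d b * vel \<mu> \<gamma> t a * f t d)) (\<gamma> t) c k"
  proof (cases "c \<in> charts_at (berger \<mu>) (\<gamma> t) \<and> k < 3")
    case False
    then show ?thesis unfolding cov_deriv_def comb_def berger_simps by (simp only: if_False)
  next
    case True
    then obtain g where g: "g \<in> S3" "c = gnomonic g" "\<gamma> t \<in> fst (gnomonic g)" and k: "k < 3"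
      by (auto simp: charts_at_berger)
    interpret local_frame "berger \<mu>" "gnomonic g" R3 3 cofr fr "lam \<mu>" "om \<mu>"
      by (rule local_frame_berger[OF g(1) mu])
    define y where "y = chart_map g (\<gamma> t)"
    have y: "y \<in> R3" unfolding y_def by (rule chart_map_R3)
    define \<xi> where "\<xi> = velocity (berger \<mu>) \<gamma> t (gnomonic g)"
    have "((\<lambda>s. fr a k (chart_map g (\<gamma> s))) has_real_derivative (\<Sum>i<3. partial_deriv i (fr a k) y * \<xi> i)) (at t)" for a
      unfolding y_def \<xi>_def
      by (rule has_derivative_along_curve[OF openin_R3 smooth_fr[OF openin_R3]])
        (use has_derivative_coord[OF g(1) t g(3)] in \<open>auto simp: chart_map_def\<close>)
    then have "((\<lambda>s. \<Sum>a<3. f s a * fr a k (chart_map g (\<gamma> s))) has_real_derivative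
        (\<Sum>a<3. f' a * fr a k y + (\<Sum>i<3. partial_deriv i (fr a k) y * \<xi> i) * f t a)) (at t)"
      unfolding y_def by (intro DERIV_sum DERIV_mult f) auto
    moreover have "eventually (\<lambda>s. s \<in> {t \<in> I. \<gamma> t \<in> fst (gnomonic g)}) (nhds t)"
      using open_curve_chart t g(3) by (intro eventually_nhds_in_open) auto
    then have "eventually (\<lambda>s. V s c k = (\<Sum>a<3. f s a * fr a k (chart_map g (\<gamma> s)))) (nhds t)"
      by (rule eventually_mono) (use g k V in \<open>auto simp: comb_gnomonic\<close>)
    ultimately have 1: "deriv (\<lambda>s. V s c k) t
      = (\<Sum>a<3. f' a * fr a k y) + (\<Sum>a<3. f t a * (\<Sum>i<3. partial_deriv i (fr a k) y * \<xi> i))"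
      by (simp add: deriv_cong_ev[OF _ refl] DERIV_imp_deriv sum.distrib mult.commute)
    have 2: "V t c j = (\<Sum>a<3. f t a * fr a j y)" if "j < 3" for j
      using V[OF t] g that by (simp add: comb_gnomonic y_def)
    have 3: "(\<Sum>i<3. cofr a i y * \<xi> i) = vel \<mu> \<gamma> t a" if "a < 3" for a
      unfolding \<xi>_def y_def velocity_comb[OF t] by (rule cofr_comb[OF g(1,3) that])
    have "cov_deriv (berger \<mu>) \<gamma> V t c k = (\<Sum>a<3. f' a * fr a k y) + ((\<Sum>a<3. f t a * (\<Sum>i<3. partial_deriv i (fr a k) y * \<xi> i))
        + (\<Sum>i<3. \<Sum>j<3. christoffel (berger \<mu>) c k i j y * \<xi> i * (\<Sum>a<3. f t a * fr a j y)))"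
      using True g by (simp add: cov_deriv_def 1[unfolded g(2)] 2[unfolded g(2)] y_def[symmetric] \<xi>_def[symmetric])
    also have "\<dots> = (\<Sum>b<3. (f' b + (\<Sum>a<3. \<Sum>d<3. om \<mu> a d b * vel \<mu> \<gamma> t a * f t d)) * fr b k y)"
      unfolding g(2) cov_deriv_frame[OF k y] by (simp add: 3 distrib_right sum.distrib)
    finally show ?thesis using g k by (simp add: comb_gnomonic y_def)
  qed
qed

end

subsection \<open>Curvature\<close>

text \<open>R(u,v)w in the frame, where \<open>A\<close>, \<open>B\<close>, \<open>C\<close> are the
  coordinates of the bivector of \<open>u\<close> and \<open>v\<close>. The curvature operator is
  diagonal on the coordinate planes. Each factor is the curvature of the plane times the weight of
  the contracted direction: \<open>4 - 3 * \<mu>\<close> is \<open>\<mu> * (4 / \<mu> - 3)\<close>,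
  while \<open>\<mu>\<^sup>2\<close> and \<mu> belong to curvature 1.\<close>

definition curv_op :: "real \<Rightarrow> (nat \<Rightarrow> real) \<Rightarrow> (nat \<Rightarrow> real) \<Rightarrow> (nat \<Rightarrow> real) \<Rightarrow> nat \<Rightarrow> real" where
  "curv_op \<mu> u v w f =
    (let A = u 0 * v 1 - u 1 * v 0; B = u 0 * v 2 - u 2 * v 0; C = u 1 * v 2 - u 2 * v 1
     in if f = 0 then (4 - 3 * \<mu>) * A * w 1 + \<mu>\<^sup>2 * B * w 2
        else if f = 1 then - (4 - 3 * \<mu>) * A * w 0 + \<mu>\<^sup>2 * C * w 2
        else - \<mu> * (B * w 0 + C * w 1))"

lemma curvature_comb:
  assumes p: "p \<in> S3" and mu: "\<mu> > 0"
  shows "curvature (berger \<mu>) p (comb \<mu> u p) (comb \<mu> v p) (comb \<mu> w p) = comb \<mu> (curv_op \<mu> u v w) p"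
proof (intro ext)
  fix c l
  show "curvature (berger \<mu>) p (comb \<mu> u p) (comb \<mu> v p) (comb \<mu> w p) c l = comb \<mu> (curv_op \<mu> u v w) p c l"
  proof (cases "c \<in> charts_at (berger \<mu>) p \<and> l < 3")
    case False
    then show ?thesis unfolding curvature_def comb_def berger_simps by (simp only: if_False)
  next
    case True
    then obtain g where g: "g \<in> S3" "c = gnomonic g" "p \<in> fst (gnomonic g)" and l: "l < 3"
      by (auto simp: charts_at_berger)
    interpret local_frame "berger \<mu>" "gnomonic g" R3 3 cofr fr "lam \<mu>" "om \<mu>"
      by (rule local_frame_berger[OF g(1) mu])
    define y where "y = chart_map g p"
    have y: "y \<in> R3" unfolding y_def by (rule chart_map_R3)
    have c: "(\<Sum>i<3. cofr a i y * comb \<mu> h p (gnomonic g) i) = h a" if "a < 3" for a h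
      unfolding y_def by (rule cofr_comb[OF g(1,3) that])
    have R: "(\<Sum>e<3. (\<Sum>b<3. \<Sum>d<3. Rc b d e f * u b * v d) * w e) = curv_op \<mu> u v w f" if "f < 3" for f
      using that unfolding less_three
      by (elim disjE; simp add: Rc_def sum_three om_def curv_op_def Let_def power2_eq_square algebra_simps)
    have "curvature (berger \<mu>) p (comb \<mu> u p) (comb \<mu> v p) (comb \<mu> w p) c l
      = (\<Sum>i<3. \<Sum>j<3. \<Sum>k<3. curv_comp (berger \<mu>) (gnomonic g) i j k l y
          * comb \<mu> u p (gnomonic g) i * comb \<mu> v p (gnomonic g) j * comb \<mu> w p (gnomonic g) k)"
      using True g by (simp add: curvature_def y_def)
    also have "\<dots> = (\<Sum>f<3. curv_op \<mu> u v w f * fr f l y)"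
      unfolding curvature_frame[OF l y] by (simp add: c R)
    finally show ?thesis using g l by (simp add: comb_gnomonic y_def)
  qed
qed

subsection \<open>Sectional curvature and Jacobi fields\<close>

lemma comb_cong: "(\<And>a. a < 3 \<Longrightarrow> f a = g a) \<Longrightarrow> comb \<mu> f p = comb \<mu> g p"
  by (simp add: comb_def fun_eq_iff)

lemma lincomb_comb: "lincomb a (comb \<mu> f p) b (comb \<mu> g p) = comb \<mu> (\<lambda>k. a * f k + b * g k) p"
  by (auto simp: comb_def lincomb_def fun_eq_iff sum_three algebra_simps)

lemma comb_eq_zero_iff: "p \<in> S3 \<Longrightarrow> comb \<mu> f p = tangent_zero \<longleftrightarrow> (\<forall>a<3. f a = 0)"
proof
  assume "p \<in> S3" "comb \<mu> f p = tangent_zero"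
  then show "\<forall>a<3. f a = 0" by (metis comb_center tangent_zero_def)
next
  assume "\<forall>a<3. f a = 0"
  then show "comb \<mu> f p = tangent_zero" by (auto simp: comb_def tangent_zero_def fun_eq_iff)
qed

lemma metric_comb: "p \<in> S3 \<Longrightarrow> metric (berger \<mu>) p (comb \<mu> f p) (comb \<mu> g p) = (\<Sum>a<3. lam \<mu> a * f a * g a)"
  by (simp add: comb_center)

lemma lin_indep_comb:
  assumes p: "p \<in> S3"
  shows "lin_indep (comb \<mu> v p) (comb \<mu> w p)
    \<longleftrightarrow> \<not> (v 0 * w 1 = v 1 * w 0 \<and> v 0 * w 2 = v 2 * w 0 \<and> v 1 * w 2 = v 2 * w 1)"
    (is "?L \<longleftrightarrow> \<not> ?R")
proof -
  have L: "?L \<longleftrightarrow> (\<forall>a b. (a * v 0 + b * w 0 = 0 \<and> a * v 1 + b * w 1 = 0 \<and> a * v 2 + b * w 2 = 0) \<longrightarrow> a = 0 \<and> b = 0)"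
    unfolding lin_indep_def lincomb_comb comb_eq_zero_iff[OF p] less_three by (simp add: all_conj_distrib)
  show ?thesis
  proof
    assume ?L
    show "\<not> ?R"
    proof
      assume R: ?R
      \<comment> \<open>If all minors vanish, the coefficients \<open>w k\<close> and
        \<open>- v k\<close> give a linear relation, so independence forces both to be 0 for every
        \<open>k\<close>; but then even \<open>v\<close> alone is dependent.\<close>
      then have *: "w k = 0 \<and> v k = 0" if "k < 3" for k
      proof -
        have e: "w k * v j + (- v k) * w j = 0" if "j < 3" for j
          using R that \<open>k < 3\<close> unfolding less_three by (elim disjE) (simp_all add: mult.commute)
        show ?thesis using \<open>?L\<close>[unfolded L, rule_format, of "w k" "- v k"] e[of 0] e[of 1] e[of 2] by simp
      qed
      show False
        using \<open>?L\<close>[unfolded L, rule_format, of 1 0] *[of 0] *[of 1] *[of 2] by simp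
    qed
  next
    assume nR: "\<not> ?R"
    show ?L
      unfolding L
    proof (intro allI impI)
      fix a b assume ab: "a * v 0 + b * w 0 = 0 \<and> a * v 1 + b * w 1 = 0 \<and> a * v 2 + b * w 2 = 0"
      have "a * (v i * w j - v j * w i) = (a * v i + b * w i) * w j - (a * v j + b * w j) * w i"
        "b * (v i * w j - v j * w i) = (a * v j + b * w j) * v i - (a * v i + b * w i) * v j" for i j
        by (simp_all add: algebra_simps)
      then have "a * (v i * w j - v j * w i) = 0" "b * (v i * w j - v j * w i) = 0" if "i < 3" "j < 3" for i j
        using ab that unfolding less_three by auto
      then have "(a = 0 \<and> b = 0) \<or> v i * w j = v j * w i" if "i < 3" "j < 3" for i j
        using that by (metis mult_eq_0_iff right_minus_eq)
      from this[of 0 1] this[of 0 2] this[of 1 2] show "a = 0 \<and> b = 0" using nR by auto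
    qed
  qed
qed

text \<open>Numerator and denominator depend on the minors only and differ by
  \<open>4 * \<mu> * (1 - \<mu>)\<close> times the square of the horizontal minor. The sign of this
  difference decides both curvature bounds.\<close>

lemma sec_comb:
  assumes p: "p \<in> S3" and mu: "\<mu> > 0"
  shows "sec (berger \<mu>) p (comb \<mu> v p) (comb \<mu> w p)
    = (\<mu> * (4 - 3 * \<mu>) * (v 0 * w 1 - v 1 * w 0)\<^sup>2
        + \<mu> ^ 3 * ((v 0 * w 2 - v 2 * w 0)\<^sup>2 + (v 1 * w 2 - v 2 * w 1)\<^sup>2))
      / (\<mu>\<^sup>2 * (v 0 * w 1 - v 1 * w 0)\<^sup>2
        + \<mu> ^ 3 * ((v 0 * w 2 - v 2 * w 0)\<^sup>2 + (v 1 * w 2 - v 2 * w 1)\<^sup>2))"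
proof -
  have 1: "metric (berger \<mu>) p (curvature (berger \<mu>) p (comb \<mu> v p) (comb \<mu> w p) (comb \<mu> w p)) (comb \<mu> v p)
    = \<mu> * (4 - 3 * \<mu>) * (v 0 * w 1 - v 1 * w 0)\<^sup>2
        + \<mu> ^ 3 * ((v 0 * w 2 - v 2 * w 0)\<^sup>2 + (v 1 * w 2 - v 2 * w 1)\<^sup>2)"
    unfolding curvature_comb[OF p mu] metric_comb[OF p]
    by (simp add: sum_three lam_def curv_op_def Let_def power2_eq_square power3_eq_cube algebra_simps)
  have 2: "metric (berger \<mu>) p (comb \<mu> v p) (comb \<mu> v p) * metric (berger \<mu>) p (comb \<mu> w p) (comb \<mu> w p)
      - (metric (berger \<mu>) p (comb \<mu> v p) (comb \<mu> w p))\<^sup>2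
    = \<mu>\<^sup>2 * (v 0 * w 1 - v 1 * w 0)\<^sup>2
        + \<mu> ^ 3 * ((v 0 * w 2 - v 2 * w 0)\<^sup>2 + (v 1 * w 2 - v 2 * w 1)\<^sup>2)"
    unfolding metric_comb[OF p]
    by (simp add: sum_three lam_def power2_eq_square power3_eq_cube algebra_simps)
  show ?thesis unfolding sec_def 1 2 ..
qed

lemma sec_denominator_pos:
  fixes A B C :: real
  assumes "\<mu> > 0" "\<not> (A = 0 \<and> B = 0 \<and> C = 0)"
  shows "\<mu>\<^sup>2 * A\<^sup>2 + \<mu> ^ 3 * (B\<^sup>2 + C\<^sup>2) > 0"
proof -
  have "A\<^sup>2 > 0 \<or> B\<^sup>2 + C\<^sup>2 > 0" using assms(2) by (auto simp: sum_power2_gt_zero_iff)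
  moreover have "\<mu>\<^sup>2 > 0" "\<mu> ^ 3 > 0" using assms(1) by auto
  moreover have "A\<^sup>2 \<ge> 0" "B\<^sup>2 + C\<^sup>2 \<ge> 0" by auto
  ultimately show ?thesis
    by (metis add_nonneg_pos add_pos_nonneg less_imp_le mult_nonneg_nonneg mult_pos_pos)
qed

lemma sec_bounds:
  assumes mu: "\<mu> > 0"
  shows "\<mu> \<ge> 1 \<Longrightarrow> sec_le (berger \<mu>) 1" "\<mu> \<le> 1 \<Longrightarrow> sec_ge (berger \<mu>) 1"
proof -
  have *: "(\<mu> \<ge> 1 \<longrightarrow> sec (berger \<mu>) p v w \<le> 1) \<and> (\<mu> \<le> 1 \<longrightarrow> sec (berger \<mu>) p v w \<ge> 1)"
    if p: "p \<in> S3" and v: "v \<in> tangent_space (berger \<mu>) p" "w \<in> tangent_space (berger \<mu>) p" and li: "lin_indep v w"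
    for p v w
  proof -
    define x y where "x = v (gnomonic p)" and "y = w (gnomonic p)"
    have vw: "v = comb \<mu> x p" "w = comb \<mu> y p"
      unfolding x_def y_def by (rule tangent_space_comb[OF p v(1)], rule tangent_space_comb[OF p v(2)])
    define A B C where "A = x 0 * y 1 - x 1 * y 0" "B = x 0 * y 2 - x 2 * y 0" "C = x 1 * y 2 - x 2 * y 1"
    have pos: "\<mu>\<^sup>2 * A\<^sup>2 + \<mu> ^ 3 * (B\<^sup>2 + C\<^sup>2) > 0"
      using li unfolding vw lin_indep_comb[OF p] by (intro sec_denominator_pos[OF mu]) (auto simp: A_B_C_def)
    have "\<mu> * (4 - 3 * \<mu>) * A\<^sup>2 - \<mu>\<^sup>2 * A\<^sup>2 = 4 * (\<mu> * A\<^sup>2) * (1 - \<mu>)"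
      by (simp add: power2_eq_square algebra_simps)
    moreover have "\<mu> * A\<^sup>2 \<ge> 0" using mu by simp
    ultimately have "(\<mu> \<ge> 1 \<longrightarrow> \<mu> * (4 - 3 * \<mu>) * A\<^sup>2 - \<mu>\<^sup>2 * A\<^sup>2 \<le> 0) \<and> (\<mu> \<le> 1 \<longrightarrow> \<mu> * (4 - 3 * \<mu>) * A\<^sup>2 - \<mu>\<^sup>2 * A\<^sup>2 \<ge> 0)"
      by (simp add: mult_nonneg_nonpos)
    then show ?thesis
      unfolding vw sec_comb[OF p mu] A_B_C_def[symmetric] using pos by (simp add: divide_le_eq le_divide_eq)
  qed
  show "\<mu> \<ge> 1 \<Longrightarrow> sec_le (berger \<mu>) 1" "\<mu> \<le> 1 \<Longrightarrow> sec_ge (berger \<mu>) 1"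
    using * by (auto simp: sec_le_def sec_ge_def)
qed

text \<open>The vanishing minor says that the horizontal parts are dependent, hence that the plane
  contains \<xi>.\<close>

lemma sec_eq_one:
  assumes p: "p \<in> S3" and mu: "\<mu> > 0" and "v 0 * w 1 = v 1 * w 0"
    and "lin_indep (comb \<mu> v p) (comb \<mu> w p)"
  shows "sec (berger \<mu>) p (comb \<mu> v p) (comb \<mu> w p) = 1"
proof -
  have "\<not> (v 0 * w 1 - v 1 * w 0 = 0 \<and> v 0 * w 2 - v 2 * w 0 = 0 \<and> v 1 * w 2 - v 2 * w 1 = 0)"
    using assms(4) unfolding lin_indep_comb[OF p] by auto
  note pos = sec_denominator_pos[OF mu this]
  have z: "v 0 * w 1 - v 1 * w 0 = 0" using assms(3) by simp
  show ?thesis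
    using pos unfolding sec_comb[OF p mu] z
    by (simp only: power_zero_numeral mult_zero_right add_0) (rule divide_self, linarith)
qed

section \<open>The geodesic equation and the Jacobi fields\<close>

context
  fixes \<mu> I \<gamma> assumes geo: "unit_geodesic (berger \<mu>) I \<gamma>" and mu: "\<mu> > 0"
begin

lemma geodesic_smooth_curve: "smooth_curve (berger \<mu>) I \<gamma>"
  using geo by (simp add: unit_geodesic_def)

text \<open>The geodesic equation in the frame: the horizontal part of the velocity rotates, the
  vertical part is constant.\<close>

lemma vel_DERIV:
  assumes t: "t \<in> I"
  shows "((\<lambda>s. vel \<mu> \<gamma> s 0) has_real_derivative - 2 * (\<mu> - 1) * vel \<mu> \<gamma> t 1 * vel \<mu> \<gamma> t 2) (at t)"
    "((\<lambda>s. vel \<mu> \<gamma> s 1) has_real_derivative 2 * (\<mu> - 1) * vel \<mu> \<gamma> t 0 * vel \<mu> \<gamma> t 2) (at t)"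
    "((\<lambda>s. vel \<mu> \<gamma> s 2) has_real_derivative 0) (at t)"
proof -
  have D: "((\<lambda>s. vel \<mu> \<gamma> s a) has_real_derivative deriv (\<lambda>s. vel \<mu> \<gamma> s a) t) (at t)" if "a < 3" for a
    by (rule smooth1_DERIV[OF smooth1_vel[OF geodesic_smooth_curve mu that] t])
  have "comb \<mu> (\<lambda>b. deriv (\<lambda>s. vel \<mu> \<gamma> s b) t + (\<Sum>a<3. \<Sum>d<3. om \<mu> a d b * vel \<mu> \<gamma> t a * vel \<mu> \<gamma> t d)) (\<gamma> t) = tangent_zero"
    using cov_deriv_comb[OF geodesic_smooth_curve mu t velocity_comb[OF geodesic_smooth_curve mu] D] geo t by (simp add: unit_geodesic_def)
  then have "deriv (\<lambda>s. vel \<mu> \<gamma> s b) t = - (\<Sum>a<3. \<Sum>d<3. om \<mu> a d b * vel \<mu> \<gamma> t a * vel \<mu> \<gamma> t d)" if "b < 3" for b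
    using that unfolding comb_eq_zero_iff[OF curve_in[OF geodesic_smooth_curve mu t]] by (simp add: eq_neg_iff_add_eq_0)
  from this[of 0] this[of 1] this[of 2] have "deriv (\<lambda>s. vel \<mu> \<gamma> s 0) t = - 2 * (\<mu> - 1) * vel \<mu> \<gamma> t 1 * vel \<mu> \<gamma> t 2"
    "deriv (\<lambda>s. vel \<mu> \<gamma> s 1) t = 2 * (\<mu> - 1) * vel \<mu> \<gamma> t 0 * vel \<mu> \<gamma> t 2"
    "deriv (\<lambda>s. vel \<mu> \<gamma> s 2) t = 0"
    by (simp_all add: sum_three om_def algebra_simps)
  then show "((\<lambda>s. vel \<mu> \<gamma> s 0) has_real_derivative - 2 * (\<mu> - 1) * vel \<mu> \<gamma> t 1 * vel \<mu> \<gamma> t 2) (at t)"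
    "((\<lambda>s. vel \<mu> \<gamma> s 1) has_real_derivative 2 * (\<mu> - 1) * vel \<mu> \<gamma> t 0 * vel \<mu> \<gamma> t 2) (at t)"
    "((\<lambda>s. vel \<mu> \<gamma> s 2) has_real_derivative 0) (at t)"
    using D[of 0] D[of 1] D[of 2] by simp_all
qed

lemma vel_norm:
  assumes t: "t \<in> I"
  shows "\<mu> * ((vel \<mu> \<gamma> t 0)\<^sup>2 + (vel \<mu> \<gamma> t 1)\<^sup>2) + (\<mu> * vel \<mu> \<gamma> t 2)\<^sup>2 = 1"
proof -
  have "metric (berger \<mu>) (\<gamma> t) (velocity (berger \<mu>) \<gamma> t) (velocity (berger \<mu>) \<gamma> t) = 1"
    using geo t unfolding unit_geodesic_def by blast
  then show ?thesis
    unfolding velocity_comb[OF geodesic_smooth_curve mu t] metric_comb[OF curve_in[OF geodesic_smooth_curve mu t]]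
    by (simp add: sum_three lam_def power2_eq_square algebra_simps)
qed

text \<open>The Jacobi equation as a first-order system for coefficients: \<open>f\<close> belongs
  to the field, \<open>g\<close> to its covariant derivative, and \<open>f'\<close>,
  \<open>g'\<close> are the ordinary derivatives.\<close>

lemma jacobi_fieldI:
  assumes f: "\<And>a. a < 3 \<Longrightarrow> smooth1 I (\<lambda>s. f s a)"
    and d1: "\<And>t a. t \<in> I \<Longrightarrow> a < 3 \<Longrightarrow> ((\<lambda>s. f s a) has_real_derivative f' t a) (at t)"
    and g: "\<And>t b. t \<in> I \<Longrightarrow> b < 3 \<Longrightarrow> f' t b + (\<Sum>a<3. \<Sum>d<3. om \<mu> a d b * vel \<mu> \<gamma> t a * f t d) = g t b"
    and d2: "\<And>t a. t \<in> I \<Longrightarrow> a < 3 \<Longrightarrow> ((\<lambda>s. g s a) has_real_derivative g' t a) (at t)"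
    and eq: "\<And>t b. t \<in> I \<Longrightarrow> b < 3 \<Longrightarrow> g' t b + (\<Sum>a<3. \<Sum>d<3. om \<mu> a d b * vel \<mu> \<gamma> t a * g t d)
        + curv_op \<mu> (f t) (vel \<mu> \<gamma> t) (vel \<mu> \<gamma> t) b = 0"
  shows "jacobi_field (berger \<mu>) I \<gamma> (\<lambda>s. comb \<mu> (f s) (\<gamma> s))"
  unfolding jacobi_field_def
proof (intro conjI ballI)
  show "smooth_field_along (berger \<mu>) I \<gamma> (\<lambda>s. comb \<mu> (f s) (\<gamma> s))"
    by (rule smooth_field_comb[OF geodesic_smooth_curve mu f])
  fix t assume t: "t \<in> I"
  have p: "\<gamma> t \<in> S3" by (rule curve_in[OF geodesic_smooth_curve mu t])
  have DJ: "cov_deriv (berger \<mu>) \<gamma> (\<lambda>s. comb \<mu> (f s) (\<gamma> s)) s = comb \<mu> (g s) (\<gamma> s)" if s: "s \<in> I" for s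
  proof -
    have "cov_deriv (berger \<mu>) \<gamma> (\<lambda>s. comb \<mu> (f s) (\<gamma> s)) s
      = comb \<mu> (\<lambda>b. f' s b + (\<Sum>a<3. \<Sum>d<3. om \<mu> a d b * vel \<mu> \<gamma> s a * f s d)) (\<gamma> s)"
      by (rule cov_deriv_comb[OF geodesic_smooth_curve mu s refl d1[OF s]])
    also have "\<dots> = comb \<mu> (g s) (\<gamma> s)" by (rule comb_cong) (rule g[OF s])
    finally show ?thesis .
  qed
  have "cov_deriv (berger \<mu>) \<gamma> (cov_deriv (berger \<mu>) \<gamma> (\<lambda>s. comb \<mu> (f s) (\<gamma> s))) t
    = comb \<mu> (\<lambda>b. g' t b + (\<Sum>a<3. \<Sum>d<3. om \<mu> a d b * vel \<mu> \<gamma> t a * g t d)) (\<gamma> t)"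
    by (rule cov_deriv_comb[OF geodesic_smooth_curve mu t DJ d2[OF t]])
  then show "lincomb 1 (cov_deriv (berger \<mu>) \<gamma> (cov_deriv (berger \<mu>) \<gamma> (\<lambda>s. comb \<mu> (f s) (\<gamma> s))) t)
    1 (curvature (berger \<mu>) (\<gamma> t) (comb \<mu> (f t) (\<gamma> t)) (velocity (berger \<mu>) \<gamma> t) (velocity (berger \<mu>) \<gamma> t)) = tangent_zero"
    unfolding velocity_comb[OF geodesic_smooth_curve mu t] curvature_comb[OF p mu]
    using eq[OF t] by (simp add: lincomb_comb comb_eq_zero_iff[OF p])
qed

text \<open>The conservation law belonging to the Killing field \<xi>; connectedness of the interval
  \<open>I\<close> makes the constant global.\<close>

lemma vel_2_const: "\<exists>w. \<forall>t\<in>I. vel \<mu> \<gamma> t 2 = w"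
proof -
  have "convex I" using geodesic_smooth_curve by (auto simp: smooth_curve_def is_interval_convex)
  then have "\<exists>w. \<forall>t\<in>I. vel \<mu> \<gamma> t 2 = w"
    using vel_DERIV(3) by (intro has_field_derivative_zero_constant) (auto intro: has_field_derivative_at_within)
  then show ?thesis .
qed

text \<open>The third frame field \<open>\<xi>\<close> is a Killing field, so its component orthogonal to \<open>\<gamma>'\<close> is a Jacobi field. All
  planes containing \<open>\<xi>\<close> have curvature 1.\<close>

lemma jacobi_generic:
  assumes w: "\<And>t. t \<in> I \<Longrightarrow> vel \<mu> \<gamma> t 2 = w" and nw: "(\<mu> * w)\<^sup>2 \<noteq> 1"
  shows "\<exists>J. normal_jacobi_field (berger \<mu>) I \<gamma> J \<and>
    (\<forall>t\<in>I. lin_indep (velocity (berger \<mu>) \<gamma> t) (J t) \<and> sec (berger \<mu>) (\<gamma> t) (velocity (berger \<mu>) \<gamma> t) (J t) = 1)"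
proof -
  let ?u = "vel \<mu> \<gamma>"
  \<comment> \<open>The inner product of \<xi> with the velocity, constant along the geodesic. Hence
    \<open>f\<close> below is \<xi> minus its tangential part.\<close>
  define k where "k = \<mu>\<^sup>2 * w"
  define f where "f = (\<lambda>s a. (if a = (2::nat) then 1 else 0) - k * ?u s a)"
  define u' where "u' = (\<lambda>t a. if a = 0 then - 2 * (\<mu> - 1) * ?u t 1 * w else if a = (1::nat) then 2 * (\<mu> - 1) * ?u t 0 * w else 0)"
  define f' where "f' = (\<lambda>t a. - k * u' t a)"
  \<comment> \<open>The covariant derivative of \<xi> along the curve; the tangential part of the
    field is parallel and contributes nothing.\<close>
  define g where "g = (\<lambda>t a. if a = 0 then \<mu> * ?u t 1 else if a = (1::nat) then - \<mu> * ?u t 0 else 0)"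
  define g' where "g' = (\<lambda>t a. if a = 0 then \<mu> * u' t 1 else if a = (1::nat) then - \<mu> * u' t 0 else 0)"
  have norm: "\<mu> * ((?u t 0)\<^sup>2 + (?u t 1)\<^sup>2) + (\<mu> * w)\<^sup>2 = 1" if "t \<in> I" for t
    using vel_norm[OF that] w[OF that] by simp
  have jac: "jacobi_field (berger \<mu>) I \<gamma> (\<lambda>s. comb \<mu> (f s) (\<gamma> s))"
  proof (rule jacobi_fieldI[where f' = f' and g = g and g' = g'])
    show "smooth1 I (\<lambda>s. f s a)" if "a < 3" for a
      unfolding f_def
      by (intro smooth1_diff smooth1_mult smooth1_const smooth1_vel[OF geodesic_smooth_curve mu that] open_I[OF geodesic_smooth_curve mu])
    fix t assume t: "t \<in> I"
    have D: "((\<lambda>s. ?u s a) has_real_derivative u' t a) (at t)" if "a < 3" for a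
      using that vel_DERIV[OF t] w[OF t] unfolding less_three by (elim disjE) (simp_all add: u'_def)
    show "((\<lambda>s. f s a) has_real_derivative f' t a) (at t)" if "a < 3" for a
      unfolding f_def f'_def by (rule derivative_eq_intros D that refl)+ simp
    show "((\<lambda>s. g s a) has_real_derivative g' t a) (at t)" if "a < 3" for a
      using that unfolding less_three
      by (elim disjE) (auto simp: g_def g'_def intro!: derivative_eq_intros D)
    show "f' t b + (\<Sum>a<3. \<Sum>d<3. om \<mu> a d b * ?u t a * f t d) = g t b" if "b < 3" for b
      using that w[OF t] unfolding less_three
      by (elim disjE) (simp_all add: f_def f'_def u'_def g_def om_def sum_three algebra_simps)
    show "g' t b + (\<Sum>a<3. \<Sum>d<3. om \<mu> a d b * ?u t a * g t d) + curv_op \<mu> (f t) (?u t) (?u t) b = 0" if "b < 3" for b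
      using that w[OF t] unfolding less_three
      by (elim disjE) (simp_all add: f_def g'_def u'_def g_def om_def sum_three curv_op_def Let_def k_def power2_eq_square algebra_simps)
  qed
  show ?thesis
  proof (intro exI[of _ "\<lambda>s. comb \<mu> (f s) (\<gamma> s)"] conjI ballI)
    show "normal_jacobi_field (berger \<mu>) I \<gamma> (\<lambda>s. comb \<mu> (f s) (\<gamma> s))"
      unfolding normal_jacobi_field_def
    proof (intro conjI ballI jac)
      fix t assume t: "t \<in> I"
      \<comment> \<open>The inner product is \<open>k\<close> times (1 minus the squared speed), and
        the speed is 1.\<close>
      have "(\<Sum>a<3. lam \<mu> a * f t a * ?u t a) = k - k * (\<mu> * ((?u t 0)\<^sup>2 + (?u t 1)\<^sup>2) + (\<mu> * w)\<^sup>2)"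
        using w[OF t] by (simp add: f_def lam_def sum_three k_def power2_eq_square algebra_simps)
      then show "metric (berger \<mu>) (\<gamma> t) (comb \<mu> (f t) (\<gamma> t)) (velocity (berger \<mu>) \<gamma> t) = 0"
        unfolding velocity_comb[OF geodesic_smooth_curve mu t] metric_comb[OF curve_in[OF geodesic_smooth_curve mu t]] norm[OF t] by simp
    qed
  next
    fix t assume t: "t \<in> I"
    have p: "\<gamma> t \<in> S3" by (rule curve_in[OF geodesic_smooth_curve mu t])
    have "?u t 0 \<noteq> 0 \<or> ?u t 1 \<noteq> 0" using norm[OF t] nw by auto
    \<comment> \<open>Subtracting a multiple of the velocity does not change the minors, so they are
      those with \<xi>. The case assumption \<open>nw\<close> makes the horizontal velocity
      nonzero.\<close>
    moreover have "?u t 0 * f t 2 - ?u t 2 * f t 0 = ?u t 0" "?u t 1 * f t 2 - ?u t 2 * f t 1 = ?u t 1"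
      by (simp_all add: f_def algebra_simps)
    ultimately show li: "lin_indep (velocity (berger \<mu>) \<gamma> t) (comb \<mu> (f t) (\<gamma> t))"
      unfolding velocity_comb[OF geodesic_smooth_curve mu t] lin_indep_comb[OF p] by auto
    show "sec (berger \<mu>) (\<gamma> t) (velocity (berger \<mu>) \<gamma> t) (comb \<mu> (f t) (\<gamma> t)) = 1"
      using li unfolding velocity_comb[OF geodesic_smooth_curve mu t]
      by (intro sec_eq_one[OF p mu]) (simp_all add: f_def)
  qed
qed

text \<open>Along an integral curve of \<open>\<xi>\<close>, a field that commutes with \<open>\<xi>\<close> is used instead.\<close>

lemma jacobi_fibre:
  assumes w: "\<And>t. t \<in> I \<Longrightarrow> vel \<mu> \<gamma> t 2 = w" and w1: "(\<mu> * w)\<^sup>2 = 1"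
  shows "\<exists>J. normal_jacobi_field (berger \<mu>) I \<gamma> J \<and>
    (\<forall>t\<in>I. lin_indep (velocity (berger \<mu>) \<gamma> t) (J t) \<and> sec (berger \<mu>) (\<gamma> t) (velocity (berger \<mu>) \<gamma> t) (J t) = 1)"
proof -
  let ?u = "vel \<mu> \<gamma>"
  \<comment> \<open>The vertical component already exhausts the unit length.\<close>
  have u0: "?u t 0 = 0" "?u t 1 = 0" if "t \<in> I" for t
    using vel_norm[OF that] w[OF that] w1 mu by (auto simp: sum_power2_eq_zero_iff)
  \<comment> \<open>The curve is x exp(t w k), and conjugation by exp(t w k) rotates the plane of i
    and j by the angle \<open>2 * w * t\<close>. So \<open>f\<close> lists the left-frame
    coefficients of a right-invariant field.\<close>
  define v where "v = 2 * w"
  define f where "f = (\<lambda>s a. if a = 0 then cos (v * s) else if a = (1::nat) then - sin (v * s) else 0)"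
  define f' where "f' = (\<lambda>s a. if a = 0 then - v * sin (v * s) else if a = (1::nat) then - v * cos (v * s) else 0)"
  define g where "g = (\<lambda>s a. if a = 0 then - \<mu> * w * sin (v * s) else if a = (1::nat) then - \<mu> * w * cos (v * s) else 0)"
  define g' where "g' = (\<lambda>s a. if a = 0 then - \<mu> * w * v * cos (v * s) else if a = (1::nat) then \<mu> * w * v * sin (v * s) else 0)"
  have jac: "jacobi_field (berger \<mu>) I \<gamma> (\<lambda>s. comb \<mu> (f s) (\<gamma> s))"
  proof (rule jacobi_fieldI[where f' = f' and g = g and g' = g'])
    show "smooth1 I (\<lambda>s. f s a)" if "a < 3" for a
      unfolding f_def
      by (intro smooth1_if smooth1_uminus smooth1_const smooth1_sin_cos open_I[OF geodesic_smooth_curve mu])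
    fix t assume t: "t \<in> I"
    show "((\<lambda>s. f s a) has_real_derivative f' t a) (at t)" if "a < 3" for a
      using that unfolding less_three
      by (elim disjE) (auto simp: f_def f'_def intro!: derivative_eq_intros)
    show "((\<lambda>s. g s a) has_real_derivative g' t a) (at t)" if "a < 3" for a
      using that unfolding less_three
      by (elim disjE) (auto simp: g_def g'_def intro!: derivative_eq_intros)
    show "f' t b + (\<Sum>a<3. \<Sum>d<3. om \<mu> a d b * ?u t a * f t d) = g t b" if "b < 3" for b
      using that w[OF t] u0[OF t] unfolding less_three
      by (elim disjE) (simp_all add: f_def f'_def g_def om_def sum_three v_def algebra_simps)
    show "g' t b + (\<Sum>a<3. \<Sum>d<3. om \<mu> a d b * ?u t a * g t d) + curv_op \<mu> (f t) (?u t) (?u t) b = 0" if "b < 3" for b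
      using that w[OF t] u0[OF t] unfolding less_three
      by (elim disjE) (simp_all add: f_def g'_def g_def om_def sum_three curv_op_def Let_def v_def power2_eq_square algebra_simps)
  qed
  show ?thesis
  proof (intro exI[of _ "\<lambda>s. comb \<mu> (f s) (\<gamma> s)"] conjI ballI)
    show "normal_jacobi_field (berger \<mu>) I \<gamma> (\<lambda>s. comb \<mu> (f s) (\<gamma> s))"
      unfolding normal_jacobi_field_def
    proof (intro conjI ballI jac)
      fix t assume t: "t \<in> I"
      show "metric (berger \<mu>) (\<gamma> t) (comb \<mu> (f t) (\<gamma> t)) (velocity (berger \<mu>) \<gamma> t) = 0"
        unfolding velocity_comb[OF geodesic_smooth_curve mu t] metric_comb[OF curve_in[OF geodesic_smooth_curve mu t]]
        using u0[OF t] by (simp add: sum_three f_def)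
    qed
  next
    fix t assume t: "t \<in> I"
    have p: "\<gamma> t \<in> S3" by (rule curve_in[OF geodesic_smooth_curve mu t])
    have "cos (v * t) \<noteq> 0 \<or> sin (v * t) \<noteq> 0" by (metis sin_zero_abs_cos_one abs_one zero_neq_one abs_zero)
    moreover have "w \<noteq> 0" using w1 by auto
    ultimately show li: "lin_indep (velocity (berger \<mu>) \<gamma> t) (comb \<mu> (f t) (\<gamma> t))"
      unfolding velocity_comb[OF geodesic_smooth_curve mu t] lin_indep_comb[OF p] using u0[OF t] w[OF t] by (auto simp: f_def)
    show "sec (berger \<mu>) (\<gamma> t) (velocity (berger \<mu>) \<gamma> t) (comb \<mu> (f t) (\<gamma> t)) = 1"
      using li u0[OF t] unfolding velocity_comb[OF geodesic_smooth_curve mu t]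
      by (intro sec_eq_one[OF p mu]) simp_all
  qed
qed

lemma jacobi_exists:
  "\<exists>J. normal_jacobi_field (berger \<mu>) I \<gamma> J \<and>
    (\<forall>t\<in>I. lin_indep (velocity (berger \<mu>) \<gamma> t) (J t) \<and> sec (berger \<mu>) (\<gamma> t) (velocity (berger \<mu>) \<gamma> t) (J t) = 1)"
  using vel_2_const jacobi_generic jacobi_fibre by metis

end

section \<open>Topology and isometries\<close>

subsection \<open>Topology of the sphere\<close>

text \<open>Transfers compactness and simple connectedness from the unit sphere of a
  four-dimensional Euclidean space type.\<close>

lemma homeomorphic_S3: "sphere (0 :: real \<times> real \<times> real \<times> real) 1 homeomorphic S3"
proof -
  let ?f = "\<lambda>(a, b, c, d) n. if n = 0 then a else if n = 1 then b else if n = 2 then c else if n = (3::nat) then d else (0::real)"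
  let ?g = "\<lambda>p::nat \<Rightarrow> real. (p 0, p 1, p 2, p 3)"
  have n: "norm (a, b, c, d) = 1 \<longleftrightarrow> a\<^sup>2 + b\<^sup>2 + c\<^sup>2 + d\<^sup>2 = 1" for a b c d :: real
    by (simp add: norm_Pair add.assoc)
  have "homeomorphism (sphere (0 :: real \<times> real \<times> real \<times> real) 1) S3 ?f ?g"
  proof (rule homeomorphismI)
    show "continuous_on (sphere 0 1) ?f"
    proof (rule continuous_on_coordinatewise_then_product)
      show "continuous_on (sphere 0 1) (\<lambda>x. ?f x i)" for i
        by (cases "i = 0"; cases "i = 1"; cases "i = 2"; cases "i = 3")
          (auto simp: case_prod_unfold intro!: continuous_intros)
    qed
    show "continuous_on S3 ?g" by (intro continuous_intros)
    show "?f ` sphere 0 1 \<subseteq> S3" by (auto simp: n S3_def)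
    show "?g ` S3 \<subseteq> sphere 0 1" by (auto simp: n S3_def)
    show "?f (?g p) = p" if "p \<in> S3" for p
    proof
      fix i :: nat
      consider "i = 0" | "i = 1" | "i = 2" | "i = 3" | "4 \<le> i" by linarith
      then show "?f (?g p) i = p i" using that by cases (auto simp: S3_def)
    qed
  qed auto
  then show ?thesis unfolding homeomorphic_def by blast
qed

lemma compact_S3: "compact S3"
  using homeomorphic_compactness[OF homeomorphic_S3] by simp

lemma simply_connected_S3: "simply_connected S3"
  using homeomorphic_simply_connected[OF homeomorphic_S3] simply_connected_sphere[of "0 :: real \<times> real \<times> real \<times> real" 1] by simp

subsection \<open>Differentials of self-maps\<close>

lemma Euclidean_space_3: "Euclidean_space 3 = top_of_set R3"
  by (simp add: Euclidean_space_def euclidean_product_topology)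

context
  fixes \<mu> f assumes f: "smooth_self_map (berger \<mu>) f"
begin

lemma self_map_in: "p \<in> S3 \<Longrightarrow> f p \<in> S3"
  using f by (auto simp: smooth_self_map_def)

lemma self_map_domain:
  assumes "g \<in> S3"
  shows "chart_map g ` (fst (gnomonic g) \<inter> f -` fst (gnomonic h)) = R3 \<inter> {y. f (point g y) \<in> fst (gnomonic h)}"
proof (intro equalityI subsetI)
  fix y assume "y \<in> R3 \<inter> {y. f (point g y) \<in> fst (gnomonic h)}"
  then show "y \<in> chart_map g ` (fst (gnomonic g) \<inter> f -` fst (gnomonic h))"
    using assms by (intro image_eqI[where x = "point g y"]) (auto simp: chart_map_point point_in_gnomonic)
qed (use assms in \<open>auto simp: point_chart_map chart_map_def\<close>)

lemma openin_self_map_domain: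
  assumes "g \<in> S3"
  shows "openin (Euclidean_space 3) (R3 \<inter> {y. f (point g y) \<in> fst (gnomonic h)})"
proof -
  have "continuous_on S3 f" "f ` S3 \<subseteq> S3" using f by (auto simp: smooth_self_map_def)
  then have "continuous_on R3 (\<lambda>y. f (point g y))"
    using point_in_S3[OF assms] by (intro continuous_on_compose2[OF _ continuous_on_point]) auto
  moreover have "(\<lambda>y. f (point g y)) \<in> R3 \<rightarrow> S3"
    using self_map_in point_in_S3[OF assms] by auto
  ultimately have "openin (top_of_set R3) (R3 \<inter> (\<lambda>y. f (point g y)) -` fst (gnomonic h))"
    using openin_gnomonic by (rule continuous_openin_preimage)
  then show ?thesis unfolding Euclidean_space_3 vimage_def .
qed

lemma self_map_smooth:
  assumes g: "g \<in> S3" and h: "h \<in> S3"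
  shows "smooth_on 3 (R3 \<inter> {y. f (point g y) \<in> fst (gnomonic h)}) (\<lambda>y. chart_map h (f (point g y)) k)"
proof (cases "k < 3")
  case True
  have "smooth_on 3 (chart_map g ` (fst (gnomonic g) \<inter> f -` fst (gnomonic h))) (\<lambda>x. chart_map h (f (chart_inv (gnomonic g) x)) k)"
    using f g h True unfolding smooth_self_map_def berger_simps by (metis imageI snd_gnomonic)
  then show ?thesis
    unfolding self_map_domain[OF g]
    by (rule smooth_on_cong[OF openin_self_map_domain[OF g], rotated]) (use g in \<open>auto simp: chart_inv_gnomonic\<close>)
next
  case False
  then show ?thesis by (simp add: chart_map_def smooth_on_const[OF openin_self_map_domain[OF g]])
qed

text \<open>The chart inside \<open>differential\<close> is an arbitrary choice; by the chain rule
  and the transformation law of \<open>v\<close>, any gnomonic chart around \<open>q\<close> gives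
  the same result.\<close>

lemma differential_berger:
  assumes g: "g \<in> S3" "q \<in> fst (gnomonic g)" and d: "d \<in> S3" "f q \<in> fst (gnomonic d)" and k: "k < 3"
    and v: "v \<in> tangent_space (berger \<mu>) q"
  shows "differential (berger \<mu>) f q v (gnomonic d) k
    = (\<Sum>j<3. partial_deriv j (\<lambda>y. chart_map d (f (point g y)) k) (chart_map g q) * v (gnomonic g) j)"
proof -
  let ?G = "\<lambda>y. chart_map d (f (point g y)) k" and ?y = "chart_map g q"
  have cg: "gnomonic g \<in> charts_at (berger \<mu>) q" using g by (auto simp: charts_at_berger)
  define c where "c = (SOME c. c \<in> charts_at (berger \<mu>) q)"
  have cc: "c \<in> charts_at (berger \<mu>) q" unfolding c_def by (rule someI[of "\<lambda>c. c \<in> charts_at (berger \<mu>) q", OF cg])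
  then obtain h where h: "h \<in> S3" "c = gnomonic h" "q \<in> fst (gnomonic h)" by (auto simp: charts_at_berger)
  let ?x = "chart_map h q" and ?t = "qmul (qconj g) h"
  have q: "point h ?x = q" "point g ?y = q" using point_chart_map g h by auto
  let ?U = "R3 \<inter> {y. qmul ?t (lift y) 0 > 0}"
  have xU: "?x \<in> ?U"
    using point_in_gnomonic_iff[OF h(1), of ?x g] g(2) q chart_map_R3[of h q] by auto
  have T: "trans_map ?t ?x = ?y" using chart_map_point_trans[of g h ?x] q by simp
  have chain: "partial_deriv i (\<lambda>x. chart_map d (f (chart_inv c x)) k) ?x
    = (\<Sum>j<3. partial_deriv j ?G ?y * partial_deriv i (\<lambda>x. trans_map ?t x j) ?x)" if i: "i < 3" for i
  proof -
    have "((\<lambda>s. ?G (trans_map ?t (?x(i := s)))) has_real_derivative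
      (\<Sum>j<3. partial_deriv j ?G (trans_map ?t (?x(i := ?x i))) * partial_deriv i (\<lambda>x. trans_map ?t x j) ?x)) (at (?x i))"
    proof (rule has_derivative_along_curve[OF openin_self_map_domain[OF g(1)] self_map_smooth[OF g(1) d(1)]])
      show "trans_map ?t (?x(i := ?x i)) \<in> R3 \<inter> {y. f (point g y) \<in> fst (gnomonic d)}"
        using d q chart_map_R3[of g q] by (simp add: T)
      show "trans_map ?t (?x(i := s)) j = 0" if "3 \<le> j" for s j using that by (simp add: trans_map_def)
      show "((\<lambda>s. trans_map ?t (?x(i := s)) j) has_real_derivative partial_deriv i (\<lambda>x. trans_map ?t x j) ?x) (at (?x i))"
        if "j < 3" for j
        using smooth_on_imp_has_partial_deriv[OF trans_map_smooth[OF openin_overlap _ that] i xU]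
        by (auto simp: has_partial_deriv_iff)
    qed
    from partial_derivI(1)[of "\<lambda>x. ?G (trans_map ?t x)", OF this]
    have "partial_deriv i (\<lambda>x. ?G (trans_map ?t x)) ?x
      = (\<Sum>j<3. partial_deriv j ?G ?y * partial_deriv i (\<lambda>x. trans_map ?t x j) ?x)" by (simp add: T)
    moreover have "partial_deriv i (\<lambda>x. chart_map d (f (chart_inv c x)) k) ?x = partial_deriv i (\<lambda>x. ?G (trans_map ?t x)) ?x"
    proof (rule partial_deriv_cong(1)[OF openin_overlap xU i])
      fix y assume y: "y \<in> ?U"
      then have "point h y \<in> fst (gnomonic g)" using point_in_gnomonic_iff[OF h(1), of y g] by simp
      then have "point g (trans_map ?t y) = point h y"
        using point_chart_map[OF g(1), of "point h y"] chart_map_point_trans[of g h y] by simp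
      then show "chart_map d (f (chart_inv c y)) k = ?G (trans_map ?t y)"
        using y h by (simp add: chart_inv_gnomonic)
    qed
    ultimately show ?thesis by simp
  qed
  have vj: "v (gnomonic g) j = (\<Sum>i<3. partial_deriv i (\<lambda>x. trans_map ?t x j) ?x * v c i)" if j: "j < 3" for j
  proof -
    have "v (gnomonic g) j = (\<Sum>i<3. partial_deriv i (\<lambda>x. snd (gnomonic g) (chart_inv c x) j) (snd c q) * v c i)"
    proof -
      have "\<forall>c\<in>charts_at (berger \<mu>) q. \<forall>d\<in>charts_at (berger \<mu>) q. \<forall>k<3.
          v d k = (\<Sum>i<3. partial_deriv i (\<lambda>x. snd d (chart_inv c x) k) (snd c q) * v c i)"
        using v unfolding tangent_space_def berger_simps by blast
      from this[rule_format, OF cc cg j] show ?thesis .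
    qed
    then show ?thesis using partial_deriv_transition[OF h(1) chart_map_R3, where h = g] h by simp
  qed
  have "differential (berger \<mu>) f q v (gnomonic d) k
    = (\<Sum>i<3. partial_deriv i (\<lambda>x. chart_map d (f (chart_inv c x)) k) ?x * v c i)"
    using d k h unfolding differential_def c_def[symmetric] Let_def by (auto simp: charts_at_berger)
  also have "\<dots> = (\<Sum>i<3. \<Sum>j<3. partial_deriv j ?G ?y * (partial_deriv i (\<lambda>x. trans_map ?t x j) ?x * v c i))"
    by (simp add: chain sum_distrib_right sum_distrib_left mult_ac)
  also have "\<dots> = (\<Sum>j<3. partial_deriv j ?G ?y * (\<Sum>i<3. partial_deriv i (\<lambda>x. trans_map ?t x j) ?x * v c i))"
    unfolding sum_distrib_left by (rule sum.swap)
  finally show ?thesis by (simp add: vj)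
qed

end

subsection \<open>The pulled back frame\<close>

lemma left_inverse_imp_right_inverse_3:
  fixes A B :: "nat \<Rightarrow> nat \<Rightarrow> real"
  assumes "\<And>k l. k < 3 \<Longrightarrow> l < 3 \<Longrightarrow> (\<Sum>a<3. B k a * A a l) = (if k = l then 1 else 0)"
    and "a < 3" "b < 3"
  shows "(\<Sum>k<3. A a k * B k b) = (if a = b then 1 else 0)"
proof -
  \<comment> \<open>The index type \<open>3\<close> has the elements 1, 2 and 3 = 0; the last case
    of the conditional sends 3 to index 2.\<close>
  define ix :: "3 \<Rightarrow> nat" where "ix = (\<lambda>i. if i = 1 then 0 else if i = 2 then 1 else 2)"
  have ix: "ix 1 = 0" "ix 2 = 1" "ix 3 = 2" by (auto simp: ix_def)
  define A' B' :: "real^3^3" where "A' = (\<chi> i j. A (ix i) (ix j))" "B' = (\<chi> i j. B (ix i) (ix j))"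
  have "B' ** A' = mat 1"
    using assms(1) by (auto simp: A'_B'_def matrix_matrix_mult_def mat_def vec_eq_iff forall_3 sum_3 ix sum_three)
  then have "A' ** B' = mat 1" by (simp add: matrix_left_right_inverse)
  then show ?thesis
    using assms(2,3) unfolding less_three
    by (auto simp: A'_B'_def matrix_matrix_mult_def mat_def vec_eq_iff forall_3 sum_3 ix sum_three)
qed

text \<open>The trace over the first and last index is the Ricci tensor. Summing over
  \<open>i\<close> pairs \<open>th b\<close> with \<open>E f\<close>, so the trace can be taken in
  the frame.\<close>

lemma (in local_frame) ricci_frame:
  assumes jk: "j < n" "k < n" and y: "y \<in> U"
  shows "(\<Sum>i<n. curv_comp M c i j k i y) = (\<Sum>b<n. \<Sum>d<n. \<Sum>e<n. Rc b d e b * th d j y * th e k y)"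
proof -
  define H where "H = (\<lambda>b f. \<Sum>d<n. \<Sum>e<n. Rc b d e f * th d j y * th e k y)"
  have "curv_comp M c i j k i y = (\<Sum>f<n. \<Sum>b<n. H b f * (th b i y * E f i y))" if i: "i < n" for i
  proof -
    have "curv_comp M c i j k i y = (\<Sum>f<n. \<Sum>e<n. \<Sum>b<n. \<Sum>d<n. Rc b d e f * th b i y * th d j y * th e k y * E f i y)"
      using i jk y by (simp add: curv_comp_frame sum_distrib_left sum_distrib_right mult_ac)
    also have "\<dots> = (\<Sum>f<n. \<Sum>b<n. \<Sum>d<n. \<Sum>e<n. Rc b d e f * th b i y * th d j y * th e k y * E f i y)"
      by (intro sum.cong refl trans[OF sum_swap3[symmetric]] sum_swap3[symmetric])
    finally show ?thesis by (simp add: H_def sum_distrib_left sum_distrib_right mult_ac)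
  qed
  then have "(\<Sum>i<n. curv_comp M c i j k i y) = (\<Sum>i<n. \<Sum>f<n. \<Sum>b<n. H b f * (th b i y * E f i y))" by simp
  also have "\<dots> = (\<Sum>f<n. \<Sum>b<n. \<Sum>i<n. H b f * (th b i y * E f i y))"
    by (rule sum_swap3[symmetric])
  also have "\<dots> = (\<Sum>f<n. \<Sum>b<n. H b f * (if b = f then 1 else 0))"
    using y by (simp add: sum_distrib_left[symmetric] th_E)
  also have "\<dots> = (\<Sum>f<n. H f f)"
    by (simp add: if_distrib cong: if_cong)
  finally show ?thesis by (simp add: H_def)
qed

text \<open>The Ricci tensor is a linear combination of the metric and \<open>\<theta>\<^sub>3 \<otimes> \<theta>\<^sub>3\<close>; hence the latter does not depend
  on the frame.\<close>

lemma third_form_squared: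
  assumes fr: "local_frame (berger \<mu>) c U 3 th E (lam \<mu>) (om \<mu>)" and mu: "\<mu> > 0" and jk: "j < 3" "k < 3" and y: "y \<in> U"
  shows "4 * \<mu> * (\<mu> - 1) * (th 2 j y * th 2 k y)
    = (\<Sum>i<3. curv_comp (berger \<mu>) c i j k i y) - (4 - 2 * \<mu>) / \<mu> * metric_comp (berger \<mu>) c j k y"
proof -
  interpret local_frame "berger \<mu>" c U 3 th E "lam \<mu>" "om \<mu>" by (rule fr)
  \<comment> \<open>The Ricci tensor is diagonal: the entries are the eigenvalues 2 and
    \<open>4 / \<mu> - 2\<close> times the weights \<open>\<mu>\<^sup>2\<close> and \<mu>.
    Subtracting the second eigenvalue times the metric leaves the factor
    \<open>4 * \<mu> * (\<mu> - 1)\<close>.\<close>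
  have R: "(\<Sum>b<3. Rc b d e b) = (if d \<noteq> e then 0 else if d = 2 then 2 * \<mu>\<^sup>2 else 4 - 2 * \<mu>)" if "d < 3" "e < 3" for d e
    using that unfolding less_three
    by (elim disjE) (simp_all add: Rc_def sum_three om_def power2_eq_square algebra_simps)
  have "(\<Sum>i<3. curv_comp (berger \<mu>) c i j k i y) = (\<Sum>d<3. \<Sum>e<3. \<Sum>b<3. Rc b d e b * th d j y * th e k y)"
    unfolding ricci_frame[OF jk y] by (rule sum_swap3[symmetric])
  also have "\<dots> = (\<Sum>d<3. \<Sum>e<3. (\<Sum>b<3. Rc b d e b) * (th d j y * th e k y))"
    by (simp add: sum_distrib_right mult.assoc)
  also have "\<dots> = (4 - 2 * \<mu>) * (th 0 j y * th 0 k y + th 1 j y * th 1 k y) + 2 * \<mu>\<^sup>2 * (th 2 j y * th 2 k y)"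
  proof -
    have "(\<Sum>d<3. \<Sum>e<3. (\<Sum>b<3. Rc b d e b) * (th d j y * th e k y))
      = (\<Sum>d<3. \<Sum>e<3. (if d \<noteq> e then 0 else if d = 2 then 2 * \<mu>\<^sup>2 else 4 - 2 * \<mu>) * (th d j y * th e k y))"
      by (intro sum.cong refl) (simp only: R lessThan_iff)
    then show ?thesis by (simp add: sum_three algebra_simps)
  qed
  finally have ric: "(\<Sum>i<3. curv_comp (berger \<mu>) c i j k i y)
    = (4 - 2 * \<mu>) * (th 0 j y * th 0 k y + th 1 j y * th 1 k y) + 2 * \<mu>\<^sup>2 * (th 2 j y * th 2 k y)" .
  have "metric_comp (berger \<mu>) c j k y = \<mu> * (th 0 j y * th 0 k y + th 1 j y * th 1 k y + \<mu> * (th 2 j y * th 2 k y))"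
    unfolding metric_frame[OF jk y] by (simp add: sum_three lam_def power2_eq_square algebra_simps)
  then have "(4 - 2 * \<mu>) / \<mu> * metric_comp (berger \<mu>) c j k y
    = (4 - 2 * \<mu>) * (th 0 j y * th 0 k y + th 1 j y * th 1 k y + \<mu> * (th 2 j y * th 2 k y))"
    using mu by simp
  then show ?thesis
    unfolding ric by (simp add: power2_eq_square algebra_simps)
qed

text \<open>Component \<open>i\<close> of the pullback of the coframe form \<open>cofr a\<close>
  under the map with components \<open>S\<close>.\<close>

definition pull :: "(nat \<Rightarrow> (nat \<Rightarrow> real) \<Rightarrow> real) \<Rightarrow> nat \<Rightarrow> nat \<Rightarrow> (nat \<Rightarrow> real) \<Rightarrow> real" where
  "pull S a i y = (\<Sum>k<3. partial_deriv i (S k) y * cofr a k (\<lambda>k. S k y))"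

lemma pull_smooth:
  assumes U: "openin (Euclidean_space 3) U" and S: "\<And>k. smooth_on 3 U (S k)" and i: "i < 3"
  shows "smooth_on 3 U (pull S a i)"
  unfolding pull_def[abs_def]
  by (intro smooth_on_sum[OF U] smooth_on_mult[OF U] smooth_on_partial_deriv smooth_cofr_compose[OF U] S i)

text \<open>Exterior derivatives commute with pullback, so the structure equations with the same
  constants are inherited. In coordinates: the terms with second derivatives of \<open>S\<close> are
  symmetric, and the rest is the symmetric tensor of \<open>cofr_structure\<close> contracted with
  first derivatives.\<close>

lemma pull_structure:
  assumes U: "openin (Euclidean_space 3) U" and S: "\<And>k. smooth_on 3 U (S k)"
    and S0: "\<And>k y. 3 \<le> k \<Longrightarrow> S k y = 0"
    and bij: "b < 3" "i < 3" "j < 3" and y: "y \<in> U"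
  shows "partial_deriv i (pull S b j) y + (\<Sum>a<3. \<Sum>d<3. om \<mu> a d b * pull S a i y * pull S d j y)
    = partial_deriv j (pull S b i) y + (\<Sum>a<3. \<Sum>d<3. om \<mu> a d b * pull S a j y * pull S d i y)"
proof -
  define X where "X = (\<lambda>m k. partial_deriv m (cofr b k) (\<lambda>k. S k y) + (\<Sum>a<3. \<Sum>d<3. om \<mu> a d b * cofr a m (\<lambda>k. S k y) * cofr d k (\<lambda>k. S k y)))"
  have Xsym: "X m k = X k m" if "m < 3" "k < 3" for m k
    unfolding X_def by (rule cofr_structure[OF bij(1) that])
  have SR: "(\<lambda>k. S k y) \<in> R3" for y using S0 by simp
  have has: "has_partial_deriv i (S k) y" if "i < 3" for i k
    by (rule smooth_on_imp_has_partial_deriv[OF S that y])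
  have *: "partial_deriv i (pull S b j) y + (\<Sum>a<3. \<Sum>d<3. om \<mu> a d b * pull S a i y * pull S d j y)
    = (\<Sum>m<3. \<Sum>k<3. X m k * (partial_deriv i (S m) y * partial_deriv j (S k) y))
      + (\<Sum>k<3. partial_deriv i (partial_deriv j (S k)) y * cofr b k (\<lambda>k. S k y))" if ij: "i < 3" "j < 3" for i j
  proof -
    have comp: "((\<lambda>t. cofr b k (\<lambda>k. S k (y(i := t)))) has_real_derivative
        (\<Sum>m<3. partial_deriv m (cofr b k) (\<lambda>k. S k (y(i := y i))) * partial_deriv i (S m) y)) (at (y i))" for k
      by (rule has_derivative_along_curve[OF openin_R3 smooth_cofr[OF openin_R3]])
        (use SR S0 has[OF ij(1)] in \<open>auto simp: has_partial_deriv_iff\<close>)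
    note comp' = partial_derivI[of "\<lambda>y. cofr b k (\<lambda>k. S k y)" for k, OF comp, simplified]
    have "partial_deriv i (pull S b j) y = (\<Sum>k<3. partial_deriv i (partial_deriv j (S k)) y * cofr b k (\<lambda>k. S k y)
        + partial_deriv j (S k) y * (\<Sum>m<3. partial_deriv m (cofr b k) (\<lambda>k. S k y) * partial_deriv i (S m) y))"
      unfolding pull_def[abs_def]
      using smooth_on_imp_has_partial_deriv[OF smooth_on_partial_deriv[OF S ij(2)] ij(1) y]
      by (subst partial_deriv_sum_mult) (auto simp: comp')
    also have "\<dots> = (\<Sum>k<3. \<Sum>m<3. partial_deriv m (cofr b k) (\<lambda>k. S k y) * (partial_deriv i (S m) y * partial_deriv j (S k) y))
       + (\<Sum>k<3. partial_deriv i (partial_deriv j (S k)) y * cofr b k (\<lambda>k. S k y))"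
      by (simp add: sum.distrib sum_distrib_left mult_ac)
    also have "(\<Sum>k<3. \<Sum>m<3. partial_deriv m (cofr b k) (\<lambda>k. S k y) * (partial_deriv i (S m) y * partial_deriv j (S k) y))
      = (\<Sum>m<3. \<Sum>k<3. partial_deriv m (cofr b k) (\<lambda>k. S k y) * (partial_deriv i (S m) y * partial_deriv j (S k) y))"
      by (rule sum.swap)
    finally have 1: "partial_deriv i (pull S b j) y
      = (\<Sum>m<3. \<Sum>k<3. partial_deriv m (cofr b k) (\<lambda>k. S k y) * (partial_deriv i (S m) y * partial_deriv j (S k) y))
       + (\<Sum>k<3. partial_deriv i (partial_deriv j (S k)) y * cofr b k (\<lambda>k. S k y))" .
    have "(\<Sum>a<3. \<Sum>d<3. om \<mu> a d b * pull S a i y * pull S d j y)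
      = (\<Sum>m<3. \<Sum>k<3. (\<Sum>a<3. \<Sum>d<3. om \<mu> a d b * cofr a m (\<lambda>k. S k y) * cofr d k (\<lambda>k. S k y))
          * (partial_deriv i (S m) y * partial_deriv j (S k) y))"
      unfolding sum_contract2 pull_def by (simp only: mult.commute[of "partial_deriv _ _ _"])
    with 1 show ?thesis by (simp add: X_def distrib_right sum.distrib)
  qed
  have "(\<Sum>m<3. \<Sum>k<3. X m k * (partial_deriv i (S m) y * partial_deriv j (S k) y))
    = (\<Sum>m<3. \<Sum>k<3. X m k * (partial_deriv j (S m) y * partial_deriv i (S k) y))"
    by (subst sum.swap) (intro sum.cong refl, simp add: Xsym mult_ac)
  moreover have "partial_deriv i (partial_deriv j (S k)) y = partial_deriv j (partial_deriv i (S k)) y" for k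
    by (rule partial_deriv_commute[OF U S y bij(2,3)])
  ultimately show ?thesis unfolding *[OF bij(2,3)] *[OF bij(3,2)] by simp
qed

text \<open>A pulled back coframe that induces the same metric satisfies the same frame calculus
  with the same constants, so \<open>third_form_squared\<close> applies to it and to the original
  coframe alike.\<close>

lemma local_frame_pull:
  assumes U: "openin (Euclidean_space 3) U" and S: "\<And>k. smooth_on 3 U (S k)"
    and S0: "\<And>k y. 3 \<le> k \<Longrightarrow> S k y = 0" and g: "g \<in> S3" and mu: "\<mu> > 0"
    and iso: "\<And>i j y. i < 3 \<Longrightarrow> j < 3 \<Longrightarrow> y \<in> U \<Longrightarrow>
      (\<Sum>a<3. lam \<mu> a * pull S a i y * pull S a j y) = (\<Sum>a<3. lam \<mu> a * cofr a i y * cofr a j y)"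
  shows "\<exists>E. local_frame (berger \<mu>) (gnomonic g) U 3 (pull S) E (lam \<mu>) (om \<mu>)"
proof -
  interpret base: local_frame "berger \<mu>" "gnomonic g" R3 3 cofr fr "lam \<mu>" "om \<mu>"
    by (rule local_frame_berger[OF g mu])
  \<comment> \<open>The inverse metric. Raising the indices of the weighted pulled back forms with
    it gives a dual frame that is visibly smooth.\<close>
  define ginv where "ginv = (\<lambda>k l y. \<Sum>b<3. fr b k y * fr b l y * (1 / lam \<mu> b))"
  define E where "E = (\<lambda>a k y. \<Sum>l<3. ginv k l y * (lam \<mu> a * pull S a l y))"
  have UR: "y \<in> R3" if "y \<in> U" for y using U that by (auto simp: openin_Euclidean_space_iff)
  have gg: "(\<Sum>m<3. ginv k m y * (\<Sum>a<3. lam \<mu> a * cofr a m y * cofr a l y)) = (if k = l then 1 else 0)"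
    if "k < 3" "l < 3" for k l y
  proof -
    have "(\<Sum>m<3. ginv k m y * (\<Sum>a<3. lam \<mu> a * cofr a m y * cofr a l y))
      = (\<Sum>m<3. \<Sum>b<3. \<Sum>a<3. (fr b k y * cofr a l y * (lam \<mu> a / lam \<mu> b)) * (cofr a m y * fr b m y))"
      unfolding ginv_def sum_product by (simp add: mult_ac)
    also have "\<dots> = (\<Sum>b<3. \<Sum>a<3. (fr b k y * cofr a l y * (lam \<mu> a / lam \<mu> b)) * (\<Sum>m<3. cofr a m y * fr b m y))"
      unfolding sum_distrib_left by (rule sum_swap3[symmetric])
    also have "\<dots> = (\<Sum>b<3. \<Sum>a<3. (if a = b then 1 else 0) * (fr b k y * cofr a l y * (lam \<mu> a / lam \<mu> b)))"
      by (intro sum.cong refl) (simp add: cofr_fr)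
    also have "\<dots> = (\<Sum>b<3. fr b k y * cofr b l y)"
      by (intro sum.cong refl, subst sum_delta_left(1)) (use base.la in auto)
    finally show ?thesis using fr_cofr[OF that] by simp
  qed
  have E_th: "(\<Sum>a<3. E a k y * pull S a l y) = (if k = l then 1 else 0)" if "k < 3" "l < 3" "y \<in> U" for k l y
  proof -
    have "(\<Sum>a<3. E a k y * pull S a l y) = (\<Sum>a<3. \<Sum>m<3. ginv k m y * (lam \<mu> a * pull S a m y * pull S a l y))"
      by (simp add: E_def sum_distrib_right sum_distrib_left mult_ac)
    also have "\<dots> = (\<Sum>m<3. ginv k m y * (\<Sum>a<3. lam \<mu> a * pull S a m y * pull S a l y))"
      unfolding sum_distrib_left by (rule sum.swap)
    also have "\<dots> = (\<Sum>m<3. ginv k m y * (\<Sum>a<3. lam \<mu> a * cofr a m y * cofr a l y))"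
      using that by (intro sum.cong) (auto simp: iso)
    finally show ?thesis using gg that by simp
  qed
  have "local_frame (berger \<mu>) (gnomonic g) U 3 (pull S) E (lam \<mu>) (om \<mu>)"
  proof
    show "smooth_on 3 U (E a i)" if "a < 3" "i < 3" for a i
      unfolding E_def ginv_def
      by (intro smooth_on_sum[OF U] smooth_on_mult[OF U] smooth_fr[OF U] smooth_on_const[OF U] pull_smooth[OF U S]) auto
    show "(\<Sum>k<3. pull S a k y * E b k y) = (if a = b then 1 else 0)" if "a < 3" "b < 3" "y \<in> U" for a b y
      by (rule left_inverse_imp_right_inverse_3[where A = "\<lambda>a k. pull S a k y" and B = "\<lambda>k a. E a k y"]) (use E_th that in auto)
    show "metric_comp (berger \<mu>) (gnomonic g) i j y = (\<Sum>a<3. lam \<mu> a * pull S a i y * pull S a j y)"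
      if "i < 3" "j < 3" "y \<in> U" for i j y
      using that UR by (simp add: iso base.metric_frame)
    show "lam \<mu> b * om \<mu> a d b = - (lam \<mu> d * om \<mu> a b d)" if "a < 3" "b < 3" "d < 3" for a b d
      by (rule base.om_antisym[OF that])
    show "partial_deriv i (pull S b j) y + (\<Sum>a<3. \<Sum>d<3. om \<mu> a d b * pull S a i y * pull S d j y)
        = partial_deriv j (pull S b i) y + (\<Sum>a<3. \<Sum>d<3. om \<mu> a d b * pull S a j y * pull S d i y)"
      if "b < 3" "i < 3" "j < 3" "y \<in> U" for b i j y
      by (rule pull_structure[OF U S S0 that])
  qed (auto simp: U E_th base.la intro: pull_smooth[OF U S])
  then show ?thesis by blast
qed

text \<open>In the chart centred at the image point, the differential of a coordinate vector has the
  pulled back forms as its components, so invariance of the metric becomes an identity between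
  coframes.\<close>

lemma isometry_pull:
  assumes iso: "isometry (berger \<mu>) f" and g: "g \<in> S3" and h: "h \<in> S3" and y: "y \<in> R3" "f (point g y) \<in> fst (gnomonic h)"
    and ij: "i < 3" "j < 3"
  shows "(\<Sum>a<3. lam \<mu> a * pull (\<lambda>k y. chart_map h (f (point g y)) k) a i y * pull (\<lambda>k y. chart_map h (f (point g y)) k) a j y)
    = (\<Sum>a<3. lam \<mu> a * cofr a i y * cofr a j y)"
proof -
  have f: "smooth_self_map (berger \<mu>) f" using iso by (simp add: isometry_def)
  define S where "S = (\<lambda>k y. chart_map h (f (point g y)) k)"
  define q where "q = point g y"
  have q: "q \<in> S3" "q \<in> fst (gnomonic g)" "chart_map g q = y"
    using g y by (simp_all add: q_def point_in_S3 point_in_gnomonic chart_map_point)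
  have r: "f q \<in> S3" "f q \<in> fst (gnomonic h)" using self_map_in[OF f q(1)] y(2) by (simp_all add: q_def)
  let ?t = "qmul (qconj (f q)) h" and ?U = "R3 \<inter> {y. f (point g y) \<in> fst (gnomonic h)}"
  have yU: "y \<in> ?U" using y by simp
  have Sy: "(\<lambda>k. S k y) = chart_map h (f q)" by (simp add: S_def q_def)
  \<comment> \<open>The coordinate vector \<partial>_i of the chart at \<open>g\<close>, written in
    the left-invariant frame.\<close>
  define v where "v = (\<lambda>i. comb \<mu> (\<lambda>a. cofr a i y) q)"
  have v: "v i \<in> tangent_space (berger \<mu>) q" for i unfolding v_def by (rule comb_in_tangent_space)
  have vk: "v i (gnomonic g) k = (if k = i then 1 else 0)" if "i < 3" "k < 3" for i k
    using q that g fr_cofr[of k i y] by (simp add: v_def comb_gnomonic mult.commute)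
  have d: "differential (berger \<mu>) f q (v i) (gnomonic (f q)) a = pull S a i y" if i: "i < 3" and a: "a < 3" for i a
  proof -
    have tn: "qmul ?t (lift (chart_map h (f q))) 0 > 0"
      using point_in_gnomonic_iff[OF h, of "chart_map h (f q)" "f q"] point_chart_map[OF h r(2)] self_in_gnomonic[OF r(1)] by simp
    have "differential (berger \<mu>) f q (v i) (gnomonic (f q)) a
      = (\<Sum>j<3. (if j = i then 1 else 0) * partial_deriv j (\<lambda>y. chart_map (f q) (f (point g y)) a) y)"
      using differential_berger[OF f g q(2) r(1) self_in_gnomonic[OF r(1)] a v] i q(3)
      by (simp add: vk mult.commute cong: sum.cong_simp)
    also have "\<dots> = partial_deriv i (\<lambda>y. chart_map (f q) (f (point g y)) a) y"
      using i by (rule sum_delta_left)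
    also have "\<dots> = partial_deriv i (\<lambda>y. trans_map ?t (\<lambda>k. S k y) a) y"
    proof (rule partial_deriv_cong(1)[OF openin_self_map_domain[OF f g] yU i])
      fix z assume "z \<in> ?U"
      then have "point h (\<lambda>k. S k z) = f (point g z)"
        unfolding S_def using point_chart_map[OF h] by simp
      then show "chart_map (f q) (f (point g z)) a = trans_map ?t (\<lambda>k. S k z) a"
        using chart_map_point_trans[of "f q" h "\<lambda>k. S k z"] by simp
    qed
    also have "\<dots> = (\<Sum>k<3. partial_deriv k (\<lambda>x. trans_map ?t x a) (\<lambda>k. S k (y(i := y i))) * partial_deriv i (S k) y)"
    proof (rule partial_derivI(1), rule has_derivative_along_curve[OF openin_overlap trans_map_smooth[OF openin_overlap _ a]])
      show "(\<lambda>k. S k (y(i := y i))) \<in> R3 \<inter> {y. 0 < qmul ?t (lift y) 0}"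
        using tn chart_map_R3[of h "f q"] by (simp add: Sy)
      show "S k (y(i := s)) = 0" if "3 \<le> k" for s k using that by (simp add: S_def chart_map_def)
      show "((\<lambda>s. S k (y(i := s))) has_real_derivative partial_deriv i (S k) y) (at (y i))" for k
        using smooth_on_imp_has_partial_deriv[OF self_map_smooth[OF f g h] i yU]
        unfolding S_def has_partial_deriv_iff .
    qed auto
    also have "\<dots> = (\<Sum>k<3. partial_deriv i (S k) y * cofr a k (\<lambda>k. S k y))"
    proof (rule sum.cong[OF refl])
      fix k :: nat assume k: "k \<in> {..<3}"
      have "partial_deriv k (\<lambda>x. trans_map ?t x a) (chart_map h (f q)) = cofr a k (chart_map h (f q))"
        using transition_to_center[OF r(2) h _ a] partial_deriv_transition[OF h chart_map_R3] k by simp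
      then show "partial_deriv k (\<lambda>x. trans_map ?t x a) (\<lambda>k. S k (y(i := y i))) * partial_deriv i (S k) y
        = partial_deriv i (S k) y * cofr a k (\<lambda>k. S k y)" by (simp add: Sy)
    qed
    finally show ?thesis by (simp add: pull_def)
  qed
  have "(\<Sum>a<3. lam \<mu> a * pull S a i y * pull S a j y)
    = metric (berger \<mu>) (f q) (differential (berger \<mu>) f q (v i)) (differential (berger \<mu>) f q (v j))"
    using ij by (simp add: d cong: sum.cong_simp)
  also have "\<dots> = metric (berger \<mu>) q (v i) (v j)"
    using iso q(1) v unfolding isometry_def by (metis berger_simps(1))
  also have "\<dots> = (\<Sum>a<3. lam \<mu> a * cofr a i y * cofr a j y)"
    unfolding v_def by (rule metric_comb[OF q(1)])
  finally show ?thesis unfolding S_def .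
qed

text \<open>If \<open>s\<close> were a geodesic symmetry at \<open>p\<close>, then \<open>s\<^sup>*\<theta>\<^sub>3 = - \<theta>\<^sub>3\<close> near \<open>p\<close>, since \<open>\<theta>\<^sub>3 \<otimes> \<theta>\<^sub>3\<close> is determined by the
  metric. But \<open>s\<^sup>*\<close> is the identity on 2-forms at \<open>p\<close>, and \<open>d\<theta>\<^sub>3\<close> does not vanish.\<close>

lemma not_symmetric_berger:
  assumes mu: "\<mu> > 0" "\<mu> \<noteq> 1"
  shows "\<not> symmetric_space (berger \<mu>)"
proof
  assume sym: "symmetric_space (berger \<mu>)"
  define p :: "nat \<Rightarrow> real" where "p = (\<lambda>n. if n = 0 then 1 else 0)"
  have p: "p \<in> S3" by (simp add: p_def S3_def)
  obtain s where iso: "isometry (berger \<mu>) s" and sp: "s p = p"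
    and ds: "\<And>v. v \<in> tangent_space (berger \<mu>) p \<Longrightarrow> differential (berger \<mu>) s p v = lincomb (- 1) v 0 v"
    using sym p unfolding symmetric_space_def by auto
  have sm: "smooth_self_map (berger \<mu>) s" using iso by (simp add: isometry_def)
  define S where "S = (\<lambda>k y. chart_map p (s (point p y)) k)"
  define U where "U = R3 \<inter> {y. s (point p y) \<in> fst (gnomonic p)}"
  let ?o = "\<lambda>k::nat. 0::real"
  have U: "openin (Euclidean_space 3) U" unfolding U_def by (rule openin_self_map_domain[OF sm p])
  have Ssm: "smooth_on 3 U (S k)" for k unfolding U_def S_def by (rule self_map_smooth[OF sm p p])
  have S0: "S k y = 0" if "3 \<le> k" for k y using that by (simp add: S_def chart_map_def)
  have "\<exists>E. local_frame (berger \<mu>) (gnomonic p) U 3 (pull S) E (lam \<mu>) (om \<mu>)"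
    by (rule local_frame_pull[OF U Ssm S0 p mu(1)]) (auto simp: S_def U_def intro!: isometry_pull[OF iso p p])
  then obtain E where fr: "local_frame (berger \<mu>) (gnomonic p) U 3 (pull S) E (lam \<mu>) (om \<mu>)" ..
  have po: "point p ?o = p"
    using point_chart_map[OF p self_in_gnomonic[OF p]] by (simp add: chart_map_self[OF p])
  have oU: "?o \<in> U" using self_in_gnomonic[OF p] by (simp add: U_def po sp)
  have So: "(\<lambda>k. S k ?o) = ?o" by (simp add: S_def po sp chart_map_self[OF p])
  have dS: "partial_deriv i (S k) ?o = (if i = k then - 1 else 0)" if "i < 3" "k < 3" for i k
  proof -
    define v where "v = comb \<mu> (\<lambda>a. if a = i then 1 else 0) p"
    have v: "v \<in> tangent_space (berger \<mu>) p" unfolding v_def by (rule comb_in_tangent_space)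
    have vj: "v (gnomonic p) j = (if j = i then 1 else 0)" if "j < 3" for j
      using that by (simp add: v_def comb_center[OF p])
    have "- v (gnomonic p) k = (\<Sum>j<3. partial_deriv j (S k) ?o * v (gnomonic p) j)"
      using differential_berger[OF sm p self_in_gnomonic[OF p] p _ that(2) v] ds[OF v] sp self_in_gnomonic[OF p]
      by (simp add: lincomb_def chart_map_self[OF p] S_def)
    also have "\<dots> = (\<Sum>j<3. (if j = i then 1 else 0) * partial_deriv j (S k) ?o)"
      by (intro sum.cong refl) (simp add: vj)
    also have "\<dots> = partial_deriv i (S k) ?o" by (rule sum_delta_left[OF that(1)])
    finally show ?thesis using vj[OF that(2)] by (auto split: if_splits)
  qed
  have pull_o: "pull S a i ?o = (if a = i then - 1 else 0)" if "a < 3" "i < 3" for a i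
  proof -
    have "pull S a i ?o = (\<Sum>k<3. (if k = i then 1 else 0) * (if a = k then - 1 else 0))"
      unfolding pull_def So by (intro sum.cong refl) (use that in \<open>simp add: dS cofr_zero\<close>)
    then show ?thesis using that by (simp only: sum_delta_left)
  qed
  have sq: "pull S 2 j y * pull S 2 k y = cofr 2 j y * cofr 2 k y" if "j < 3" "k < 3" "y \<in> U" for j k y
  proof -
    have "y \<in> R3" using that by (simp add: U_def)
    from trans[OF third_form_squared[OF fr mu(1) that]
        third_form_squared[OF local_frame_berger[OF p mu(1)] mu(1) that(1,2) this, symmetric]]
    show ?thesis using mu by simp
  qed
  \<comment> \<open>Equality of squares determines the pulled back form up to sign. On this
    neighbourhood of the origin, where its last component stays negative, the sign is fixed to be
    minus.\<close>
  define N where "N = U \<inter> pull S 2 2 -` {..<0}"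
  have oN: "?o \<in> N" using oU pull_o[of 2 2] by (simp add: N_def)
  have "continuous_on U (pull S 2 2)"
    by (rule smooth_on_imp_continuous_on[OF pull_smooth[OF U Ssm]]) simp
  then have "openin (top_of_set U) N"
    unfolding N_def by (rule continuous_openin_preimage_gen) simp
  moreover have "openin (top_of_set R3) U" using U by (simp add: Euclidean_space_3)
  ultimately have N: "openin (Euclidean_space 3) N"
    unfolding Euclidean_space_3 by (rule openin_trans)
  have neg: "pull S 2 j y = - 1 * cofr 2 j y" if j: "j < 3" and y: "y \<in> N" for j y
  proof -
    have yU: "y \<in> U" and lt: "pull S 2 2 y < 0" using y by (auto simp: N_def)
    have pos: "cofr 2 2 y > 0" using den_pos[of y] by (simp add: cofr_def cofr_num_def cross_def)
    have "(pull S 2 2 y - cofr 2 2 y) * (pull S 2 2 y + cofr 2 2 y) = 0"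
      using sq[of 2 2 y] yU by (simp add: algebra_simps)
    then have "pull S 2 2 y = - cofr 2 2 y" using lt pos by auto
    \<comment> \<open>The mixed product with the component 2, whose sign is now known, transfers the
      sign to the component \<open>j\<close>.\<close>
    then have "(pull S 2 j y + cofr 2 j y) * cofr 2 2 y = 0"
      using sq[OF j _ yU, of 2] by (simp add: algebra_simps)
    then show ?thesis using pos by auto
  qed
  have d: "partial_deriv i (pull S 2 j) ?o = - partial_deriv i (cofr 2 j) ?o" if "i < 3" "j < 3" for i j
  proof -
    have "partial_deriv i (pull S 2 j) ?o = partial_deriv i (\<lambda>y. - 1 * cofr 2 j y) ?o"
      by (rule partial_deriv_cong(1)[OF N oN that(1) neg[OF that(2)]])
    also have "\<dots> = partial_deriv i (\<lambda>y. - 1) ?o * cofr 2 j ?o + - 1 * partial_deriv i (cofr 2 j) ?o"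
      by (rule partial_deriv_mult(1)[OF partial_deriv_const(1)
            smooth_on_imp_has_partial_deriv[OF smooth_cofr[OF openin_R3] that(1)]]) simp
    also have "\<dots> = - partial_deriv i (cofr 2 j) ?o"
      by (simp add: partial_deriv_const(2))
    finally show ?thesis .
  qed
  \<comment> \<open>At the origin the two coframes are plus and minus the identity, so the quadratic
    terms of the structure equations agree while the derivative terms are opposite. The exterior
    derivative would equal -2 and 2 at once.\<close>
  have "partial_deriv 0 (cofr 2 1) ?o + 2 = partial_deriv 1 (cofr 2 0) ?o"
    using cofr_structure[of 2 0 1 ?o \<mu>] by (simp add: sum_three cofr_zero om_def)
  moreover have "partial_deriv 0 (pull S 2 1) ?o + 2 = partial_deriv 1 (pull S 2 0) ?o"
    using pull_structure[where S = S and b = 2 and i = 0 and j = 1 and \<mu> = \<mu>, OF U Ssm S0 _ _ _ oU] by (simp add: sum_three pull_o om_def)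
  ultimately show False using d[of 0 1] d[of 1 0] by simp
qed

lemma berger_properties:
  assumes "\<mu> > 0" "\<mu> \<noteq> 1"
  shows "riemannian_manifold (berger \<mu>) \<and> compact (points (berger \<mu>)) \<and> simply_connected (points (berger \<mu>)) \<and>
    \<not> symmetric_space (berger \<mu>) \<and>
    (\<forall>I \<gamma>. unit_geodesic (berger \<mu>) I \<gamma> \<longrightarrow>
      (\<exists>J. normal_jacobi_field (berger \<mu>) I \<gamma> J \<and>
        (\<forall>t\<in>I. lin_indep (velocity (berger \<mu>) \<gamma> t) (J t) \<and> sec (berger \<mu>) (\<gamma> t) (velocity (berger \<mu>) \<gamma> t) (J t) = 1)))"
  using assms
  by (simp add: riemannian_berger compact_S3 simply_connected_S3 not_symmetric_berger jacobi_exists del: berger_simps(4))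

theorem mainTheorem4:
  shows
    "(\<exists>M :: (nat \<Rightarrow> real) riemannian.
        riemannian_manifold M \<and> compact (points M) \<and> simply_connected (points M) \<and>
        \<not> symmetric_space M \<and> sec_le M 1 \<and>
        (\<forall>I \<gamma>. unit_geodesic M I \<gamma> \<longrightarrow>
           (\<exists>J. normal_jacobi_field M I \<gamma> J \<and>
                (\<forall>t\<in>I. lin_indep (velocity M \<gamma> t) (J t) \<and> sec M (\<gamma> t) (velocity M \<gamma> t) (J t) = 1)))) \<and>
     (\<exists>M :: (nat \<Rightarrow> real) riemannian.
        riemannian_manifold M \<and> compact (points M) \<and> simply_connected (points M) \<and>
        \<not> symmetric_space M \<and> sec_ge M 1 \<and>
        (\<forall>I \<gamma>. unit_geodesic M I \<gamma> \<longrightarrow>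
           (\<exists>J. normal_jacobi_field M I \<gamma> J \<and>
                (\<forall>t\<in>I. lin_indep (velocity M \<gamma> t) (J t) \<and> sec M (\<gamma> t) (velocity M \<gamma> t) (J t) = 1))))"
proof
  show "\<exists>M :: (nat \<Rightarrow> real) riemannian.
        riemannian_manifold M \<and> compact (points M) \<and> simply_connected (points M) \<and>
        \<not> symmetric_space M \<and> sec_le M 1 \<and>
        (\<forall>I \<gamma>. unit_geodesic M I \<gamma> \<longrightarrow>
           (\<exists>J. normal_jacobi_field M I \<gamma> J \<and>
                (\<forall>t\<in>I. lin_indep (velocity M \<gamma> t) (J t) \<and> sec M (\<gamma> t) (velocity M \<gamma> t) (J t) = 1)))"
    \<comment> \<open>Any parameter above 1 would serve here, and any parameter strictly between 0
      and 1 in the second half.\<close>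
    using berger_properties[of 2] sec_bounds(1)[of 2] by (intro exI[of _ "berger 2"]) simp
  show "\<exists>M :: (nat \<Rightarrow> real) riemannian.
        riemannian_manifold M \<and> compact (points M) \<and> simply_connected (points M) \<and>
        \<not> symmetric_space M \<and> sec_ge M 1 \<and>
        (\<forall>I \<gamma>. unit_geodesic M I \<gamma> \<longrightarrow>
           (\<exists>J. normal_jacobi_field M I \<gamma> J \<and>
                (\<forall>t\<in>I. lin_indep (velocity M \<gamma> t) (J t) \<and> sec M (\<gamma> t) (velocity M \<gamma> t) (J t) = 1)))"
    using berger_properties[of "1 / 2"] sec_bounds(2)[of "1 / 2"] by (intro exI[of _ "berger (1 / 2)"]) simp
qed

end
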